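(* Let $n\ge 1$ and $0\le m\le n-1$ be integers, let $\Lambda\subset\mathbf{R}^n$ be an $m$-dimensional hyperplane, $w\in\Lambda$, $p\in(n-m,\infty]$ with $p>1$, and let $\beta=\frac{p-n+m}{p-1}$ if $p<\infty$ and $\beta=1$ if $p=\infty$. Let $\Omega\subset\mathbf{R}^n$ be an unbounded domain with $\Lambda\cap\Omega=\emptyset$. Suppose that $u$ is $p$-subharmonic in $\Omega$ and that $$\limsup_{x\to y,\ x\in\Omega}u(x)\le 0\qquad\text{for all } y\in\partial\Omega.$$ Then either $u\le 0$ in $\Omega$, or $$\liminf_{R\to\infty}\frac{M(R)}{R^\beta}>0,\qquad\text{where } M(R)=\sup_{\partial B(w,R)\cap\Omega}u.$$
   Context: A domain is an open connected set; an $m$-dimensional hyperplane is an $m$-dimensional affine subspace of $\mathbf{R}^n$ (a point if $m=0$); $B(w,R)$ is the open ball; boundaries are taken in $\mathbf{R}^n$. For $p\in(1,\infty)$, $u\in W^{1,p}_{loc}(\Omega)$ is a weak subsolution of the $p$-Laplace equation in $\Omega$ if $\int_\Omega|\nabla u|^{p-2}\langle\nabla u,\nabla\theta\rangle\,dx\le 0$ for all non-negative $\theta\in C_0^\infty(\Omega)$. For $p=\infty$, with $\Delta_\infty\psi=\sum_{i,j}\psi_{x_i}\psi_{x_j}\psi_{x_ix_j}$, an upper semicontinuous $u:\Omega\to\mathbf{R}$ is a (viscosity) subsolution if for every $\psi\in C^2(\Omega)$ such that $u-\psi$ has a local maximum at $x_0\in\Omega$ one has $\Delta_\infty\psi(x_0)\ge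 0$. A function $u$ is $p$-subharmonic in $\Omega$, $p\in(1,\infty]$, if it is an upper semicontinuous subsolution (weak if $p<\infty$, viscosity if $p=\infty$) in $\Omega$.
   Formalization: For p<∞ a p-subharmonic u is real-valued and taken as its canonical representative, u(x) = ess limsup of u(y) as y→x, at every x in Ω; for arbitrary upper semicontinuous representatives the claim fails (e.g. the indicator function of one point). *)

theory Defs
  imports "HOL-Analysis.Analysis" "HOL-Probability.Essential_Supremum"
begin

definition partial_deriv :: "'n \<Rightarrow> (real ^ 'n \<Rightarrow> real) \<Rightarrow> real ^ 'n \<Rightarrow> real" where
  "partial_deriv i f x = frechet_derivative f (at x) (axis i 1)"

definition gradient :: "(real ^ 'n \<Rightarrow> real) \<Rightarrow> real ^ 'n \<Rightarrow> real ^ 'n" where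
  "gradient f x = (\<chi> i. partial_deriv i f x)"

text \<open>The derivatives are taken in the ambient space, so the following is meant for open \<open>S\<close>.\<close>

fun Ck_on :: "nat \<Rightarrow> (real ^ 'n \<Rightarrow> real) \<Rightarrow> (real ^ 'n) set \<Rightarrow> bool" where
  "Ck_on 0 f S \<longleftrightarrow> continuous_on S f"
| "Ck_on (Suc k) f S \<longleftrightarrow>
     (\<forall>x\<in>S. f differentiable (at x)) \<and> (\<forall>i. Ck_on k (partial_deriv i f) S)"

definition test_fun :: "(real ^ 'n) set \<Rightarrow> (real ^ 'n \<Rightarrow> real) \<Rightarrow> bool" where
  "test_fun \<Omega> \<theta> \<longleftrightarrow>
     (\<forall>k. Ck_on k \<theta> UNIV) \<and>
     compact (closure {x. \<theta> x \<noteq> 0}) \<and> closure {x. \<theta> x \<noteq> 0} \<subseteq> \<Omega>"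

definition Lp_loc :: "real \<Rightarrow> (real ^ 'n) set \<Rightarrow> (real ^ 'n \<Rightarrow> 'b::euclidean_space) \<Rightarrow> bool" where
  "Lp_loc p \<Omega> f \<longleftrightarrow>
     f \<in> borel_measurable (lebesgue_on \<Omega>) \<and>
     (\<forall>K. compact K \<and> K \<subseteq> \<Omega> \<longrightarrow> set_integrable lebesgue K (\<lambda>x. norm (f x) powr p))"

definition weak_gradient ::
    "(real ^ 'n) set \<Rightarrow> (real ^ 'n \<Rightarrow> real) \<Rightarrow> (real ^ 'n \<Rightarrow> real ^ 'n) \<Rightarrow> bool" where
  "weak_gradient \<Omega> u G \<longleftrightarrow>
     (\<forall>\<theta> i. test_fun \<Omega> \<theta> \<longrightarrow>
        (LINT x:\<Omega>|lebesgue. u x * partial_deriv i \<theta> x) = - (LINT x:\<Omega>|lebesgue. G x $ i * \<theta> x))"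

text \<open>\<open>W1p_loc p \<Omega> u G\<close>: \<open>u\<close> lies in the local Sobolev space of exponent \<open>p\<close> on \<open>\<Omega>\<close>, and
  \<open>G\<close> is a version of its gradient (unique up to a null set).\<close>

definition W1p_loc ::
    "real \<Rightarrow> (real ^ 'n) set \<Rightarrow> (real ^ 'n \<Rightarrow> real) \<Rightarrow> (real ^ 'n \<Rightarrow> real ^ 'n) \<Rightarrow> bool" where
  "W1p_loc p \<Omega> u G \<longleftrightarrow> Lp_loc p \<Omega> u \<and> Lp_loc p \<Omega> G \<and> weak_gradient \<Omega> u G"

text \<open>For \<open>p \<le> 2\<close> the integrand vanishes wherever \<open>G x = 0\<close>, because \<open>0 powr a = 0\<close> for
  every \<open>a\<close>; this is the usual convention.\<close>

definition weak_subsolution :: "real \<Rightarrow> (real ^ 'n) set \<Rightarrow> (real ^ 'n \<Rightarrow> real) \<Rightarrow> bool" where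
  "weak_subsolution p \<Omega> u \<longleftrightarrow>
     (\<exists>G. W1p_loc p \<Omega> u G \<and>
        (\<forall>\<theta>. test_fun \<Omega> \<theta> \<and> (\<forall>x. 0 \<le> \<theta> x) \<longrightarrow>
           (LINT x:\<Omega>|lebesgue. norm (G x) powr (p - 2) * (G x \<bullet> gradient \<theta> x)) \<le> 0))"

definition infinity_laplacian :: "(real ^ 'n \<Rightarrow> real) \<Rightarrow> real ^ 'n \<Rightarrow> real" where
  "infinity_laplacian \<psi> x =
     (\<Sum>i\<in>UNIV. \<Sum>j\<in>UNIV. partial_deriv i \<psi> x * partial_deriv j \<psi> x *
        partial_deriv j (partial_deriv i \<psi>) x)"

definition viscosity_subsolution :: "(real ^ 'n) set \<Rightarrow> (real ^ 'n \<Rightarrow> real) \<Rightarrow> bool" where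
  "viscosity_subsolution \<Omega> u \<longleftrightarrow>
     (\<forall>\<psi> x0. Ck_on 2 \<psi> \<Omega> \<and> x0 \<in> \<Omega> \<and>
        (\<exists>r>0. \<forall>x\<in>ball x0 r \<inter> \<Omega>. u x - \<psi> x \<le> u x0 - \<psi> x0) \<longrightarrow>
        0 \<le> infinity_laplacian \<psi> x0)"

definition usc_on :: "(real ^ 'n) set \<Rightarrow> (real ^ 'n \<Rightarrow> real) \<Rightarrow> bool" where
  "usc_on \<Omega> u \<longleftrightarrow> (\<forall>c. openin (top_of_set \<Omega>) {x \<in> \<Omega>. u x < c})"

text \<open>A weak subsolution is determined only up to a null set, and upper semicontinuity alone does
  not fix its pointwise values: the function that is \<open>1\<close> at a single point and \<open>0\<close> elsewhere
  is an upper semicontinuous member of the class of \<open>0\<close>. As usual, an element of the Sobolev space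
  is represented by its upper semicontinuous regularisation,
  \<open>u x = ess limsup u y\<close> as \<open>y\<close> tends to \<open>x\<close>.\<close>

definition canonical_representative :: "(real ^ 'n) set \<Rightarrow> (real ^ 'n \<Rightarrow> real) \<Rightarrow> bool" where
  "canonical_representative \<Omega> u \<longleftrightarrow>
     (\<forall>x\<in>\<Omega>. ereal (u x) =
        (INF r\<in>{0<..}. esssup (lebesgue_on (ball x r \<inter> \<Omega>)) (\<lambda>y. ereal (u y))))"

text \<open>Viscosity subsolutions are defined pointwise, so no choice of representative is involved
  when \<open>p = \<infinity>\<close>.\<close>

definition p_subharmonic :: "ereal \<Rightarrow> (real ^ 'n) set \<Rightarrow> (real ^ 'n \<Rightarrow> real) \<Rightarrow> bool" where
  "p_subharmonic p \<Omega> u \<longleftrightarrow>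
     usc_on \<Omega> u \<and>
     (if p = \<infinity> then viscosity_subsolution \<Omega> u
      else weak_subsolution (real_of_ereal p) \<Omega> u \<and> canonical_representative \<Omega> u)"

definition growth_exponent :: "nat \<Rightarrow> nat \<Rightarrow> ereal \<Rightarrow> real" where
  "growth_exponent n m p =
     (if p = \<infinity> then 1
      else (real_of_ereal p - real n + real m) / (real_of_ereal p - 1))"

text \<open>Extended-real valued, with value \<open>-\<infinity>\<close> when the sphere misses \<open>\<Omega>\<close>.\<close>

definition sphere_sup ::
    "(real ^ 'n) set \<Rightarrow> (real ^ 'n \<Rightarrow> real) \<Rightarrow> real ^ 'n \<Rightarrow> real \<Rightarrow> ereal" where
  "sphere_sup \<Omega> u w R = (SUP x\<in>frontier (ball w R) \<inter> \<Omega>. ereal (u x))"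

end

theory Submission
  imports Defs
begin

text \<open>
The heart is a growth estimate whose constant \<open>C\<close> does not depend on \<open>R\<close> or \<open>L\<close>: if \<open>u \<le> L\<close> on the
part of the sphere of radius \<open>R\<close> about \<open>w\<close> that lies in \<open>\<Omega>\<close>, then \<open>u x \<le> L * C * (norm (x - w) / R) powr \<beta>\<close>
inside (\<open>growth_finite_exponent\<close>, \<open>growth_infinite_exponent\<close>). If the lower limit of \<open>M(R) / R\<^sup>\<beta>\<close> is
not positive, then for each \<open>\<eta> > 0\<close> there are arbitrarily large radii with \<open>M(R) < \<eta> * R\<^sup>\<beta>\<close>, and the
estimate turns into \<open>u x \<le> \<eta> * C * norm (x - w) powr \<beta>\<close>; hence \<open>u x \<le> 0\<close>.

The obvious comparison function is \<open>d powr \<beta>\<close>, where \<open>d\<close> is the distance to \<open>\<Lambda>\<close>: it is \<open>p\<close>-harmonic off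
\<open>\<Lambda>\<close>, being the fundamental solution of the \<open>p\<close>-Laplacian in the \<open>n - m\<close> variables normal to \<open>\<Lambda>\<close>. But
it is small on the part of the sphere that is close to \<open>\<Lambda>\<close>, where \<open>u\<close> is only known to be at most
\<open>L\<close>. The barrier, written for the unit ball in terms of \<open>s = d\<^sup>2\<close> and the squared length \<open>t\<close> of the
component along \<open>\<Lambda>\<close>, is \<open>A * s powr b - K * s powr c + t\<close> with \<open>b = \<beta> / 2 < c\<close>. The summand \<open>t\<close> lifts it to
at least \<open>1\<close> on the whole unit sphere, the term with \<open>K\<close> makes up for the positive contribution of
\<open>t\<close> to the \<open>p\<close>-Laplacian, and a large \<open>A\<close> keeps the gradient close to the normal direction, so that
this accounting remains valid. The barrier is still at most of order \<open>norm z powr \<beta>\<close>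
(\<open>barrier_constants\<close>, \<open>strict_supersolution_barrier\<close>).

For finite \<open>p\<close> the weak subsolution \<open>u\<close> has to be compared with a smooth strict supersolution \<open>v\<close>, given
that \<open>u < v\<close> outside a compact set. The natural test function, the positive part of \<open>u - v\<close>, is only a
Sobolev function. It is replaced by \<open>\<zeta> * H (u\<^sub>k - v)\<close>, with a cutoff \<open>\<zeta>\<close>, a bounded increasing \<open>C\<^sup>1\<close>
function \<open>H\<close> vanishing exactly on the nonpositive numbers, and mollifications \<open>u\<^sub>k\<close> of \<open>u\<close>. In the limit the
monotonicity of \<open>a \<mapsto> |a|\<^sup>p\<^sup>-\<^sup>2 a\<close> and the strictness of \<open>v\<close> leave no room for a set of positive measure
on which \<open>u > v\<close> (\<open>weak_comparison\<close>); the choice of the representative then gives \<open>u \<le> v\<close> at every point.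

For \<open>p = \<infinity>\<close> the functions \<open>norm (x - w) powr a\<close> with \<open>0 < a < 1\<close> are strict supersolutions away from \<open>w\<close>, and the
definition of a viscosity subsolution applies at a maximum point of the difference; then \<open>a\<close> tends to \<open>1\<close>.
\<close>

section \<open>Density of continuous functions in \<open>L\<^sup>1\<close>\<close>

lemma integral_lborel_affine:
  fixes f :: "'a::euclidean_space \<Rightarrow> 'b::{banach, second_countable_topology}"
  assumes "\<bar>c\<bar> = 1"
  shows "(LINT x|lborel. f (t + c *\<^sub>R x)) = (LINT x|lborel. f x)"
    and "integrable lborel (\<lambda>x. f (t + c *\<^sub>R x)) \<longleftrightarrow> integrable lborel f"
proof -
  have eq: "(lborel :: 'a measure) = distr lborel borel (\<lambda>x. t + c *\<^sub>R x)"
    using lborel_affine[of c t] assms by (auto simp: density_1)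
  have D: "(\<lambda>x. t + c *\<^sub>R x) \<in> measurable lborel (borel :: 'a measure)" by simp
  have meas: "f \<in> borel_measurable borel \<longleftrightarrow> (\<lambda>x. f (t + c *\<^sub>R x)) \<in> borel_measurable borel"
  proof
    assume "(\<lambda>x. f (t + c *\<^sub>R x)) \<in> borel_measurable borel"
    then have "(\<lambda>x. f (t + c *\<^sub>R x)) \<circ> (\<lambda>x. (1/c) *\<^sub>R (x - t)) \<in> borel_measurable borel"
      by (intro measurable_comp[where N=borel]) auto
    moreover have "(\<lambda>x. f (t + c *\<^sub>R x)) \<circ> (\<lambda>x. (1/c) *\<^sub>R (x - t)) = f"
      using assms by (auto simp: fun_eq_iff)
    ultimately show "f \<in> borel_measurable borel" by simp
  next
    assume "f \<in> borel_measurable borel"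
    then show "(\<lambda>x. f (t + c *\<^sub>R x)) \<in> borel_measurable borel" by measurable
  qed
  show I: "integrable lborel (\<lambda>x. f (t + c *\<^sub>R x)) \<longleftrightarrow> integrable lborel f"
  proof (cases "f \<in> borel_measurable borel")
    case True
    then show ?thesis
      by (subst (2) eq, subst integrable_distr_eq[OF D]) auto
  next
    case False
    then show ?thesis using meas by (auto dest!: borel_measurable_integrable)
  qed
  show "(LINT x|lborel. f (t + c *\<^sub>R x)) = (LINT x|lborel. f x)"
  proof (cases "f \<in> borel_measurable borel")
    case True
    then show ?thesis
      by (subst (2) eq, subst integral_distr[OF D]) auto
  next
    case False
    then have "\<not> integrable lborel f" by (auto dest!: borel_measurable_integrable)
    then show ?thesis using I by (simp add: not_integrable_integral_eq)
  qed
qed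

lemma LIMSEQ_ex_less:
  fixes X :: "nat \<Rightarrow> real"
  assumes "X \<longlonglongrightarrow> a" "a < b"
  shows "\<exists>n. X n < b"
  using order_tendstoD(2)[OF assms] by (auto simp: eventually_sequentially)

text \<open>A measurable function is almost everywhere a limit of continuous functions, but these need not be
bounded or have bounded support. Composing them with the radial retraction \<open>T n\<close> onto a ball and multiplying by
the cutoff \<open>c n\<close> supplies a dominating function; a second limit, in \<open>n\<close>, removes the truncation.\<close>

lemma L1_continuous_approx:
  fixes f :: "'a::euclidean_space \<Rightarrow> 'b::euclidean_space"
  assumes f: "integrable lborel f" and e: "e > 0"
  shows "\<exists>g. continuous_on UNIV g \<and> (\<exists>M. \<forall>x. M \<le> norm x \<longrightarrow> g x = 0) \<and>
    integrable lborel g \<and> (LINT x|lborel. norm (f x - g x)) < e"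
proof -
  define T :: "nat \<Rightarrow> 'b \<Rightarrow> 'b" where "T n y = (real n / max (real n) (norm y)) *\<^sub>R y" for n y
  define c :: "nat \<Rightarrow> 'a \<Rightarrow> real" where "c n x = max 0 (min 1 (real n - norm x))" for n x
  have [measurable]: "f \<in> borel_measurable borel" "T n \<in> borel_measurable borel" "c n \<in> borel_measurable borel" for n
    using f unfolding T_def c_def by (auto intro!: borel_measurable_scaleR)
  have Tn: "norm (T n y) \<le> norm y" "norm (T n y) \<le> real n" for n y
    by (auto simp: T_def divide_simps max_def mult_left_mono)
  have Tc: "continuous_on UNIV (T (Suc n))" for n
    unfolding T_def by (intro continuous_intros) (auto simp: max_def)
  have cb: "0 \<le> c n x" "c n x \<le> 1" for n x by (auto simp: c_def)
  have c0: "c n x = 0" if "real n \<le> norm x" for n x using that by (simp add: c_def)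
  have cc: "continuous_on UNIV (c n)" for n unfolding c_def by (intro continuous_intros)
  have cT: "norm (c n x *\<^sub>R T n y) \<le> norm y" "norm (c n x *\<^sub>R T n y) \<le> real n * indicator (cball 0 (real n)) x" for n x y
    using Tn[of n y] cb[of n x] c0[of n x] mult_left_le_one_le[of "norm (T n y)" "c n x"]
    by (auto simp: indicator_def)
  have "(\<lambda>n. LINT x|lborel. norm (f x - c (Suc n) x *\<^sub>R T (Suc n) (f x))) \<longlonglongrightarrow> (LINT x::'a|lborel. 0)"
  proof (rule integral_dominated_convergence)
    show "integrable lborel (\<lambda>x. 2 * norm (f x))" using f by auto
    show "AE x in lborel. norm (norm (f x - c (Suc n) x *\<^sub>R T (Suc n) (f x))) \<le> 2 * norm (f x)" for n
    proof (intro AE_I2)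
      fix x show "norm (norm (f x - c (Suc n) x *\<^sub>R T (Suc n) (f x))) \<le> 2 * norm (f x)"
        using cT(1)[of "Suc n" x "f x"] norm_triangle_ineq4[of "f x" "c (Suc n) x *\<^sub>R T (Suc n) (f x)"] by simp
    qed
    show "AE x in lborel. (\<lambda>n. norm (f x - c (Suc n) x *\<^sub>R T (Suc n) (f x))) \<longlonglongrightarrow> 0"
    proof (intro AE_I2)
      fix x
      obtain N where N: "norm x + norm (f x) + 1 \<le> real N" using real_arch_simple by blast
      have "norm (f x - c (Suc n) x *\<^sub>R T (Suc n) (f x)) = 0" if "n \<ge> N" for n
      proof -
        have "norm x + norm (f x) + 1 \<le> real (Suc n)" using N that by linarith
        moreover have "0 \<le> norm x" "0 \<le> norm (f x)" by simp_all
        ultimately have "norm x + 1 \<le> real (Suc n)" "norm (f x) \<le> real (Suc n)" by linarith+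
        then have "c (Suc n) x = 1" "max (real (Suc n)) (norm (f x)) = real (Suc n)" by (simp_all add: c_def)
        then show ?thesis by (simp add: T_def del: of_nat_Suc)
      qed
      then show "(\<lambda>n. norm (f x - c (Suc n) x *\<^sub>R T (Suc n) (f x))) \<longlonglongrightarrow> 0"
        by (intro tendsto_eventually) (auto simp: eventually_sequentially)
    qed
  qed auto
  then have "\<exists>n. (LINT x|lborel. norm (f x - c (Suc n) x *\<^sub>R T (Suc n) (f x))) < e / 2"
    using e by (intro LIMSEQ_ex_less) auto
  then obtain k where k: "(LINT x|lborel. norm (f x - c (Suc k) x *\<^sub>R T (Suc k) (f x))) < e / 2" by blast
  let ?n = "Suc k"
  have "f \<in> borel_measurable lebesgue" by (intro measurable_completion) simp
  then have "f measurable_on UNIV" by (simp add: lebesgue_measurable_imp_measurable_on)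
  then have "\<exists>N g. negligible N \<and> (\<forall>i. continuous_on UNIV (g i)) \<and> (\<forall>x. x \<notin> N \<longrightarrow> (\<lambda>i. g i x) \<longlonglongrightarrow> f x)"
    unfolding measurable_on_def by simp
  then obtain N g where N: "negligible N" and g: "\<And>i. continuous_on UNIV (g i)" "\<And>x. x \<notin> N \<Longrightarrow> (\<lambda>i. g i x) \<longlonglongrightarrow> f x"
    by blast
  have ae: "AE x in lborel. x \<notin> N"
    using AE_not_in[of N lebesgue] N unfolding negligible_iff_null_sets AE_completion_iff by blast
  define h where "h i x = c ?n x *\<^sub>R T ?n (g i x)" for i x
  have hc: "continuous_on UNIV (h i)" for i
    unfolding h_def by (intro continuous_on_scaleR cc continuous_on_compose2[OF Tc g(1)]) auto
  then have [measurable]: "h i \<in> borel_measurable borel" for i by (rule borel_measurable_continuous_onI)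
  have i1: "integrable lborel (\<lambda>x::'a. real ?n * indicator (cball 0 (real ?n)) x :: real)"
    by (intro integrable_mult_right integrable_real_indicator emeasure_bounded_finite) auto
  have hi: "integrable lborel (h i)" for i
  proof (rule Bochner_Integration.integrable_bound[OF i1])
    show "AE x in lborel. norm (h i x) \<le> norm (real ?n * indicator (cball 0 (real ?n)) x)"
      unfolding h_def real_norm_def using order_trans[OF cT(2) abs_ge_self] by (rule AE_I2)
  qed simp
  have fi: "integrable lborel (\<lambda>x. c ?n x *\<^sub>R T ?n (f x))"
    by (rule Bochner_Integration.integrable_bound[OF f]) (use cT(1) in auto)
  have "(\<lambda>i. LINT x|lborel. norm (c ?n x *\<^sub>R T ?n (f x) - h i x)) \<longlonglongrightarrow> (LINT x::'a|lborel. 0)"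
  proof (rule integral_dominated_convergence)
    show "integrable lborel (\<lambda>x::'a. 2 * (real ?n * indicator (cball 0 (real ?n)) x) :: real)"
      using i1 by (rule integrable_mult_right)
    show "AE x in lborel. norm (norm (c ?n x *\<^sub>R T ?n (f x) - h i x)) \<le> 2 * (real ?n * indicator (cball 0 (real ?n)) x)" for i
    proof (intro AE_I2)
      fix x show "norm (norm (c ?n x *\<^sub>R T ?n (f x) - h i x)) \<le> 2 * (real ?n * indicator (cball 0 (real ?n)) x)"
        using cT(2)[of ?n x "f x"] cT(2)[of ?n x "g i x"] norm_triangle_ineq4[of "c ?n x *\<^sub>R T ?n (f x)" "h i x"]
        unfolding h_def real_norm_def abs_norm_cancel by linarith
    qed
    show "AE x in lborel. (\<lambda>i. norm (c ?n x *\<^sub>R T ?n (f x) - h i x)) \<longlonglongrightarrow> 0"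
      using ae
    proof eventually_elim
      case (elim x)
      have "isCont (T ?n) (f x)" using Tc by (auto simp: continuous_on_eq_continuous_at)
      then have "(\<lambda>i. T ?n (g i x)) \<longlonglongrightarrow> T ?n (f x)" by (rule isCont_tendsto_compose[OF _ g(2)[OF elim]])
      then have "(\<lambda>i. norm (c ?n x *\<^sub>R T ?n (f x) - h i x)) \<longlonglongrightarrow> norm (c ?n x *\<^sub>R T ?n (f x) - c ?n x *\<^sub>R T ?n (f x))"
        unfolding h_def by (intro tendsto_intros)
      then show ?case by simp
    qed
  qed auto
  then have "\<exists>i. (LINT x|lborel. norm (c ?n x *\<^sub>R T ?n (f x) - h i x)) < e / 2"
    using e by (intro LIMSEQ_ex_less) auto
  then obtain i where i: "(LINT x|lborel. norm (c ?n x *\<^sub>R T ?n (f x) - h i x)) < e / 2" by blast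
  have "(LINT x|lborel. norm (f x - h i x)) \<le>
    (LINT x|lborel. norm (f x - c ?n x *\<^sub>R T ?n (f x)) + norm (c ?n x *\<^sub>R T ?n (f x) - h i x))"
    using f fi hi by (intro integral_mono) (auto intro: norm_diff_triangle_le)
  also have "\<dots> = (LINT x|lborel. norm (f x - c ?n x *\<^sub>R T ?n (f x))) + (LINT x|lborel. norm (c ?n x *\<^sub>R T ?n (f x) - h i x))"
    using f fi hi by (intro Bochner_Integration.integral_add) auto
  also have "\<dots> < e" using k i by simp
  finally have "(LINT x|lborel. norm (f x - h i x)) < e" .
  moreover have "\<forall>x. real ?n \<le> norm x \<longrightarrow> h i x = 0" using c0 by (simp add: h_def)
  ultimately show ?thesis using hc hi by blast
qed

section \<open>Convolution with mollifiers\<close>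

text \<open>\<open>\<phi>\<close> is continuously differentiable with gradient field \<open>g\<close> and vanishes off \<open>K\<close>. For compact \<open>K\<close> these are
the \<open>C\<^sup>1\<close> test functions; carrying the gradient as an argument avoids recomputing it.\<close>

definition C1c :: "'a::euclidean_space set \<Rightarrow> ('a \<Rightarrow> real) \<Rightarrow> ('a \<Rightarrow> 'a) \<Rightarrow> bool" where
  "C1c K \<phi> g \<longleftrightarrow> (\<forall>x. (\<phi> has_derivative (\<lambda>h. g x \<bullet> h)) (at x)) \<and>
     continuous_on UNIV g \<and> (\<forall>x. x \<notin> K \<longrightarrow> \<phi> x = 0)"

definition kernel :: "real \<Rightarrow> ('a::euclidean_space \<Rightarrow> 'b::euclidean_space) \<Rightarrow> bool" where
  "kernel d r \<longleftrightarrow> continuous_on UNIV r \<and> (\<forall>x. d \<le> norm x \<longrightarrow> r x = 0)"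

definition mollifier :: "real \<Rightarrow> ('a::euclidean_space \<Rightarrow> real) \<Rightarrow> bool" where
  "mollifier d r \<longleftrightarrow> kernel d r \<and> (\<forall>x. 0 \<le> r x) \<and> (LINT x|lborel. r x) = 1"

definition convol :: "('a::euclidean_space \<Rightarrow> 'b::euclidean_space) \<Rightarrow> ('a \<Rightarrow> real) \<Rightarrow> 'a \<Rightarrow> 'b" where
  "convol f r x = (LINT y|lborel. r (x - y) *\<^sub>R f y)"

lemma kernel_bounded:
  fixes r :: "'a::euclidean_space \<Rightarrow> 'b::euclidean_space"
  assumes "kernel d r" obtains B where "B > 0" "\<And>x. norm (r x) \<le> B"
proof -
  have "compact (r ` cball 0 d)"
    using assms by (intro compact_continuous_image) (auto simp: kernel_def intro: continuous_on_subset)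
  then obtain B where B: "\<And>x. x \<in> cball 0 d \<Longrightarrow> norm (r x) \<le> B"
    by (metis bounded_iff compact_imp_bounded imageI)
  have "norm (r x) \<le> max 1 B" for x
    using B[of x] assms by (cases "d \<le> norm x") (auto simp: kernel_def)
  then show ?thesis by (intro that[of "max 1 B"]) auto
qed

lemma kernel_measurable:
  fixes r :: "'a::euclidean_space \<Rightarrow> 'b::euclidean_space"
  shows "kernel d r \<Longrightarrow> r \<in> borel_measurable borel"
  by (auto simp: kernel_def intro!: borel_measurable_continuous_onI)

lemma integrable_indicator_bounded:
  "bounded (A :: 'a::euclidean_space set) \<Longrightarrow> A \<in> sets borel \<Longrightarrow> integrable lborel (indicator A :: 'a \<Rightarrow> real)"
  by (auto intro!: integrable_real_indicator emeasure_bounded_finite)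

lemma kernel_integrable:
  fixes r :: "'a::euclidean_space \<Rightarrow> 'b::euclidean_space"
  assumes "kernel d r" shows "integrable lborel r"
proof -
  obtain B where B: "B > 0" "\<And>x. norm (r x) \<le> B" using kernel_bounded[OF assms] by blast
  have "integrable lborel (\<lambda>x::'a. B * indicator (cball 0 d) x :: real)"
    by (intro integrable_mult_right integrable_indicator_bounded) auto
  then show ?thesis
    by (rule Bochner_Integration.integrable_bound)
      (use assms B kernel_measurable[OF assms] in \<open>auto simp: kernel_def indicator_def abs_mult\<close>)
qed

lemma integral_reflect:
  fixes f :: "'a::euclidean_space \<Rightarrow> 'b::{banach, second_countable_topology}"
  shows "(LINT y|lborel. f (x - y)) = (LINT y|lborel. f y)"
    "integrable lborel (\<lambda>y. f (x - y)) \<longleftrightarrow> integrable lborel f"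
    "(LINT y|lborel. f (y - x)) = (LINT y|lborel. f y)"
    "integrable lborel (\<lambda>y. f (y - x)) \<longleftrightarrow> integrable lborel f"
  using integral_lborel_affine[of "-1" f x] integral_lborel_affine[of "1" f "-x"] by auto

lemma integrable_bounded_scaleR:
  fixes f :: "'a::euclidean_space \<Rightarrow> 'b::euclidean_space" and b :: "'a \<Rightarrow> real"
  assumes "integrable lborel f" "b \<in> borel_measurable borel" "\<And>x. \<bar>b x\<bar> \<le> B"
  shows "integrable lborel (\<lambda>x. b x *\<^sub>R f x)"
proof (rule Bochner_Integration.integrable_bound)
  show "integrable lborel (\<lambda>x. B *\<^sub>R norm (f x))" using assms by auto
  show "(\<lambda>x. b x *\<^sub>R f x) \<in> borel_measurable lborel" using assms by auto
  show "AE x in lborel. norm (b x *\<^sub>R f x) \<le> norm (B *\<^sub>R norm (f x))"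
    using assms(3) by (intro AE_I2) (auto simp: abs_mult intro!: mult_right_mono order_trans[OF assms(3) abs_ge_self])
qed

lemma kernel_shift_measurable:
  fixes r :: "'a::euclidean_space \<Rightarrow> 'b::euclidean_space"
  assumes "kernel d r" shows "(\<lambda>y. r (x - y)) \<in> borel_measurable borel"
  by (rule measurable_compose[OF _ kernel_measurable[OF assms]]) simp

lemma convol_integrand:
  fixes f :: "'a::euclidean_space \<Rightarrow> 'b::euclidean_space"
  assumes "integrable lborel f" "kernel d r"
  shows "integrable lborel (\<lambda>y. r (x - y) *\<^sub>R f y)"
proof -
  obtain B where B: "B > 0" "\<And>x. norm (r x) \<le> B" using kernel_bounded[OF assms(2)] by blast
  then show ?thesis using assms kernel_shift_measurable[OF assms(2)]
    by (intro integrable_bounded_scaleR[where B=B]) auto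
qed

lemma mollifierD:
  assumes "mollifier d r" shows "kernel d r" "0 \<le> r x" "(LINT y|lborel. r (x - y)) = 1"
    "integrable lborel (\<lambda>y. r (x - y))" "(LINT y|lborel. r (y - x)) = 1"
    "integrable lborel (\<lambda>y. r (y - x))"
  using assms kernel_integrable[of d r] by (auto simp: mollifier_def integral_reflect)

lemma norm_convol_le:
  assumes "integrable lborel f" "mollifier d r"
  shows "norm (convol f r x) \<le> convol (\<lambda>y. norm (f y)) r x"
proof -
  have "norm (convol f r x) \<le> (LINT y|lborel. norm (r (x - y) *\<^sub>R f y))"
    unfolding convol_def by (rule integral_norm_bound)
  also have "\<dots> = convol (\<lambda>y. norm (f y)) r x"
    unfolding convol_def using mollifierD(2)[OF assms(2)] by simp
  finally show ?thesis .
qed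

text \<open>Tonelli's theorem needs joint integrability; this supplies it for the convolution integrand.\<close>

lemma convol_product_integrable:
  fixes f :: "'a::euclidean_space \<Rightarrow> 'b::euclidean_space"
  assumes f: "integrable lborel f" and r: "mollifier d r"
  shows "integrable (lborel \<Otimes>\<^sub>M lborel) (\<lambda>(y, x). r (x - y) *\<^sub>R f y)"
proof (rule lborel_pair.Fubini_integrable)
  have [measurable]: "f \<in> borel_measurable borel" "r \<in> borel_measurable borel"
    using f kernel_measurable[OF mollifierD(1)[OF r]] by auto
  show "(\<lambda>(y, x). r (x - y) *\<^sub>R f y) \<in> borel_measurable (lborel \<Otimes>\<^sub>M lborel)"
    by measurable
  show "integrable lborel (\<lambda>y. LINT x|lborel. norm (case (y, x) of (y, x) \<Rightarrow> r (x - y) *\<^sub>R f y))"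
    using f mollifierD[OF r] by (simp add: mollifierD(2)[OF r])
  show "AE y in lborel. integrable lborel (\<lambda>x. case (y, x) of (y, x) \<Rightarrow> r (x - y) *\<^sub>R f y)"
    using mollifierD[OF r] by simp
qed

lemma convol_integrable:
  assumes f: "integrable lborel f" and r: "mollifier d r"
  shows "integrable lborel (convol f r)"
  using lborel_pair.integrable_snd[OF convol_product_integrable[OF f r]] by (simp add: convol_def[abs_def])

lemma convol_L1_le:
  assumes f: "integrable lborel f" and r: "mollifier d r"
  shows "(LINT x|lborel. norm (convol f r x)) \<le> (LINT x|lborel. norm (f x))"
proof -
  have n: "integrable lborel (\<lambda>x. norm (f x))" using f by auto
  have "(LINT x|lborel. norm (convol f r x)) \<le> (LINT x|lborel. convol (\<lambda>y. norm (f y)) r x)"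
    using convol_integrable[OF f r] convol_integrable[OF n r] norm_convol_le[OF f r] by (intro integral_mono) auto
  also have "\<dots> = (LINT y|lborel. LINT x|lborel. r (x - y) *\<^sub>R norm (f y))"
    unfolding convol_def by (rule lborel_pair.Fubini_integral[OF convol_product_integrable[OF n r]])
  also have "\<dots> = (LINT x|lborel. norm (f x))" using mollifierD[OF r] by simp
  finally show ?thesis .
qed

lemma convol_diff:
  assumes "integrable lborel f" "integrable lborel g" "kernel d r"
  shows "convol (\<lambda>x. f x - g x) r x = convol f r x - convol g r x"
  unfolding convol_def scaleR_diff_right
  by (intro Bochner_Integration.integral_diff convol_integrand[OF assms(1,3)] convol_integrand[OF assms(2,3)])

text \<open>The value of a mollification is an average of the values of \<open>f\<close> over a ball of radius \<open>d\<close>.\<close>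

lemma convol_deviation_le:
  assumes f: "integrable lborel f" and r: "mollifier d r"
    and e: "\<And>y. norm (x - y) < d \<Longrightarrow> norm (f y - c) \<le> e"
  shows "norm (convol f r x - c) \<le> e"
proof -
  have i: "integrable lborel (\<lambda>y. r (x - y) *\<^sub>R f y)" "integrable lborel (\<lambda>y. r (x - y) *\<^sub>R c)"
    using convol_integrand[OF f mollifierD(1)[OF r]] mollifierD[OF r] by auto
  have "c = (LINT y|lborel. r (x - y) *\<^sub>R c)" using mollifierD[OF r] by simp
  then have "convol f r x - c = (LINT y|lborel. r (x - y) *\<^sub>R f y) - (LINT y|lborel. r (x - y) *\<^sub>R c)"
    unfolding convol_def by metis
  also have "\<dots> = (LINT y|lborel. r (x - y) *\<^sub>R f y - r (x - y) *\<^sub>R c)"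
    using i by (rule Bochner_Integration.integral_diff[symmetric])
  also have "norm \<dots> \<le> (LINT y|lborel. norm (r (x - y) *\<^sub>R f y - r (x - y) *\<^sub>R c))"
    by (rule integral_norm_bound)
  also have "\<dots> \<le> (LINT y|lborel. r (x - y) * e)"
  proof (rule integral_mono)
    fix y
    show "norm (r (x - y) *\<^sub>R f y - r (x - y) *\<^sub>R c) \<le> r (x - y) * e"
      using e[of y] mollifierD(1,2)[OF r]
      by (cases "norm (x - y) < d") (auto simp: kernel_def mult_left_mono simp flip: scaleR_diff_right)
  qed (use i mollifierD[OF r] in auto)
  also have "\<dots> = e" using mollifierD[OF r] by simp
  finally show ?thesis .
qed

lemma convol_support:
  assumes "kernel d r" "\<And>y. norm (x - y) < d \<Longrightarrow> f y = 0"
  shows "convol f r x = 0"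
proof -
  have "r (x - y) *\<^sub>R f y = 0" for y
    using assms by (cases "norm (x - y) < d") (auto simp: kernel_def)
  then have "(\<lambda>y. r (x - y) *\<^sub>R f y) = (\<lambda>y. 0)" by (intro ext)
  then show ?thesis unfolding convol_def by simp
qed

lemma kernel_uniformly_continuous:
  fixes g :: "'a::euclidean_space \<Rightarrow> 'b::euclidean_space"
  assumes "kernel M g" "e > 0"
  obtains d where "d > 0" "\<And>x y :: 'a. norm (x - y) < d \<Longrightarrow> norm (g x - g y) < e"
proof -
  have "uniformly_continuous_on (cball 0 (M+1)) g"
    using assms by (intro compact_uniformly_continuous) (auto simp: kernel_def intro: continuous_on_subset)
  then obtain d where d: "d > 0" "\<And>x y. x \<in> cball 0 (M+1) \<Longrightarrow> y \<in> cball 0 (M+1) \<Longrightarrow> dist x y < d \<Longrightarrow> dist (g x) (g y) < e"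
    unfolding uniformly_continuous_on_def using assms(2) by (metis dist_commute)
  show ?thesis
  proof (rule that[of "min d 1"])
    fix x y :: 'a assume xy: "norm (x - y) < min d 1"
    show "norm (g x - g y) < e"
    proof (cases "x \<in> cball 0 (M+1) \<and> y \<in> cball 0 (M+1)")
      case True then show ?thesis using d(2)[of x y] xy by (simp add: dist_norm)
    next
      case False
      then have "M \<le> norm x" "M \<le> norm y" using xy norm_triangle_ineq2[of x y] norm_triangle_ineq3[of x y] by auto
      then show ?thesis using assms by (simp add: kernel_def)
    qed
  qed (use d in auto)
qed

lemma mollifier_mono: "mollifier d r \<Longrightarrow> d \<le> d' \<Longrightarrow> mollifier d' r"
  by (auto simp: mollifier_def kernel_def)

text \<open>For continuous \<open>f\<close> with bounded support this is uniform continuity; the general case follows by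
density, because convolution with a mollifier does not increase the \<open>L\<^sup>1\<close> norm.\<close>

lemma convol_L1_converges:
  fixes f :: "'a::euclidean_space \<Rightarrow> 'b::euclidean_space"
  assumes f: "integrable lborel f" and e: "e > 0"
  shows "\<exists>d>0. \<forall>r. mollifier d r \<longrightarrow> (LINT x|lborel. norm (convol f r x - f x)) < e"
proof -
  obtain g M where g: "continuous_on UNIV g" "\<And>x. M \<le> norm x \<Longrightarrow> g x = 0" "integrable lborel g"
    "(LINT x|lborel. norm (f x - g x)) < e/4" using L1_continuous_approx[OF f, of "e/4"] e by auto
  have kg: "kernel M g" using g by (auto simp: kernel_def)
  define V where "V = measure lborel (cball 0 (M+1) :: 'a set)"
  have V: "V \<ge> 0" by (simp add: V_def)
  then have "e/4 / (V+1) > 0" using e by auto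
  obtain d where d: "d > 0" "\<And>x y. norm (x - y) < d \<Longrightarrow> norm (g x - g y) < e/4/(V+1)"
    using kernel_uniformly_continuous[OF kg \<open>e/4 / (V+1) > 0\<close>] by metis
  have ind: "integrable lborel (indicator (cball 0 (M+1)) :: 'a \<Rightarrow> real)"
    by (rule integrable_indicator_bounded) auto
  have "(LINT x|lborel. norm (convol f r x - f x)) < e" if "mollifier (min d 1) r" for r
  proof -
    have r: "mollifier d r" "mollifier 1 r" using that mollifier_mono by (metis min.cobounded1, metis min.cobounded2)
    have fg: "integrable lborel (\<lambda>x. f x - g x)" using f g by auto
    have ci: "integrable lborel (convol f r)" "integrable lborel (convol g r)" "integrable lborel (convol (\<lambda>x. f x - g x) r)"
      using f g fg r by (auto intro: convol_integrable)
    have 1: "norm (convol g r x - g x) \<le> e/4/(V+1) * indicator (cball 0 (M+1)) x" for x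
    proof (cases "norm x \<le> M + 1")
      case True
      have "norm (convol g r x - g x) \<le> e/4/(V+1)"
        by (rule convol_deviation_le[OF g(3) r(1)]) (use d(2) in \<open>simp add: norm_minus_commute less_imp_le\<close>)
      then show ?thesis using True by auto
    next
      case False
      have "convol g r x = 0"
      proof (rule convol_support[OF mollifierD(1)[OF r(2)]])
        fix y assume "norm (x - y) < 1"
        then show "g y = 0" using False g(2)[of y] norm_triangle_ineq2[of x y] by auto
      qed
      then show ?thesis using False g(2)[of x] by simp
    qed
    (* f * r - f = (f - g) * r + (g * r - g) - (f - g), with convolution written as a product *)
    have "(LINT x|lborel. norm (convol f r x - f x)) \<le>
      (LINT x|lborel. norm (convol (\<lambda>x. f x - g x) r x) + e/4/(V+1) * indicator (cball 0 (M+1)) x + norm (f x - g x))"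
    proof (rule integral_mono)
      fix x
      have "convol f r x - f x = convol (\<lambda>x. f x - g x) r x + (convol g r x - g x) - (f x - g x)"
        using convol_diff[OF f g(3) mollifierD(1)[OF r(1)]] by simp
      then have "norm (convol f r x - f x) \<le> norm (convol (\<lambda>x. f x - g x) r x) + norm (convol g r x - g x) + norm (f x - g x)"
        by (smt (verit) norm_triangle_ineq norm_triangle_ineq4)
      then show "norm (convol f r x - f x) \<le> norm (convol (\<lambda>x. f x - g x) r x) + e/4/(V+1) * indicator (cball 0 (M+1)) x + norm (f x - g x)"
        using 1[of x] by simp
    qed (use ci f g ind in auto)
    also have "\<dots> = (LINT x|lborel. norm (convol (\<lambda>x. f x - g x) r x)) + e/4/(V+1) * V + (LINT x|lborel. norm (f x - g x))"
    proof -
      have i2: "integrable lborel (\<lambda>x::'a. e/4/(V+1) * indicator (cball 0 (M+1)) x)"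
        using ind by (rule integrable_mult_right)
      have "(LINT x|lborel. norm (convol (\<lambda>x. f x - g x) r x) + e/4/(V+1) * indicator (cball 0 (M+1)) x + norm (f x - g x)) =
        (LINT x|lborel. norm (convol (\<lambda>x. f x - g x) r x)) + (LINT x|lborel. e/4/(V+1) * indicator (cball (0::'a) (M+1)) x) + (LINT x|lborel. norm (f x - g x))"
        using integrable_norm[OF ci(3)] i2 integrable_norm[OF fg]
        by (subst Bochner_Integration.integral_add; simp add: Bochner_Integration.integral_add)+
      moreover have "(LINT x|lborel. e/4/(V+1) * indicator (cball (0::'a) (M+1)) x) = e/4/(V+1) * V"
        by (simp add: V_def)
      ultimately show ?thesis by simp
    qed
    also have "\<dots> < e"
    proof -
      have "e/4/(V+1) * V \<le> e/4" using V e by (simp add: field_simps)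
      then show ?thesis using convol_L1_le[OF fg r(1)] g(4) e by linarith
    qed
    finally show ?thesis .
  qed
  then show ?thesis using d(1) by (intro exI[of _ "min d 1"]) auto
qed

section \<open>Differentiation of convolutions and smooth bump functions\<close>

lemma has_derivative_everywhere_continuous:
  assumes "\<And>x. (f has_derivative D x) (at x)" shows "continuous_on S f"
  using assms by (intro continuous_at_imp_continuous_on ballI has_derivative_continuous)

lemma C1cD:
  assumes "C1c K \<phi> g"
  shows "(\<phi> has_derivative (\<lambda>h. g x \<bullet> h)) (at x)" "continuous_on UNIV g" "x \<notin> K \<Longrightarrow> \<phi> x = 0"
    "continuous_on UNIV \<phi>"
  using assms by (auto simp: C1c_def intro: has_derivative_everywhere_continuous)

lemma gradient_zero_if_constant:
  assumes "((\<lambda>y. c) has_derivative (\<lambda>h. g \<bullet> h)) (at x)" shows "g = 0"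
proof -
  have "(\<lambda>h. g \<bullet> h) = (\<lambda>h. 0)" using has_derivative_unique[OF assms has_derivative_const] .
  then show ?thesis by (metis inner_eq_zero_iff)
qed

lemma C1c_gradient_outside:
  assumes "C1c K \<phi> g" "closed K" "x \<notin> K"
  shows "g x = 0"
proof -
  have "((\<lambda>x. 0) has_derivative (\<lambda>h. g x \<bullet> h)) (at x)"
    by (rule has_derivative_transform_within_open[OF C1cD(1)[OF assms(1)], of "- K"])
      (use assms C1cD(3)[OF assms(1)] in auto)
  then show ?thesis by (rule gradient_zero_if_constant)
qed

lemma C1c_kernel:
  assumes "C1c K \<phi> g" "compact K"
  obtains d where "kernel d \<phi>" "kernel d g"
proof -
  obtain M where M: "\<And>x. x \<in> K \<Longrightarrow> norm x \<le> M"
    using compact_imp_bounded[OF assms(2)] bounded_iff by metis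
  then have "x \<notin> K" if "M + 1 \<le> norm x" for x using that by fastforce
  then show ?thesis using C1cD[OF assms(1)] C1c_gradient_outside[OF assms(1) compact_imp_closed[OF assms(2)]]
    by (intro that[of "M+1"]) (auto simp: kernel_def)
qed

text \<open>Differentiation falls on the kernel. The remainder of the first-order expansion of the kernel,
divided by \<open>norm h\<close>, is bounded by twice its Lipschitz constant and tends to zero pointwise, so
dominated convergence applies.\<close>

lemma convol_has_derivative:
  fixes f :: "'a::euclidean_space \<Rightarrow> real"
  assumes f: "integrable lborel f" and r: "C1c K r g" and K: "compact K"
  shows "(convol f r has_derivative (\<lambda>h. (LINT y|lborel. f y *\<^sub>R g (x - y)) \<bullet> h)) (at x)"
    and "integrable lborel (\<lambda>y. f y *\<^sub>R g (x - y))"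
proof -
  obtain d where d: "kernel d r" "kernel d g" using C1c_kernel[OF r K] by blast
  obtain L where L: "L > 0" "\<And>x. norm (g x) \<le> L" using kernel_bounded[OF d(2)] by blast
  have rm: "(\<lambda>y. r (z - y)) \<in> borel_measurable borel" and gm: "(\<lambda>y. g (z - y)) \<in> borel_measurable borel" for z
    using d by (auto intro: kernel_shift_measurable)
  have fm [measurable]: "f \<in> borel_measurable borel" using f by auto
  show gi: "integrable lborel (\<lambda>y. f y *\<^sub>R g (x - y))"
  proof (rule Bochner_Integration.integrable_bound)
    show "integrable lborel (\<lambda>y. L * f y)" using f by auto
    show "AE y in lborel. norm (f y *\<^sub>R g (x - y)) \<le> norm (L * f y)"
      using L by (intro AE_I2) (auto simp: abs_mult mult.commute[of "\<bar>f _\<bar>"] intro!: mult_right_mono)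
  qed (use gm fm in auto)
  define q where "q h y = (r (x + h - y) - r (x - y) - g (x - y) \<bullet> h) / norm h" for h y
  have lip: "\<bar>r (z + h) - r z\<bar> \<le> L * norm h" for z h

  proof -
    have "onorm (\<lambda>h. g x \<bullet> h) \<le> L" for x
      by (rule onorm_le) (metis Cauchy_Schwarz_ineq2 L(2) mult_right_mono norm_ge_zero order_trans real_norm_def)
    then have "norm (r (z + h) - r z) \<le> L * norm (z + h - z)"
      by (intro differentiable_bound[of UNIV r "\<lambda>x h. g x \<bullet> h" L "z+h" z])
        (auto intro: C1cD(1)[OF r])
    then show ?thesis by simp
  qed
  have qb: "\<bar>q h y\<bar> \<le> 2 * L" for h y
  proof (cases "h = 0")
    case False
    have "\<bar>r (x - y + h) - r (x - y) - g (x - y) \<bullet> h\<bar> \<le> L * norm h + L * norm h"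
      using lip[of "x - y" h] Cauchy_Schwarz_ineq2[of "g (x - y)" h] mult_right_mono[OF L(2)[of "x - y"] norm_ge_zero[of h]]
      by linarith
    then show ?thesis using False by (auto simp: q_def field_simps)
  qed (use L in \<open>auto simp: q_def\<close>)
  have q0: "((\<lambda>h. q h y) \<longlongrightarrow> 0) (at 0)" for y
  proof -
    have "((\<lambda>h. norm (r (x - y + h) - r (x - y) - g (x - y) \<bullet> h) / norm h) \<longlongrightarrow> 0) (at 0)"
      using C1cD(1)[OF r, of "x - y"] unfolding has_derivative_at by blast
    then have "((\<lambda>h. \<bar>q h y\<bar>) \<longlongrightarrow> 0) (at 0)" by (simp add: q_def algebra_simps)
    then show ?thesis by (rule tendsto_rabs_zero_cancel)
  qed
  have ri: "integrable lborel (\<lambda>y. f y * r (z - y))" for z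
    using convol_integrand[OF f d(1)] by (simp add: mult.commute)
  have qm: "(\<lambda>y. q h y) \<in> borel_measurable borel" for h
    unfolding q_def using rm gm by auto
  have main: "((\<lambda>h. (LINT y|lborel. f y * q h y)) \<longlongrightarrow> (LINT y::'a|lborel. 0::real)) (at 0)"
    unfolding tendsto_at_iff_sequentially comp_def
  proof (intro allI impI)
    fix X :: "nat \<Rightarrow> 'a" assume X: "\<forall>i. X i \<in> UNIV - {0}" "X \<longlonglongrightarrow> 0"
    show "(\<lambda>n. LINT y|lborel. f y * q (X n) y) \<longlonglongrightarrow> (LINT y::'a|lborel. 0::real)"
    proof (rule integral_dominated_convergence)
      show "integrable lborel (\<lambda>y. 2 * L * \<bar>f y\<bar>)" using f by auto
      show "AE y in lborel. norm (f y * q (X n) y) \<le> 2 * L * \<bar>f y\<bar>" for n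
        using qb by (intro AE_I2) (auto simp: abs_mult mult.commute[of "\<bar>f _\<bar>"] intro!: mult_right_mono)
      show "AE y in lborel. (\<lambda>n. f y * q (X n) y) \<longlonglongrightarrow> 0"
      proof (intro AE_I2)
        fix y
        have "(\<lambda>n. q (X n) y) \<longlonglongrightarrow> 0"
          using q0[of y] X unfolding tendsto_at_iff_sequentially comp_def by blast
        then show "(\<lambda>n. f y * q (X n) y) \<longlonglongrightarrow> 0" by (rule tendsto_mult_right_zero)
      qed
    qed (use qm in auto)
  qed
  show "(convol f r has_derivative (\<lambda>h. (LINT y|lborel. f y *\<^sub>R g (x - y)) \<bullet> h)) (at x)"
    unfolding has_derivative_at
  proof (intro conjI)
    show "bounded_linear (\<lambda>h. (LINT y|lborel. f y *\<^sub>R g (x - y)) \<bullet> h)" by (rule bounded_linear_inner_right)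
    have "norm (convol f r (x + h) - convol f r x - (LINT y|lborel. f y *\<^sub>R g (x - y)) \<bullet> h) / norm h = norm (LINT y|lborel. f y * q h y)" for h
    proof -
      have gh: "(LINT y|lborel. f y *\<^sub>R g (x - y)) \<bullet> h = (LINT y|lborel. f y * (g (x - y) \<bullet> h))" 
        "integrable lborel (\<lambda>y. f y * (g (x - y) \<bullet> h))"
        using integral_inner_left[of h lborel "\<lambda>y. f y *\<^sub>R g (x - y)"]
          integrable_inner_left[of h lborel "\<lambda>y. f y *\<^sub>R g (x - y)"] gi by simp_all
      have "convol f r (x + h) - convol f r x - (LINT y|lborel. f y *\<^sub>R g (x - y)) \<bullet> h
        = (LINT y|lborel. f y * r (x + h - y)) - (LINT y|lborel. f y * r (x - y)) - (LINT y|lborel. f y * (g (x - y) \<bullet> h))"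
        by (simp add: convol_def gh mult.commute)
      also have "\<dots> = (LINT y|lborel. f y * r (x + h - y) - f y * r (x - y) - f y * (g (x - y) \<bullet> h))"
        using ri gh(2) by (subst Bochner_Integration.integral_diff; simp)+
      also have "\<dots> = (LINT y|lborel. norm h * (f y * q h y))"
      proof (rule Bochner_Integration.integral_cong)
        fix y
        have "norm h * q h y = r (x + h - y) - r (x - y) - g (x - y) \<bullet> h"
          using C1cD(1)[OF r] by (cases "h = 0") (auto simp: q_def)
        then show "f y * r (x + h - y) - f y * r (x - y) - f y * (g (x - y) \<bullet> h) = norm h * (f y * q h y)"
          by (metis mult.left_commute right_diff_distrib')
      qed simp
      also have "\<dots> = norm h * (LINT y|lborel. f y * q h y)" by simp
      finally show ?thesis by (cases "h = 0") (auto simp: abs_mult q_def)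
    qed
    then show "((\<lambda>h. norm (convol f r (x + h) - convol f r x - (LINT y|lborel. f y *\<^sub>R g (x - y)) \<bullet> h) / norm h) \<longlongrightarrow> 0) (at 0)"
      using tendsto_norm[OF main] by simp
  qed
qed

lemma convol_commute:
  fixes f :: "'a::euclidean_space \<Rightarrow> real"
  shows "convol f r = convol r f"
proof
  fix x
  have "convol f r x = (LINT y|lborel. (\<lambda>z. r z *\<^sub>R f (x - z)) (x - y))" by (simp add: convol_def)
  also have "\<dots> = (LINT y|lborel. r y *\<^sub>R f (x - y))" by (rule integral_reflect)
  also have "\<dots> = convol r f x" by (simp add: convol_def mult.commute)
  finally show "convol f r x = convol r f x" .
qed

text \<open>The property that \<open>test_fun\<close> demands apart from the support.\<close>

definition smooth :: "(real^'n \<Rightarrow> real) \<Rightarrow> bool" where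
  "smooth f \<longleftrightarrow> (\<forall>k. Ck_on k f UNIV)"

lemma gradient_has_derivative:
  fixes f :: "real^'n \<Rightarrow> real"
  assumes "f differentiable (at x)"
  shows "(f has_derivative (\<lambda>h. gradient f x \<bullet> h)) (at x)"
proof -
  have D: "(f has_derivative frechet_derivative f (at x)) (at x)"
    using assms frechet_derivative_works by blast
  then have lin: "linear (frechet_derivative f (at x))" by (rule has_derivative_linear)
  have "frechet_derivative f (at x) h = gradient f x \<bullet> h" for h
  proof -
    have "h = (\<Sum>i\<in>UNIV. (h $ i) *\<^sub>R axis i 1)"
      using basis_expansion[of h] by (simp add: scalar_mult_eq_scaleR)
    then have "frechet_derivative f (at x) h = frechet_derivative f (at x) (\<Sum>i\<in>UNIV. (h $ i) *\<^sub>R axis i 1)" by simp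
    also have "\<dots> = (\<Sum>i\<in>UNIV. h $ i * partial_deriv i f x)"
      by (simp add: linear_sum[OF lin] linear_cmul[OF lin] partial_deriv_def)
    also have "\<dots> = gradient f x \<bullet> h"
      by (simp add: gradient_def inner_vec_def mult.commute)
    finally show ?thesis .
  qed
  then have "frechet_derivative f (at x) = (\<lambda>h. gradient f x \<bullet> h)" by (intro ext)
  then show ?thesis using D by simp
qed

lemma has_derivative_imp_partial:
  fixes f :: "real^'n \<Rightarrow> real"
  assumes "(f has_derivative (\<lambda>h. g \<bullet> h)) (at x)"
  shows "partial_deriv i f x = g $ i" "gradient f x = g"
proof -
  have "frechet_derivative f (at x) = (\<lambda>h. g \<bullet> h)" using frechet_derivative_at[OF assms] by simp
  then show "partial_deriv i f x = g $ i" for i by (simp add: partial_deriv_def inner_axis)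
  then show "gradient f x = g" by (simp add: gradient_def vec_eq_iff)
qed

lemma smoothD:
  assumes "smooth f"
  shows "f differentiable (at x)" "smooth (partial_deriv i f)" "continuous_on UNIV f" "continuous_on UNIV (gradient f)"
proof -
  have *: "Ck_on (Suc k) f UNIV" for k using assms by (simp only: smooth_def)
  then show "f differentiable (at x)" "smooth (partial_deriv i f)" by (auto simp: smooth_def)
  show "continuous_on UNIV f" using assms by (auto simp: smooth_def dest: spec[of _ 0])
  have "continuous_on UNIV (partial_deriv i f)" for i using *[of 0] by auto
  then show "continuous_on UNIV (gradient f)" unfolding gradient_def by (intro continuous_intros)
qed

lemma smooth_C1c:
  assumes "smooth f" "\<And>x. x \<notin> K \<Longrightarrow> f x = 0"
  shows "C1c K f (gradient f)"
  using assms gradient_has_derivative[OF smoothD(1)[OF assms(1)]] smoothD(4)[OF assms(1)] by (auto simp: C1c_def)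

lemma convol_smooth:
  fixes f :: "real^'n \<Rightarrow> real"
  assumes f: "integrable lborel f" and r: "smooth r" "\<And>x. x \<notin> K \<Longrightarrow> r x = 0" and K: "compact K"
  shows "smooth (convol f r)"
proof -
  have "Ck_on k (convol f r) UNIV" for k
    using r
  proof (induction k arbitrary: r)
    case 0
    have "(convol f r) differentiable (at x)" for x
      using convol_has_derivative(1)[OF f smooth_C1c[OF 0] K] by (auto simp: differentiable_def)
    then show ?case
      using has_derivative_everywhere_continuous[OF convol_has_derivative(1)[OF f smooth_C1c[OF 0] K]] by simp
  next
    case (Suc k)
    note t = smooth_C1c[OF Suc.prems]
    note D = convol_has_derivative[OF f t K]
    have p: "partial_deriv i (convol f r) = convol f (partial_deriv i r)" for i
    proof
      fix x
      have "partial_deriv i (convol f r) x = (LINT y|lborel. f y *\<^sub>R gradient r (x - y)) $ i"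
        by (rule has_derivative_imp_partial(1)[OF D(1)])
      also have "\<dots> = (LINT y|lborel. f y *\<^sub>R gradient r (x - y)) \<bullet> axis i 1"
        by (simp add: inner_axis)
      also have "\<dots> = (LINT y|lborel. (f y *\<^sub>R gradient r (x - y)) \<bullet> axis i 1)"
        using integral_inner_left[of "axis i 1" lborel "\<lambda>y. f y *\<^sub>R gradient r (x - y)"] D(2) by simp
      also have "\<dots> = convol f (partial_deriv i r) x"
        by (simp add: convol_def inner_axis gradient_def mult.commute)
      finally show "partial_deriv i (convol f r) x = convol f (partial_deriv i r) x" .
    qed
    have "partial_deriv i r x = 0" if "x \<notin> K" for i x
      using C1c_gradient_outside[OF t compact_imp_closed[OF K] that] by (simp add: gradient_def vec_eq_iff)
    then have "Ck_on k (convol f (partial_deriv i r)) UNIV" for i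
      using Suc.IH smoothD(2)[OF Suc.prems(1)] by blast
    then show ?case using D(1) by (auto simp: p differentiable_def)
  qed
  then show ?thesis by (simp add: smooth_def)
qed

text \<open>The functions \<open>exp (- 1 / t) / t\<^sup>k\<close>, extended by zero. The family is closed under differentiation up to
linear combinations, which is why all \<open>k\<close> are needed.\<close>

definition bump_profile :: "nat \<Rightarrow> real \<Rightarrow> real" where
  "bump_profile k t = (if t > 0 then exp (- inverse t) * inverse t ^ k else 0)"

lemma bump_profile_tendsto_0: "((\<lambda>t. bump_profile k t) \<longlongrightarrow> 0) (at 0)"
proof -
  have "((\<lambda>x::real. x ^ k / exp x) \<longlongrightarrow> 0) at_top" by (rule tendsto_power_div_exp_0)
  then have "((\<lambda>t::real. inverse t ^ k / exp (inverse t)) \<longlongrightarrow> 0) (at_right 0)"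
    by (rule filterlim_compose) (rule filterlim_inverse_at_top_right)
  then have "((\<lambda>t. bump_profile k t) \<longlongrightarrow> 0) (at_right 0)"
    by (rule Lim_transform_eventually)
      (auto simp: bump_profile_def exp_minus field_simps eventually_at_right_field intro!: exI[of _ 1])
  moreover have "((\<lambda>t. bump_profile k t) \<longlongrightarrow> 0) (at_left 0)"
    by (rule Lim_transform_eventually[OF tendsto_const])
      (auto simp: bump_profile_def eventually_at_left_field intro!: exI[of _ "-1"])
  ultimately show ?thesis by (simp add: filterlim_split_at)
qed

lemma bump_profile_deriv:
  "(bump_profile k has_real_derivative (bump_profile (k+2) t - real k * bump_profile (k+1) t)) (at t)"
proof (cases t "0::real" rule: linorder_cases)
  case less
  have "((\<lambda>t. 0) has_real_derivative 0) (at t)" by auto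
  then have "(bump_profile k has_real_derivative 0) (at t)"
    by (rule has_field_derivative_transform_within_open[where S="{..<0}"]) (use less in \<open>auto simp: bump_profile_def\<close>)
  then show ?thesis using less by (simp add: bump_profile_def)
next
  case equal
  have "((\<lambda>h. bump_profile (k+1) h) \<longlongrightarrow> 0) (at 0)" by (rule bump_profile_tendsto_0)
  then have "((\<lambda>h. (bump_profile k (0 + h) - bump_profile k 0) / h) \<longlongrightarrow> 0) (at 0)"
    by (rule Lim_transform_eventually) (auto simp: bump_profile_def field_simps eventually_at_filter)
  then show ?thesis using equal by (simp add: DERIV_def bump_profile_def)
next
  case greater
  have "((\<lambda>t. exp (- inverse t) * inverse t ^ k) has_real_derivative (bump_profile (k+2) t - real k * bump_profile (k+1) t)) (at t)"
  proof -
    have "((\<lambda>t. inverse t ^ k) has_real_derivative - real k * inverse t ^ (k+1)) (at t)"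
    proof (cases k)
      case (Suc j)
      have "(inverse has_real_derivative - (inverse t * inverse t)) (at t)"
        using greater by (auto intro!: derivative_eq_intros)
      from DERIV_power[OF this, of "Suc j"] show ?thesis by (simp add: Suc algebra_simps)
    qed simp
    moreover have "((\<lambda>t. exp (- inverse t)) has_real_derivative exp (- inverse t) * (inverse t)\<^sup>2) (at t)"
      using greater by (auto intro!: derivative_eq_intros simp: power2_eq_square)
    ultimately have "((\<lambda>t. exp (- inverse t) * inverse t ^ k) has_real_derivative
      exp (- inverse t) * (inverse t)\<^sup>2 * inverse t ^ k + (- real k * inverse t ^ (k+1)) * exp (- inverse t)) (at t)"
      by (rule DERIV_mult[rotated])
    then show ?thesis using greater by (simp add: bump_profile_def power2_eq_square algebra_simps)
  qed
  then show ?thesis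
    by (rule has_field_derivative_transform_within_open[where S="{0<..}"]) (use greater in \<open>auto simp: bump_profile_def\<close>)
qed

text \<open>A class of functions that contains the radial bump around \<open>a\<close> and is closed under partial
derivatives; hence all its members are smooth.\<close>

inductive bump_class :: "real \<Rightarrow> real^'n \<Rightarrow> (real^'n \<Rightarrow> real) \<Rightarrow> bool" for d a where
  base: "bump_class d a (\<lambda>x. c * bump_profile k (d\<^sup>2 - (norm (x - a))\<^sup>2))"
| add: "bump_class d a f \<Longrightarrow> bump_class d a g \<Longrightarrow> bump_class d a (\<lambda>x. f x + g x)"
| coord: "bump_class d a f \<Longrightarrow> bump_class d a (\<lambda>x. (x - a) $ i * f x)"

lemma bump_class_cmult: "bump_class d a f \<Longrightarrow> bump_class d a (\<lambda>x. c * f x)"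
proof (induction rule: bump_class.induct)
  case (base b k)
  show ?case using bump_class.base[of d a "c * b" k] by (simp add: mult.assoc)
next
  case (add f g)
  then show ?case using bump_class.add[OF add.IH] by (simp add: distrib_left)
next
  case (coord f i)
  then show ?case using bump_class.coord[OF coord.IH, of i] by (simp add: mult.left_commute)
qed

lemma bump_class_deriv:
  assumes "bump_class d a f"
  shows "\<exists>g. (\<forall>x. (f has_derivative (\<lambda>h. g x \<bullet> h)) (at x)) \<and> (\<forall>i. bump_class d a (\<lambda>x. g x $ i))"
  using assms
proof (induction rule: bump_class.induct)
  case (base c k)
  let ?s = "\<lambda>x. d\<^sup>2 - (norm (x - a))\<^sup>2"
  let ?e = "\<lambda>x. bump_profile (k+2) (?s x) - real k * bump_profile (k+1) (?s x)"
  let ?g = "\<lambda>x. (- 2 * c * ?e x) *\<^sub>R (x - a)"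
  have "((\<lambda>x. c * bump_profile k (?s x)) has_derivative (\<lambda>h. ?g x \<bullet> h)) (at x)" for x
  proof -
    have "(?s has_derivative (\<lambda>h. - 2 * ((x - a) \<bullet> h))) (at x)"
      unfolding power2_norm_eq_inner by (auto intro!: derivative_eq_intros simp: inner_commute)
    from has_derivative_compose[OF this bump_profile_deriv[of k "?s x", unfolded has_field_derivative_def]]
    have "((\<lambda>x. bump_profile k (?s x)) has_derivative (\<lambda>h. ?e x * (- 2 * ((x - a) \<bullet> h)))) (at x)" .
    then have "((\<lambda>x. c * bump_profile k (?s x)) has_derivative (\<lambda>h. c * (?e x * (- 2 * ((x - a) \<bullet> h))))) (at x)"
      by (rule has_derivative_mult_right)
    then show ?thesis by (simp add: algebra_simps)
  qed
  moreover have "bump_class d a (\<lambda>x. ?g x $ i)" for i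
  proof -
    have "bump_class d a (\<lambda>x. (x - a) $ i * ((-2*c) * bump_profile (k+2) (?s x) + (2*c*real k) * bump_profile (k+1) (?s x)))"
      by (intro bump_class.intros)
    then show ?thesis by (simp add: algebra_simps)
  qed
  ultimately show ?case by (intro exI[of _ ?g]) blast
next
  case (add f g)
  then obtain f' g' where "\<forall>x. (f has_derivative (\<lambda>h. f' x \<bullet> h)) (at x)" "\<forall>i. bump_class d a (\<lambda>x. f' x $ i)"
    "\<forall>x. (g has_derivative (\<lambda>h. g' x \<bullet> h)) (at x)" "\<forall>i. bump_class d a (\<lambda>x. g' x $ i)" by blast
  then show ?case
    by (intro exI[of _ "\<lambda>x. f' x + g' x"]) (auto simp: inner_add_left intro!: has_derivative_add bump_class.add)
next
  case (coord f i)
  then obtain g where g: "\<And>x. (f has_derivative (\<lambda>h. g x \<bullet> h)) (at x)" "\<And>i. bump_class d a (\<lambda>x. g x $ i)" by blast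
  let ?g = "\<lambda>x. ((x - a) $ i) *\<^sub>R g x + f x *\<^sub>R axis i 1"
  have "((\<lambda>x. (x - a) $ i * f x) has_derivative (\<lambda>h. ?g x \<bullet> h)) (at x)" for x
  proof -
    have "((\<lambda>x. (x - a) $ i) has_derivative (\<lambda>h. h $ i)) (at x)"
    proof -
      have "((\<lambda>x. (x - a) \<bullet> axis i 1) has_derivative (\<lambda>h. h \<bullet> axis i 1)) (at x)"
        by (auto intro!: derivative_eq_intros)
      then show ?thesis by (simp add: inner_axis)
    qed
    from has_derivative_mult[OF this g(1)[of x]] show ?thesis
      by (simp add: inner_add_left inner_axis' algebra_simps)
  qed
  moreover have "bump_class d a (\<lambda>x. ?g x $ j)" for j
  proof -
    have "bump_class d a (\<lambda>x. (x - a) $ i * g x $ j + (if i = j then 1 else 0) * f x)"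
      by (intro bump_class.add bump_class.coord bump_class_cmult g(2) coord.hyps)
    moreover have "(\<lambda>x. ?g x $ j) = (\<lambda>x. (x - a) $ i * g x $ j + (if i = j then 1 else 0) * f x)"
      by (auto simp: axis_def fun_eq_iff)
    ultimately show ?thesis by simp
  qed
  ultimately show ?case by (intro exI[of _ ?g]) blast
qed

lemma bump_class_smooth:
  fixes f :: "real^'n \<Rightarrow> real"
  assumes "bump_class d a f" shows "smooth f"
proof -
  have "Ck_on k f UNIV" for k
    using assms
  proof (induction k arbitrary: f)
    case 0
    then obtain g where "\<And>x. (f has_derivative (\<lambda>h. g x \<bullet> h)) (at x)" using bump_class_deriv by blast
    then show ?case using has_derivative_everywhere_continuous[of f "\<lambda>x h. g x \<bullet> h"] by simp
  next
    case (Suc k)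
    then obtain g where g: "\<And>x. (f has_derivative (\<lambda>h. g x \<bullet> h)) (at x)" "\<And>i. bump_class d a (\<lambda>x. g x $ i)"
      using bump_class_deriv by blast
    then have "partial_deriv i f = (\<lambda>x. g x $ i)" for i using has_derivative_imp_partial(1) by blast
    then show ?case using g Suc.IH by (auto intro: differentiableI)
  qed
  then show ?thesis by (simp add: smooth_def)
qed

definition bump :: "real \<Rightarrow> real^'n \<Rightarrow> real" where
  "bump d x = bump_profile 0 (d\<^sup>2 - (norm x)\<^sup>2) / (LINT y::real^'n|lborel. bump_profile 0 (d\<^sup>2 - (norm y)\<^sup>2))"

lemma bump_shift_smooth: "smooth (\<lambda>x. bump d (x - a))"
proof -
  have "bump_class d a (\<lambda>x. inverse (LINT y::real^'n|lborel. bump_profile 0 (d\<^sup>2 - (norm y)\<^sup>2)) * bump_profile 0 (d\<^sup>2 - (norm (x - a))\<^sup>2))"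
    by (rule bump_class.base)
  from bump_class_smooth[OF this] show ?thesis unfolding bump_def by (simp add: field_simps)
qed

lemma bump_smooth: "smooth (bump d)" using bump_shift_smooth[of d 0] by simp

lemma bump_even: "bump d (x - y) = bump d (y - x)" by (simp add: bump_def norm_minus_commute)

lemma bump_mollifier:
  assumes "d > 0" shows "mollifier d (bump d :: real^'n \<Rightarrow> real)"
proof -
  let ?f = "\<lambda>y::real^'n. bump_profile 0 (d\<^sup>2 - (norm y)\<^sup>2)"
  have z: "?f x = 0" if "d \<le> norm x" for x
  proof -
    have "d\<^sup>2 \<le> (norm x)\<^sup>2" using that assms by (intro power_mono) auto
    then show ?thesis by (simp add: bump_profile_def)
  qed
  have "smooth ?f" using bump_class_smooth[OF bump_class.base[of d 0 1 0]] by simp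
  then have k: "kernel d ?f" using z smoothD(3) by (auto simp: kernel_def)
  have i: "integrable lborel ?f" by (rule kernel_integrable[OF k])
  have pos: "0 \<le> ?f x" for x by (simp add: bump_profile_def)
  have "(LINT y|lborel. ?f y) > 0"
  proof -
    have "(LINT y|lborel. ?f y) \<noteq> 0"
    proof
      assume "(LINT y|lborel. ?f y) = 0"
      then have "AE y in lborel. ?f y = 0" using integral_nonneg_eq_0_iff_AE[OF i] pos by auto
      then have "AE y in lborel. y \<notin> ball (0::real^'n) d"
        by eventually_elim (use assms in \<open>auto simp: bump_profile_def power_strict_mono split: if_splits\<close>)
      then have "emeasure lborel (ball (0::real^'n) d) = 0"
        by (subst (asm) AE_iff_null_sets[symmetric]) auto
      then have "ball (0::real^'n) d = {}" 
        using open_not_negligible[of "ball (0::real^'n) d"] assms by (auto simp: negligible_iff_null_sets null_sets_def)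
      then show False using assms by simp
    qed
    then show ?thesis using pos by (simp add: order_less_le integral_nonneg_AE)
  qed
  then show ?thesis using k i pos z smoothD(3)[OF bump_smooth[of d]]
    by (auto simp: mollifier_def kernel_def bump_def)
qed

lemma bump_outside:
  fixes x :: "real^'n"
  assumes "d > 0" "x \<notin> cball 0 d" shows "bump d x = 0"
  using bump_mollifier[OF assms(1), where 'n='n] assms(2) by (auto simp: mollifier_def kernel_def not_le less_imp_le)

section \<open>Integration by parts, cutoff functions and truncations\<close>

abbreviation thicken :: "'a::metric_space set \<Rightarrow> real \<Rightarrow> 'a set" where
  "thicken K d \<equiv> (\<Union>x\<in>K. cball x d)"

lemma compact_thicken:
  fixes K :: "'a::euclidean_space set"
  assumes "compact K" shows "compact (thicken K d)"
proof -
  have "thicken K d = (\<Union>x\<in>K. \<Union>y\<in>cball 0 d. {x + y})"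
    by (force simp: dist_norm norm_minus_commute intro: exI[of _ "_ - _"])
  then show ?thesis using compact_sums'[OF assms compact_cball, of 0 d] by simp
qed

text \<open>The convolution of \<open>\<phi>\<close> with the indicator of a large ball is constant near the origin, so its
derivative there vanishes; but that derivative is the integral of the reflected gradient.\<close>

lemma integral_gradient_zero:
  assumes t: "C1c K \<phi> g" and K: "compact K"
  shows "(LINT x|lborel. g x) = 0"
proof -
  obtain M where M: "kernel M \<phi>" "kernel M g" using C1c_kernel[OF t K] by blast
  let ?f = "indicator (cball 0 (M+1)) :: 'a \<Rightarrow> real"
  have f: "integrable lborel ?f" by (rule integrable_indicator_bounded) auto
  note D = convol_has_derivative[OF f t K, of 0]
  have const: "convol ?f \<phi> x = (LINT y|lborel. \<phi> y)" if "x \<in> ball 0 1" for x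
  proof -
    have "\<phi> (x - y) *\<^sub>R ?f y = \<phi> (x - y)" for y
      using M(1) that norm_triangle_ineq2[of y x]
      by (auto simp: kernel_def indicator_def norm_minus_commute)
    then have "(\<lambda>y. \<phi> (x - y) *\<^sub>R ?f y) = (\<lambda>y. \<phi> (x - y))" by (intro ext)
    then show ?thesis by (simp add: convol_def integral_reflect)
  qed
  have "((\<lambda>x. LINT y|lborel. \<phi> y) has_derivative (\<lambda>h. (LINT y|lborel. ?f y *\<^sub>R g (0 - y)) \<bullet> h)) (at 0)"
    by (rule has_derivative_transform_within_open[OF D(1), of "ball 0 1"]) (use const in auto)
  then have "(LINT y|lborel. ?f y *\<^sub>R g (0 - y)) = 0" by (rule gradient_zero_if_constant)
  moreover have "?f y *\<^sub>R g (0 - y) = g (0 - y)" for y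
    using M(2) by (auto simp: kernel_def indicator_def)
  ultimately have "(LINT y|lborel. g (0 - y)) = 0" by simp
  then show ?thesis unfolding integral_reflect .
qed

lemma divergence_theorem_compact_support:
  fixes X :: "'a::euclidean_space \<Rightarrow> 'a"
  assumes X: "\<And>x. (X has_derivative X' x) (at x)" "\<And>h. continuous_on UNIV (\<lambda>x. X' x h)"
    and K: "compact K" "\<And>x. x \<notin> K \<Longrightarrow> X x = 0"
  shows "(LINT x|lborel. (\<Sum>b\<in>Basis. X' x b \<bullet> b)) = 0"
proof -
  have lin: "linear (X' x)" for x using X(1) by (rule has_derivative_linear)
  have *: "integrable lborel (\<lambda>x. X' x b \<bullet> b) \<and> (LINT x|lborel. X' x b \<bullet> b) = 0" if b: "b \<in> Basis" for b
  proof -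
    define g where "g x = (\<Sum>c\<in>Basis. (X' x c \<bullet> b) *\<^sub>R c)" for x
    have gb: "g x \<bullet> h = X' x h \<bullet> b" for x h
    proof -
      have "X' x h = X' x (\<Sum>c\<in>Basis. (h \<bullet> c) *\<^sub>R c)" by (simp add: euclidean_representation)
      also have "\<dots> = (\<Sum>c\<in>Basis. (h \<bullet> c) *\<^sub>R X' x c)"
        by (simp add: linear_sum[OF lin] linear_cmul[OF lin])
      finally have eq: "X' x h = (\<Sum>c\<in>Basis. (h \<bullet> c) *\<^sub>R X' x c)" .
      have "X' x h \<bullet> b = (\<Sum>c\<in>Basis. (h \<bullet> c) * (X' x c \<bullet> b))"
        unfolding eq by (simp add: inner_sum_left)
      moreover have "g x \<bullet> h = (\<Sum>c\<in>Basis. (X' x c \<bullet> b) * (c \<bullet> h))"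
        by (simp add: g_def inner_sum_left)
      ultimately show ?thesis by (simp add: inner_commute[of h] mult.commute)
    qed
    have "((\<lambda>x. X x \<bullet> b) has_derivative (\<lambda>h. g x \<bullet> h)) (at x)" for x
      unfolding gb by (rule has_derivative_inner_left[OF X(1)])
    moreover have "continuous_on UNIV g"
      unfolding g_def by (intro continuous_intros X(2))
    ultimately have t: "C1c K (\<lambda>x. X x \<bullet> b) g" using K by (auto simp: C1c_def)
    obtain M where M: "kernel M g" using C1c_kernel[OF t K(1)] by blast
    have gi: "integrable lborel g" by (rule kernel_integrable[OF M])
    have "(LINT x|lborel. g x \<bullet> b) = 0" 
      using integral_inner_left[of b lborel g] gi integral_gradient_zero[OF t K(1)] by simp
    then show ?thesis using integrable_inner_left[of b lborel g] gi by (simp add: gb)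
  qed
  then have "(LINT x|lborel. (\<Sum>b\<in>Basis. X' x b \<bullet> b)) = (\<Sum>b\<in>Basis. (LINT x|lborel. X' x b \<bullet> b))"
    by (intro Bochner_Integration.integral_sum) auto
  then show ?thesis using * by simp
qed

lemma continuous_on_zero_extension:
  fixes f :: "'a::metric_space \<Rightarrow> 'b::real_normed_vector"
  assumes "continuous_on U f" "open U" "closed K" "K \<subseteq> U" "\<And>x. x \<notin> K \<Longrightarrow> f x = 0"
  shows "continuous_on UNIV f"
proof -
  have "continuous_on (- K) f" using assms(5) by (intro continuous_on_eq[OF continuous_on_const[of _ 0]]) auto
  then have "continuous_on (U \<union> - K) f" using assms by (intro continuous_on_open_Un) auto
  moreover have "U \<union> - K = UNIV" using assms by auto
  ultimately show ?thesis by simp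
qed

lemma has_derivative_zero_outside:
  assumes "closed K" "x \<notin> K" "\<And>x. x \<notin> K \<Longrightarrow> f x = 0"
  shows "(f has_derivative (\<lambda>h. 0)) (at x)"
  by (rule has_derivative_transform_within_open[OF has_derivative_const[of 0], of "- K"]) (use assms in auto)

text \<open>The sum over \<open>Basis\<close> is the divergence of \<open>A\<close>; the formula is the divergence theorem for \<open>\<phi> A\<close>.\<close>

lemma integration_by_parts:
  fixes A :: "'a::euclidean_space \<Rightarrow> 'a"
  assumes U: "open U" and A: "\<And>x. x \<in> U \<Longrightarrow> (A has_derivative A' x) (at x)" "\<And>h. continuous_on U (\<lambda>x. A' x h)"
    and t: "C1c K \<phi> g" and K: "compact K" "K \<subseteq> U"
  shows "(LINT x|lborel. A x \<bullet> g x) = - (LINT x|lborel. \<phi> x * (\<Sum>b\<in>Basis. A' x b \<bullet> b))"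
    and "integrable lborel (\<lambda>x. A x \<bullet> g x)" "integrable lborel (\<lambda>x. \<phi> x * (\<Sum>b\<in>Basis. A' x b \<bullet> b))"
proof -
  note cl = compact_imp_closed[OF K(1)]
  have z: "\<phi> x = 0" "g x = 0" if "x \<notin> K" for x
    using C1cD(3)[OF t that] C1c_gradient_outside[OF t cl that] by auto
  have cA: "continuous_on U A"
    by (intro continuous_at_imp_continuous_on ballI has_derivative_continuous[OF A(1)])
  obtain M where M: "kernel M \<phi>" using C1c_kernel[OF t K(1)] by blast
  obtain d where d: "\<And>x. x \<in> K \<Longrightarrow> norm x \<le> d" using compact_imp_bounded[OF K(1)] bounded_iff by metis
  have dK: "x \<notin> K" if "d + 1 \<le> norm x" for x using d[of x] that by auto
  have c1: "continuous_on UNIV (\<lambda>x. A x \<bullet> g x)"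
    by (rule continuous_on_zero_extension[OF _ U cl K(2)])
      (use z in \<open>auto intro!: continuous_intros cA continuous_on_subset[OF C1cD(2)[OF t]]\<close>)
  have c2: "continuous_on UNIV (\<lambda>x. \<phi> x * (\<Sum>b\<in>Basis. A' x b \<bullet> b))"
    by (rule continuous_on_zero_extension[OF _ U cl K(2)])
      (use z in \<open>auto intro!: continuous_intros A(2) continuous_on_subset[OF C1cD(4)[OF t]]\<close>)
  show i1: "integrable lborel (\<lambda>x. A x \<bullet> g x)"
    by (rule kernel_integrable[of "d+1"]) (use c1 z dK in \<open>auto simp: kernel_def\<close>)
  show i2: "integrable lborel (\<lambda>x. \<phi> x * (\<Sum>b\<in>Basis. A' x b \<bullet> b))"
    by (rule kernel_integrable[of "d+1"]) (use c2 z dK in \<open>auto simp: kernel_def\<close>)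
  define X' where "X' x h = (g x \<bullet> h) *\<^sub>R A x + \<phi> x *\<^sub>R A' x h" for x h
  have "(LINT x|lborel. (\<Sum>b\<in>Basis. X' x b \<bullet> b)) = 0"
  proof (rule divergence_theorem_compact_support[where X="\<lambda>x. \<phi> x *\<^sub>R A x" and K=K])
    show "((\<lambda>x. \<phi> x *\<^sub>R A x) has_derivative X' x) (at x)" for x
    proof (cases "x \<in> K")
      case True
      then have "x \<in> U" using K by auto
      from has_derivative_scaleR[OF C1cD(1)[OF t] A(1)[OF this]]
      show ?thesis unfolding X'_def[abs_def] by (simp add: add.commute)
    next
      case False
      then have "X' x = (\<lambda>h. 0)" using z[OF False] by (auto simp: X'_def)
      then show ?thesis using has_derivative_zero_outside[OF cl False, of "\<lambda>x. \<phi> x *\<^sub>R A x"] z by auto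
    qed
    show "continuous_on UNIV (\<lambda>x. X' x h)" for h
      unfolding X'_def
      by (rule continuous_on_zero_extension[OF _ U cl K(2)])
        (use z in \<open>auto intro!: continuous_intros cA A(2) continuous_on_subset[OF C1cD(4)[OF t]] continuous_on_subset[OF C1cD(2)[OF t]]\<close>)
  qed (use K z in auto)
  moreover have "(\<Sum>b\<in>Basis. X' x b \<bullet> b) = A x \<bullet> g x + \<phi> x * (\<Sum>b\<in>Basis. A' x b \<bullet> b)" for x
  proof -
    have "(\<Sum>b\<in>Basis. (g x \<bullet> b) * (A x \<bullet> b)) = A x \<bullet> g x"
      by (subst euclidean_inner[of "A x" "g x"]) (simp add: mult.commute)
    then show ?thesis by (simp add: X'_def inner_add_left sum.distrib sum_distrib_left)
  qed
  ultimately have "(LINT x|lborel. A x \<bullet> g x + \<phi> x * (\<Sum>b\<in>Basis. A' x b \<bullet> b)) = 0" by simp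
  then show "(LINT x|lborel. A x \<bullet> g x) = - (LINT x|lborel. \<phi> x * (\<Sum>b\<in>Basis. A' x b \<bullet> b))"
    using i1 i2 by simp
qed

text \<open>A mollified indicator of a neighbourhood of \<open>K\<close>; it is constant near \<open>K\<close>, so its gradient vanishes there.\<close>

lemma cutoff_exists:
  fixes K :: "(real^'n) set"
  assumes K: "compact K" and U: "open U" "K \<subseteq> U"
  obtains L \<zeta> g where "compact L" "L \<subseteq> U" "K \<subseteq> L" "C1c L \<zeta> g" "\<And>x. 0 \<le> \<zeta> x" "\<And>x. x \<in> K \<Longrightarrow> \<zeta> x = 1"
    "\<And>x. x \<in> K \<Longrightarrow> g x = 0"
proof -
  obtain e where e: "e > 0" "thicken K e \<subseteq> U"
    using compact_subset_open_imp_cball_epsilon_subset[OF K U] by blast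
  define d where "d = e/3"
  have d: "d > 0" using e by (simp add: d_def)
  let ?N = "thicken K (2*d)" and ?L = "thicken K (3*d)"
  let ?i = "indicator ?N :: real^'n \<Rightarrow> real"
  let ?\<zeta> = "convol ?i (bump d)"
  have m: "mollifier d (bump d :: real^'n \<Rightarrow> real)" by (rule bump_mollifier[OF d])
  have cN: "compact ?N" by (rule compact_thicken[OF K])
  have i: "integrable lborel ?i"
    by (rule integrable_indicator_bounded[OF compact_imp_bounded[OF cN]]) (use compact_imp_closed[OF cN] in auto)
  note b0 = bump_outside[OF d]
  have sm: "smooth ?\<zeta>" by (rule convol_smooth[OF i bump_smooth b0 compact_cball])
  have out: "?\<zeta> x = 0" if "x \<notin> ?L" for x
  proof (rule convol_support[OF mollifierD(1)[OF m]])
    fix y assume y: "norm (x - y) < d"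
    show "?i y = 0"
    proof (rule ccontr)
      assume "?i y \<noteq> 0"
      then obtain z where "z \<in> K" "dist z y \<le> 2*d" by (auto simp: indicator_def split: if_splits)
      then have "z \<in> K" "dist z x \<le> 3*d"
        using y dist_triangle[of z x y] by (auto simp: dist_norm norm_minus_commute)
      then show False using that by auto
    qed
  qed
  have t: "C1c ?L ?\<zeta> (gradient ?\<zeta>)" by (rule smooth_C1c[OF sm out])
  have one: "?\<zeta> y = 1" if x: "x \<in> K" "dist x y < d" for x y
  proof -
    have "norm (?\<zeta> y - 1) \<le> 0"
    proof (rule convol_deviation_le[OF i m])
      fix z assume "norm (y - z) < d"
      then have "dist x z \<le> 2*d" using x dist_triangle[of x z y] by (auto simp: dist_norm)
      then show "norm (?i z - 1) \<le> 0" using x by (auto simp: indicator_def)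
    qed
    then show ?thesis by simp
  qed
  show ?thesis
  proof (rule that[of ?L ?\<zeta> "gradient ?\<zeta>"])
    show "compact ?L" by (rule compact_thicken[OF K])
    show "?L \<subseteq> U" using e by (simp add: d_def)
    show "K \<subseteq> ?L" using d by force
    show "0 \<le> ?\<zeta> x" for x using mollifierD(2)[OF m] by (auto simp: convol_def intro!: integral_nonneg_AE)
    show "C1c ?L ?\<zeta> (gradient ?\<zeta>)" by (rule t)
    show "?\<zeta> x = 1" if "x \<in> K" for x using one[OF that, of x] d by simp
    show "gradient ?\<zeta> x = 0" if "x \<in> K" for x
    proof -
      have "((\<lambda>y. 1) has_derivative (\<lambda>h. gradient ?\<zeta> x \<bullet> h)) (at x)"
        by (rule has_derivative_transform_within_open[OF C1cD(1)[OF t], of "ball x d"])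
          (use one[OF that] d in auto)
      then show ?thesis by (rule gradient_zero_if_constant)
    qed
  qed
qed

text \<open>Transfers the integrals in the definitions, which are over an open set and with respect to the
completed measure, to Borel functions on the whole space.\<close>

lemma set_integral_eq_lborel:
  fixes h :: "'a::euclidean_space \<Rightarrow> real"
  assumes F: "F \<in> borel_measurable borel" and ae: "AE x in lborel. indicator S x *\<^sub>R h x = F x"
  shows "(LINT x:S|lebesgue. h x) = (LINT x|lborel. F x)"
proof -
  have F': "F \<in> borel_measurable lebesgue" using F by (auto intro: measurable_completion)
  have ae': "AE x in lebesgue. indicator S x *\<^sub>R h x = F x" by (rule AE_completion[OF ae])
  have m: "(\<lambda>x. indicator S x *\<^sub>R h x) \<in> borel_measurable lebesgue"
    by (rule borel_measurable_AE[OF F']) (use ae' in auto)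
  have "(LINT x:S|lebesgue. h x) = (LINT x|lebesgue. F x)"
    unfolding set_lebesgue_integral_def by (rule integral_cong_AE[OF m F' ae'])
  also have "\<dots> = (LINT x|lborel. F x)" using F by (intro integral_completion) auto
  finally show ?thesis .
qed

lemma borel_truncation:
  fixes f :: "'a::euclidean_space \<Rightarrow> 'b::euclidean_space"
  assumes f: "f \<in> borel_measurable (lebesgue_on S)" and S: "S \<in> sets lebesgue" and K: "compact K" "K \<subseteq> S"
  obtains g where "g \<in> borel_measurable borel" "\<And>x. x \<notin> K \<Longrightarrow> g x = 0" "AE x in lborel. x \<in> K \<longrightarrow> g x = f x"
proof -
  have m: "(\<lambda>x. if x \<in> S then f x else 0) \<in> borel_measurable lebesgue" using borel_measurable_if_I[OF f S] .
  have "\<exists>g'\<in>borel_measurable lborel. (AE x in lborel. (if x \<in> S then f x else 0) \<bullet> b = g' x)" for b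
    by (rule completion_ex_borel_measurable_real) (use m in \<open>rule borel_measurable_inner\<close>, simp)
  then obtain g' where g': "\<And>b. g' b \<in> borel_measurable lborel" 
    "\<And>b. AE x in lborel. (if x \<in> S then f x else 0) \<bullet> b = g' b x" by metis
  define g where "g x = indicator K x *\<^sub>R (\<Sum>b\<in>Basis. g' b x *\<^sub>R b)" for x
  show ?thesis
  proof (rule that[of g])
    have [measurable]: "K \<in> sets borel" "\<And>b. g' b \<in> borel_measurable borel"
      using borel_closed[OF compact_imp_closed[OF K(1)]] g'(1) by auto
    show "g \<in> borel_measurable borel" unfolding g_def by measurable
    show "x \<notin> K \<Longrightarrow> g x = 0" for x by (simp add: g_def)
    have "AE x in lborel. \<forall>b\<in>Basis. (if x \<in> S then f x else 0) \<bullet> b = g' b x"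
      by (rule AE_finite_allI) (auto simp: g')
    then show "AE x in lborel. x \<in> K \<longrightarrow> g x = f x"
    proof eventually_elim
      case (elim x)
      show ?case
      proof
        assume x: "x \<in> K"
        then have "g x = (\<Sum>b\<in>Basis. (f x \<bullet> b) *\<^sub>R b)" using elim K by (auto simp: g_def intro!: sum.cong)
        then show "g x = f x" by (simp add: euclidean_representation)
      qed
    qed
  qed
qed

lemma le_one_plus_powr:
  assumes "0 \<le> (t::real)" "0 < a" "a \<le> b"
  shows "t powr a \<le> 1 + t powr b"
proof (cases "t \<le> 1")
  case True
  then have "t powr a \<le> 1" using assms by (simp add: powr_le1)
  then show ?thesis by (simp add: add_increasing2)
next
  case False
  then have "t powr a \<le> t powr b" using assms by (intro powr_mono) auto
  then show ?thesis by simp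
qed

text \<open>Restricting a local function to a compact set and passing to a Borel version makes it integrable on
the whole space, where convolution is available.\<close>

lemma Lp_loc_truncation:
  fixes f :: "real^'n \<Rightarrow> 'b::euclidean_space"
  assumes f: "Lp_loc p S f" and p: "p > 1" and S: "open S" and K: "compact K" "K \<subseteq> S"
  obtains g where "g \<in> borel_measurable borel" "\<And>x. x \<notin> K \<Longrightarrow> g x = 0" "AE x in lborel. x \<in> K \<longrightarrow> g x = f x"
    "integrable lborel (\<lambda>x. norm (g x) powr p)" "\<And>q. 0 < q \<Longrightarrow> q \<le> p \<Longrightarrow> integrable lborel (\<lambda>x. norm (g x) powr q)"
    "integrable lborel g"
proof -
  obtain g where g: "g \<in> borel_measurable borel" "\<And>x. x \<notin> K \<Longrightarrow> g x = 0" "AE x in lborel. x \<in> K \<longrightarrow> g x = f x"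
  proof -
    have "f \<in> borel_measurable (lebesgue_on S)" "S \<in> sets lebesgue" using f S by (auto simp: Lp_loc_def)
    then show ?thesis using borel_truncation[OF _ _ K] that by blast
  qed
  note [measurable] = g(1)
  have "integrable lebesgue (\<lambda>x. indicator K x *\<^sub>R norm (f x) powr p)"
    using f K by (auto simp: Lp_loc_def set_integrable_def)
  then have 1: "integrable lebesgue (\<lambda>x. indicator K x * norm (f x) powr p)" by simp
  have ae: "AE x in lebesgue. indicator K x * norm (f x) powr p = norm (g x) powr p"
    using AE_completion[OF g(3)] by eventually_elim (use g(2) in \<open>auto simp: indicator_def\<close>)
  have m: "(\<lambda>x. norm (g x) powr p) \<in> borel_measurable lebesgue"
    by (rule measurable_completion) measurable
  have "integrable lebesgue (\<lambda>x. norm (g x) powr p)"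
    by (rule integrable_cong_AE_imp[OF 1 m]) (use ae in \<open>auto simp: eq_commute\<close>)
  then have ip: "integrable lborel (\<lambda>x. norm (g x) powr p)"
    using integrable_completion[of "\<lambda>x. norm (g x) powr p" lborel] by simp
  have iK: "integrable lborel (indicator K :: real^'n \<Rightarrow> real)"
    using K compact_imp_closed compact_imp_bounded by (intro integrable_indicator_bounded) auto
  have iq: "integrable lborel (\<lambda>x. norm (g x) powr q)" if "0 < q" "q \<le> p" for q
  proof (rule Bochner_Integration.integrable_bound)
    show "integrable lborel (\<lambda>x. indicator K x + norm (g x) powr p)" using iK ip by auto
    show "AE x in lborel. norm (norm (g x) powr q) \<le> norm (indicator K x + norm (g x) powr p)"
    proof (intro AE_I2)
      fix x show "norm (norm (g x) powr q) \<le> norm (indicator K x + norm (g x) powr p)"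
        using le_one_plus_powr[of "norm (g x)" q p] that g(2)[of x] by (cases "x \<in> K") auto
    qed
  qed measurable
  have "integrable lborel (\<lambda>x. norm (g x) powr 1)" using p by (intro iq) auto
  then have "integrable lborel (\<lambda>x. norm (g x))" by (simp add: powr_one)
  then have "integrable lborel g" by (simp add: integrable_norm_iff)
  then show ?thesis using that g ip iq by blast
qed

section \<open>Mollified Sobolev functions and admissible test functions\<close>

lemma closed_subset_compact:
  assumes "compact L" "closed S" "S \<subseteq> L" shows "compact S"
  using compact_Int_closed[OF assms(1,2)] assms(3) by (simp add: Int_absorb1)

lemma convol_bounded_linear:
  fixes f :: "'a::euclidean_space \<Rightarrow> 'b::euclidean_space" and T :: "'b \<Rightarrow> 'c::euclidean_space"
  assumes T: "bounded_linear T" and f: "integrable lborel f" and r: "kernel d r"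
  shows "convol (\<lambda>x. T (f x)) r x = T (convol f r x)"
proof -
  interpret bounded_linear T by (rule T)
  have "convol (\<lambda>x. T (f x)) r x = (LINT y|lborel. T (r (x - y) *\<^sub>R f y))"
    by (simp add: convol_def scaleR)
  also have "\<dots> = T (convol f r x)"
    unfolding convol_def by (rule integral_bounded_linear[OF T convol_integrand[OF f r]])
  finally show ?thesis .
qed

text \<open>Convergence in \<open>L\<^sup>1\<close> gives convergence almost everywhere along a subsequence of the radii.\<close>

lemma mollifier_sequence:
  fixes f :: "real^'n \<Rightarrow> 'b::euclidean_space"
  assumes f: "integrable lborel f" and e: "e > 0"
  obtains \<delta> :: "nat \<Rightarrow> real" where "\<And>n. 0 < \<delta> n" "\<And>n. \<delta> n \<le> e"
    "(\<lambda>n. LINT x|lborel. norm (convol f (bump (\<delta> n)) x - f x)) \<longlonglongrightarrow> 0"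
    "AE x in lborel. (\<lambda>n. convol f (bump (\<delta> n)) x) \<longlonglongrightarrow> f x"
proof -
  have "\<exists>d>0. d \<le> e \<and> (LINT x|lborel. norm (convol f (bump d) x - f x)) < 1 / real (Suc n)" for n
  proof -
    obtain d where d: "d > 0" "\<And>r. mollifier d r \<Longrightarrow> (LINT x|lborel. norm (convol f r x - f x)) < 1 / real (Suc n)"
      using convol_L1_converges[OF f, of "1 / real (Suc n)"] by auto
    have "mollifier d (bump (min d e) :: real^'n \<Rightarrow> real)"
      by (rule mollifier_mono[OF bump_mollifier]) (use d e in auto)
    then show ?thesis using d e by (intro exI[of _ "min d e"]) auto
  qed
  then obtain \<epsilon> where \<epsilon>: "\<And>n. \<epsilon> n > 0" "\<And>n. \<epsilon> n \<le> e"
    "\<And>n. (LINT x|lborel. norm (convol f (bump (\<epsilon> n)) x - f x)) < 1 / real (Suc n)" by metis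
  have lim: "(\<lambda>n. LINT x|lborel. norm (convol f (bump (\<epsilon> n)) x - f x)) \<longlonglongrightarrow> 0"
  proof (rule tendsto_sandwich[OF _ _ tendsto_const LIMSEQ_inverse_real_of_nat])
    show "\<forall>\<^sub>F n in sequentially. (LINT x|lborel. norm (convol f (bump (\<epsilon> n)) x - f x)) \<le> inverse (real (Suc n))"
      using \<epsilon>(3) by (intro always_eventually) (auto simp: inverse_eq_divide less_imp_le)
  qed auto
  have i: "integrable lborel (\<lambda>x. convol f (bump (\<epsilon> n)) x - f x)" for n
    using convol_integrable[OF f bump_mollifier[OF \<epsilon>(1)]] f by auto
  obtain s :: "nat \<Rightarrow> nat" where s: "strict_mono s" "AE x in lborel. (\<lambda>n. convol f (bump (\<epsilon> (s n))) x - f x) \<longlonglongrightarrow> 0"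
    using tendsto_L1_AE_subseq[OF i lim] by blast
  show ?thesis
  proof (rule that[of "\<epsilon> \<circ> s"])
    show "(\<lambda>n. LINT x|lborel. norm (convol f (bump ((\<epsilon> \<circ> s) n)) x - f x)) \<longlonglongrightarrow> 0"
      using LIMSEQ_subseq_LIMSEQ[OF lim s(1)] by (simp add: comp_def)
    show "AE x in lborel. (\<lambda>n. convol f (bump ((\<epsilon> \<circ> s) n)) x) \<longlonglongrightarrow> f x"
      using s(2) by (simp add: LIM_zero_iff)
  qed (use \<epsilon> in auto)
qed

text \<open>Dominated convergence with varying bounds \<open>D n\<close> that converge in \<open>L\<^sup>1\<close>: cut \<open>T n\<close> off at the limiting
bound \<open>D'\<close>; the error is at most \<open>\<bar>D n - D'\<bar>\<close>.\<close>

lemma dominated_convergence_L1: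
  fixes T :: "nat \<Rightarrow> 'a \<Rightarrow> real"
  assumes T: "\<And>n. T n \<in> borel_measurable M" "T' \<in> borel_measurable M" "AE x in M. (\<lambda>n. T n x) \<longlonglongrightarrow> T' x"
    and D: "\<And>n. integrable M (D n)" "integrable M D'" "(\<lambda>n. LINT x|M. \<bar>D n x - D' x\<bar>) \<longlonglongrightarrow> 0"
      "AE x in M. (\<lambda>n. D n x) \<longlonglongrightarrow> D' x"
    and b: "\<And>n. AE x in M. \<bar>T n x\<bar> \<le> D n x"
  shows "(\<lambda>n. LINT x|M. T n x) \<longlonglongrightarrow> (LINT x|M. T' x)" "\<And>n. integrable M (T n)" "integrable M T'"
proof -
  show iT: "integrable M (T n)" for n
  proof (rule Bochner_Integration.integrable_bound[OF D(1)[of n] T(1)[of n]])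
    show "AE x in M. norm (T n x) \<le> norm (D n x)" using b[of n] by eventually_elim auto
  qed
  have "AE x in M. \<forall>n. \<bar>T n x\<bar> \<le> D n x" using b by (simp add: AE_all_countable)
  then have b': "AE x in M. \<bar>T' x\<bar> \<le> D' x"
    using T(3) D(4)
  proof eventually_elim
    case (elim x)
    then show ?case by (intro LIMSEQ_le[OF tendsto_rabs[OF elim(2)] elim(3)]) auto
  qed
  show iT': "integrable M T'"
  proof (rule Bochner_Integration.integrable_bound[OF D(2) T(2)])
    show "AE x in M. norm (T' x) \<le> norm (D' x)" using b' by eventually_elim auto
  qed
  define C where "C n x = max (- D' x) (min (T n x) (D' x))" for n x
  have [measurable]: "T n \<in> borel_measurable M" "D' \<in> borel_measurable M" for n using T D by auto
  have Cm: "C n \<in> borel_measurable M" for n unfolding C_def by measurable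
  have Cb: "AE x in M. norm (C n x) \<le> D' x" for n
    using b' by eventually_elim (auto simp: C_def)
  have iC: "integrable M (C n)" for n
  proof (rule Bochner_Integration.integrable_bound[OF D(2) Cm[of n]])
    show "AE x in M. norm (C n x) \<le> norm (D' x)" using Cb[of n] by eventually_elim auto
  qed
  have CT: "(\<lambda>n. LINT x|M. C n x) \<longlonglongrightarrow> (LINT x|M. T' x)"
  proof (rule integral_dominated_convergence[OF T(2) Cm D(2) _ Cb])
    show "AE x in M. (\<lambda>n. C n x) \<longlonglongrightarrow> T' x"
      using T(3) b'
    proof eventually_elim
      case (elim x)
      have "(\<lambda>n. C n x) \<longlonglongrightarrow> max (- D' x) (min (T' x) (D' x))"
        unfolding C_def by (intro tendsto_max tendsto_min tendsto_const elim(1))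
      moreover have "max (- D' x) (min (T' x) (D' x)) = T' x" using elim(2) by auto
      ultimately show ?case by simp
    qed
  qed
  have "(\<lambda>n. (LINT x|M. T n x) - (LINT x|M. C n x)) \<longlonglongrightarrow> 0"
  proof (rule tendsto_rabs_zero_cancel, rule tendsto_sandwich[OF _ _ tendsto_const D(3)])
    show "\<forall>\<^sub>F n in sequentially. \<bar>(LINT x|M. T n x) - (LINT x|M. C n x)\<bar> \<le> (LINT x|M. \<bar>D n x - D' x\<bar>)"
    proof (intro always_eventually allI)
      fix n
      have "\<bar>(LINT x|M. T n x) - (LINT x|M. C n x)\<bar> = \<bar>LINT x|M. T n x - C n x\<bar>"
        using iT iC by simp
      also have "\<dots> \<le> (LINT x|M. \<bar>T n x - C n x\<bar>)" by (rule integral_abs_bound)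
      also have "\<dots> \<le> (LINT x|M. \<bar>D n x - D' x\<bar>)"
      proof (rule integral_mono_AE)
        show "AE x in M. \<bar>T n x - C n x\<bar> \<le> \<bar>D n x - D' x\<bar>"
          using b[of n] b' by eventually_elim (auto simp: C_def)
      qed (use iT iC D in auto)
      finally show "\<bar>(LINT x|M. T n x) - (LINT x|M. C n x)\<bar> \<le> (LINT x|M. \<bar>D n x - D' x\<bar>)" .
    qed
  qed auto
  from tendsto_add[OF this CT] show "(\<lambda>n. LINT x|M. T n x) \<longlonglongrightarrow> (LINT x|M. T' x)" by simp
qed

lemma norm_powr_mult_norm:
  fixes a :: "'a::real_normed_vector"
  shows "norm a powr (p - 2) * norm a = norm a powr (p - 1)"
proof (cases "a = 0")
  case False
  then have "norm a powr (p - 2) * norm a = norm a powr (p - 2) * norm a powr 1" by simp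
  also have "\<dots> = norm a powr (p - 1)" by (simp only: powr_add[symmetric]) simp
  finally show ?thesis .
qed simp

text \<open>Mollification commutes with the weak gradient as long as the mollifying ball stays in \<open>K\<close>: the
translated and reflected bump is itself an admissible test function.\<close>

lemma convol_weak_gradient:
  fixes u :: "real^'n \<Rightarrow> real"
  assumes w: "weak_gradient \<Omega> u G" and K: "compact K" "K \<subseteq> \<Omega>"
    and u1: "integrable lborel u1" "\<And>x. x \<notin> K \<Longrightarrow> u1 x = 0" "AE x in lborel. x \<in> K \<longrightarrow> u1 x = u x"
    and G1: "integrable lborel G1" "\<And>x. x \<notin> K \<Longrightarrow> G1 x = 0" "AE x in lborel. x \<in> K \<longrightarrow> G1 x = G x"
    and d: "d > 0" "cball x d \<subseteq> K"
  shows "(convol u1 (bump d) has_derivative (\<lambda>h. convol G1 (bump d) x \<bullet> h)) (at x)"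
proof -
  let ?b = "bump d :: real^'n \<Rightarrow> real"
  have m: "mollifier d ?b" by (rule bump_mollifier[OF d(1)])
  note b0 = bump_outside[OF d(1)]
  have t: "C1c (cball 0 d) ?b (gradient ?b)" by (rule smooth_C1c[OF bump_smooth b0])
  note D = convol_has_derivative[OF u1(1) t compact_cball]
  define \<theta> where "\<theta> y = ?b (y - x)" for y
  have \<theta>: "\<theta> y = ?b (x - y)" for y unfolding \<theta>_def by (rule bump_even)
  have \<theta>0: "\<theta> y = 0" if "y \<notin> cball x d" for y using b0[of "x - y"] that by (simp add: \<theta> dist_norm norm_minus_commute)
  have cl: "closure {y. \<theta> y \<noteq> 0} \<subseteq> cball x d"
    by (rule closure_minimal[OF _ closed_cball]) (use \<theta>0 in blast)
  have in\<Omega>: "y \<in> \<Omega>" if "y \<in> cball x d" for y using that d K by blast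
  have sm: "smooth \<theta>" unfolding \<theta>_def by (rule bump_shift_smooth)
  have tf: "test_fun \<Omega> \<theta>"
    using cl d K sm closed_subset_compact[OF compact_cball _ cl] by (auto simp: test_fun_def smooth_def)
  have "(\<theta> has_derivative (\<lambda>h. gradient ?b (x - y) \<bullet> (- h))) (at y)" for y
  proof -
    have "((\<lambda>y. x - y) has_derivative (\<lambda>h. - h)) (at y)" by (auto intro!: derivative_eq_intros)
    from has_derivative_compose[OF this C1cD(1)[OF t, of "x - y"]] show ?thesis by (simp add: \<theta>[abs_def])
  qed
  then have pd: "partial_deriv i \<theta> y = - gradient ?b (x - y) $ i" for i y
    using has_derivative_imp_partial(1)[of \<theta> "- gradient ?b (x - y)"] by simp
  have gb0: "gradient ?b (x - y) = 0" if "y \<notin> cball x d" for y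
    using C1c_gradient_outside[OF t closed_cball, of "x - y"] that by (simp add: dist_norm norm_minus_commute)
  have [measurable]: "u1 \<in> borel_measurable borel" "G1 \<in> borel_measurable borel" using u1 G1 by auto
  have gm: "(\<lambda>y. gradient ?b (x - y)) \<in> borel_measurable borel"
    by (intro borel_measurable_continuous_onI continuous_on_compose2[OF C1cD(2)[OF t]]) (auto intro: continuous_intros)
  have [measurable]: "(\<lambda>y. ?b (x - y)) \<in> borel_measurable borel"
    by (rule kernel_shift_measurable[OF mollifierD(1)[OF m]])
  have "(LINT y|lborel. u1 y *\<^sub>R gradient ?b (x - y)) $ i = convol G1 ?b x $ i" for i
  proof -
    have [measurable]: "(\<lambda>y. gradient ?b (x - y) $ i) \<in> borel_measurable borel" "(\<lambda>y. G1 y $ i) \<in> borel_measurable borel"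
      using gm by (auto simp: cart_eq_inner_axis)
    have 1: "(LINT y:\<Omega>|lebesgue. u y * partial_deriv i \<theta> y) = (LINT y|lborel. - (u1 y * gradient ?b (x - y) $ i))"
    proof (rule set_integral_eq_lborel)
      show "AE y in lborel. indicator \<Omega> y *\<^sub>R (u y * partial_deriv i \<theta> y) = - (u1 y * gradient ?b (x - y) $ i)"
        using u1(3)
      proof eventually_elim
        case (elim y)
        then show ?case using gb0[of y] in\<Omega>[of y] d(2) by (cases "y \<in> cball x d") (auto simp: pd subset_iff)
      qed
    qed simp
    have 2: "(LINT y:\<Omega>|lebesgue. G y $ i * \<theta> y) = (LINT y|lborel. ?b (x - y) * G1 y $ i)"
    proof (rule set_integral_eq_lborel)
      show "AE y in lborel. indicator \<Omega> y *\<^sub>R (G y $ i * \<theta> y) = ?b (x - y) * G1 y $ i"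
        using G1(3)
      proof eventually_elim
        case (elim y)
        then show ?case using \<theta>0[of y] in\<Omega>[of y] d(2) by (cases "y \<in> cball x d") (auto simp: \<theta> subset_iff)
      qed
    qed simp
    have "(LINT y|lborel. u1 y * gradient ?b (x - y) $ i) = (LINT y|lborel. ?b (x - y) * G1 y $ i)"
      using w tf 1 2 unfolding weak_gradient_def by simp
    moreover have "(LINT y|lborel. u1 y *\<^sub>R gradient ?b (x - y)) $ i = (LINT y|lborel. u1 y * gradient ?b (x - y) $ i)"
      using integral_bounded_linear[OF bounded_linear_vec_nth[of i] D(2)[of x]] by simp
    moreover have "convol G1 ?b x $ i = (LINT y|lborel. ?b (x - y) * G1 y $ i)"
      using integral_bounded_linear[OF bounded_linear_vec_nth[of i] convol_integrand[OF G1(1) mollifierD(1)[OF m]], of x]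
      by (simp add: convol_def)
    ultimately show ?thesis by simp
  qed
  then have "(LINT y|lborel. u1 y *\<^sub>R gradient ?b (x - y)) = convol G1 ?b x" by (simp add: vec_eq_iff)
  then show ?thesis using D(1)[of x] by simp
qed

text \<open>The defining inequality, assumed for smooth test functions, extends to nonnegative \<open>C\<^sup>1\<close> test functions
by mollifying them.\<close>

lemma weak_subsolution_C1c:
  fixes G G1 :: "real^'n \<Rightarrow> real^'n"
  assumes p: "p > 1" and \<Omega>: "open \<Omega>" and G: "Lp_loc p \<Omega> G"
    and ineq: "\<And>\<theta>. test_fun \<Omega> \<theta> \<Longrightarrow> (\<forall>x. 0 \<le> \<theta> x) \<Longrightarrow>
       (LINT x:\<Omega>|lebesgue. norm (G x) powr (p - 2) * (G x \<bullet> gradient \<theta> x)) \<le> 0"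
    and t: "C1c K \<phi> g" "\<And>x. 0 \<le> \<phi> x" and K: "compact K" "K \<subseteq> \<Omega>"
    and G1: "G1 \<in> borel_measurable borel" "AE x in lborel. x \<in> K \<longrightarrow> G1 x = G x"
  shows "(LINT x|lborel. norm (G1 x) powr (p - 2) * (G1 x \<bullet> g x)) \<le> 0"
proof -
  obtain d where d: "d > 0" "thicken K d \<subseteq> \<Omega>"
    using compact_subset_open_imp_cball_epsilon_subset[OF K(1) \<Omega> K(2)] by blast
  let ?L = "thicken K d"
  have L: "compact ?L" by (rule compact_thicken[OF K(1)])
  obtain G2 where G2: "G2 \<in> borel_measurable borel" "\<And>x. x \<notin> ?L \<Longrightarrow> G2 x = 0" "AE x in lborel. x \<in> ?L \<longrightarrow> G2 x = G x"
    "integrable lborel (\<lambda>x. norm (G2 x) powr p)"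
    "\<And>q. 0 < q \<Longrightarrow> q \<le> p \<Longrightarrow> integrable lborel (\<lambda>x. norm (G2 x) powr q)" "integrable lborel G2"
    by (rule Lp_loc_truncation[OF G p \<Omega> L d(2)]) (rule that)
  obtain M where M: "kernel M \<phi>" "kernel M g" using C1c_kernel[OF t(1) K(1)] by blast
  note \<phi>i = kernel_integrable[OF M(1)] and gi = kernel_integrable[OF M(2)]
  obtain B where B: "B > 0" "\<And>x. norm (g x) \<le> B" using kernel_bounded[OF M(2)] by blast
  obtain \<delta> where \<delta>: "\<And>n. 0 < \<delta> n" "\<And>n. \<delta> n \<le> d"
    "(\<lambda>n. LINT x|lborel. norm (convol g (bump (\<delta> n)) x - g x)) \<longlonglongrightarrow> 0"
    "AE x in lborel. (\<lambda>n. convol g (bump (\<delta> n)) x) \<longlonglongrightarrow> g x" by (rule mollifier_sequence[OF gi d(1)]) (rule that)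
  define \<rho> where "\<rho> n = (bump (\<delta> n) :: real^'n \<Rightarrow> real)" for n
  have m: "mollifier (\<delta> n) (\<rho> n)" for n unfolding \<rho>_def by (rule bump_mollifier[OF \<delta>(1)])
  note [measurable] = G2(1) G1(1)
  have [measurable]: "g \<in> borel_measurable borel" using gi by auto
  have [measurable]: "convol g (\<rho> n) \<in> borel_measurable borel" for n using convol_integrable[OF gi m] by auto
  have g0: "g x = 0" if "x \<notin> K" for x by (rule C1c_gradient_outside[OF t(1) compact_imp_closed[OF K(1)] that])
  have far: "x \<in> ?L" if "y \<in> K" "norm (x - y) < \<delta> n" for x y n
    using that \<delta>(2)[of n] by (auto simp: dist_norm norm_minus_commute intro!: bexI[of _ y])
  have step: "(LINT x|lborel. norm (G2 x) powr (p - 2) * (G2 x \<bullet> convol g (\<rho> n) x)) \<le> 0" for n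
  proof -
    let ?\<theta> = "convol \<phi> (\<rho> n)"
    have b0: "\<rho> n y = 0" if "y \<notin> cball 0 (\<delta> n)" for y
      unfolding \<rho>_def using \<delta>(1) that by (rule bump_outside)
    have sm: "smooth ?\<theta>" by (rule convol_smooth[OF \<phi>i _ b0 compact_cball]) (simp add: \<rho>_def bump_smooth)
    have out: "?\<theta> x = 0" if "x \<notin> ?L" for x
      by (rule convol_support[OF mollifierD(1)[OF m]]) (use that far C1cD(3)[OF t(1)] in blast)
    have cl: "closure {x. ?\<theta> x \<noteq> 0} \<subseteq> ?L"
      by (rule closure_minimal[OF _ compact_imp_closed[OF L]]) (use out in blast)
    have tf: "test_fun \<Omega> ?\<theta>"
      using cl d(2) sm closed_subset_compact[OF L _ cl] by (auto simp: test_fun_def smooth_def)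
    have nn: "0 \<le> ?\<theta> x" for x using mollifierD(2)[OF m] t(2) by (auto simp: convol_def intro!: integral_nonneg_AE)
    have "(?\<theta> has_derivative (\<lambda>h. convol g (\<rho> n) x \<bullet> h)) (at x)" for x
    proof -
      have "(LINT y|lborel. \<rho> n y *\<^sub>R g (x - y)) = (LINT y|lborel. (\<lambda>z. \<rho> n (x - z) *\<^sub>R g z) (x - y))" by simp
      also have "\<dots> = convol g (\<rho> n) x" unfolding convol_def by (rule integral_reflect)
      finally show ?thesis
        using convol_has_derivative(1)[OF kernel_integrable[OF mollifierD(1)[OF m[of n]]] t(1) K(1), of x]
        by (simp add: convol_commute[of \<phi>])
    qed
    then have gr: "gradient ?\<theta> x = convol g (\<rho> n) x" for x by (rule has_derivative_imp_partial(2))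
    have "(LINT x:\<Omega>|lebesgue. norm (G x) powr (p - 2) * (G x \<bullet> gradient ?\<theta> x)) =
       (LINT x|lborel. norm (G2 x) powr (p - 2) * (G2 x \<bullet> convol g (\<rho> n) x))"
    proof (rule set_integral_eq_lborel)
      show "AE x in lborel. indicator \<Omega> x *\<^sub>R (norm (G x) powr (p - 2) * (G x \<bullet> gradient ?\<theta> x)) =
         norm (G2 x) powr (p - 2) * (G2 x \<bullet> convol g (\<rho> n) x)"
        using G2(3)
      proof eventually_elim
        case (elim x)
        show ?case
        proof (cases "x \<in> ?L")
          case True
          then have "x \<in> \<Omega>" using d(2) by blast
          then show ?thesis using True elim by (simp add: gr)
        next
          case False
          have "convol g (\<rho> n) x = 0"
            by (rule convol_support[OF mollifierD(1)[OF m]]) (use False far g0 in blast)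
          then show ?thesis by (simp add: gr)
        qed
      qed
    qed measurable
    then show ?thesis using ineq[OF tf] nn by simp
  qed
  have bound: "\<bar>norm (G2 x) powr (p - 2) * (G2 x \<bullet> h)\<bar> \<le> B * norm (G2 x) powr (p - 1)" if "norm h \<le> B" for x h
  proof -
    have "\<bar>G2 x \<bullet> h\<bar> \<le> norm (G2 x) * B"
      using Cauchy_Schwarz_ineq2[of "G2 x" h] mult_left_mono[OF that norm_ge_zero[of "G2 x"]] by linarith
    then have "norm (G2 x) powr (p - 2) * \<bar>G2 x \<bullet> h\<bar> \<le> norm (G2 x) powr (p - 2) * (norm (G2 x) * B)"
      by (intro mult_left_mono) auto
    then show ?thesis by (simp add: abs_mult norm_powr_mult_norm[symmetric] mult_ac)
  qed
  have "(\<lambda>n. LINT x|lborel. norm (G2 x) powr (p - 2) * (G2 x \<bullet> convol g (\<rho> n) x)) \<longlonglongrightarrow>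
     (LINT x|lborel. norm (G2 x) powr (p - 2) * (G2 x \<bullet> g x))"
  proof (rule integral_dominated_convergence)
    show "integrable lborel (\<lambda>x. B * norm (G2 x) powr (p - 1))" using G2(5)[of "p - 1"] p by auto
    show "AE x in lborel. (\<lambda>n. norm (G2 x) powr (p - 2) * (G2 x \<bullet> convol g (\<rho> n) x)) \<longlonglongrightarrow> norm (G2 x) powr (p - 2) * (G2 x \<bullet> g x)"
      using \<delta>(4) by eventually_elim (auto simp: \<rho>_def intro!: tendsto_intros)
    show "AE x in lborel. norm (norm (G2 x) powr (p - 2) * (G2 x \<bullet> convol g (\<rho> n) x)) \<le> B * norm (G2 x) powr (p - 1)" for n
      using bound convol_deviation_le[OF gi m[of n], of _ 0 B] B by (intro AE_I2) simp
  qed measurable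
  then have "(LINT x|lborel. norm (G2 x) powr (p - 2) * (G2 x \<bullet> g x)) \<le> 0"
    using step by (intro LIMSEQ_le_const2) auto
  moreover have "(LINT x|lborel. norm (G1 x) powr (p - 2) * (G1 x \<bullet> g x)) = (LINT x|lborel. norm (G2 x) powr (p - 2) * (G2 x \<bullet> g x))"
  proof (rule integral_cong_AE)
    show "AE x in lborel. norm (G1 x) powr (p - 2) * (G1 x \<bullet> g x) = norm (G2 x) powr (p - 2) * (G2 x \<bullet> g x)"
      using G1(2) G2(3)
    proof eventually_elim
      case (elim x)
      have "x \<in> K \<Longrightarrow> x \<in> ?L" using d(1) by force
      then show ?case using elim g0[of x] by (cases "x \<in> K") auto
    qed
  qed measurable
  ultimately show ?thesis by simp
qed

lemma powr_young:
  assumes "0 \<le> (a::real)" "0 \<le> b" "p > 1"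
  shows "a powr (p - 1) * b \<le> a powr p + b powr p"
proof -
  define m where "m = max a b"
  have "a powr (p-1) * b \<le> m powr (p-1) * m"
    using assms by (intro mult_mono powr_mono2) (auto simp: m_def)
  also have "\<dots> = m powr p" using norm_powr_mult_norm[of m "p+1"] assms norm_powr_mult_norm[of m p]
    by (cases "m = 0") (auto simp: m_def powr_diff)
  also have "\<dots> \<le> a powr p + b powr p" by (auto simp: m_def max_def)
  finally show ?thesis .
qed

text \<open>Young's inequality under the averaging integral. It bounds the product of \<open>|G|\<^sup>p\<^sup>-\<^sup>1\<close> with a mollified
gradient by terms that converge in \<open>L\<^sup>1\<close>, so that no convergence in \<open>L\<^sup>p\<close> has to be established.\<close>

lemma convol_young:
  fixes f :: "'a::euclidean_space \<Rightarrow> 'b::euclidean_space"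
  assumes f: "integrable lborel f" "integrable lborel (\<lambda>x. norm (f x) powr p)" and m: "mollifier d r"
    and p: "p > 1" and c: "0 \<le> c" "0 \<le> a"
  shows "(c powr (p - 1) + a) * norm (convol f r x) \<le> c powr p + convol (\<lambda>y. norm (f y) powr p + a * norm (f y)) r x"
proof -
  note k = mollifierD(1)[OF m]
  have i1: "integrable lborel (\<lambda>y. norm (f y))" using f by auto
  have i2: "integrable lborel (\<lambda>y. norm (f y) powr p + a * norm (f y))" using f by auto
  have "(c powr (p - 1) + a) * norm (convol f r x) \<le> (c powr (p - 1) + a) * convol (\<lambda>y. norm (f y)) r x"
    using norm_convol_le[OF f(1) m] c by (intro mult_left_mono) auto
  also have "\<dots> = (LINT y|lborel. (c powr (p - 1) + a) * (r (x - y) * norm (f y)))"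
    unfolding convol_def by simp
  also have "\<dots> \<le> (LINT y|lborel. r (x - y) * c powr p + r (x - y) *\<^sub>R (norm (f y) powr p + a * norm (f y)))"
  proof (rule integral_mono)
    show "integrable lborel (\<lambda>y. (c powr (p - 1) + a) * (r (x - y) * norm (f y)))"
      using convol_integrand[OF i1 k] by (intro integrable_mult_right) simp
    show "integrable lborel (\<lambda>y. r (x - y) * c powr p + r (x - y) *\<^sub>R (norm (f y) powr p + a * norm (f y)))"
      using convol_integrand[OF i2 k] mollifierD(4)[OF m] by auto
    fix y
    have "c powr (p-1) * norm (f y) \<le> c powr p + norm (f y) powr p" using powr_young[OF c(1) norm_ge_zero p] .
    then have "r (x - y) * (c powr (p-1) * norm (f y)) \<le> r (x - y) * (c powr p + norm (f y) powr p)"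
      using mollifierD(2)[OF m] by (intro mult_left_mono) auto
    then show "(c powr (p - 1) + a) * (r (x - y) * norm (f y)) \<le> r (x - y) * c powr p + r (x - y) *\<^sub>R (norm (f y) powr p + a * norm (f y))"
      by (simp add: algebra_simps)
  qed
  also have "\<dots> = c powr p + convol (\<lambda>y. norm (f y) powr p + a * norm (f y)) r x"
    using convol_integrand[OF i2 k] mollifierD(3,4)[OF m] unfolding convol_def by simp
  finally show ?thesis .
qed

lemma convol_continuous:
  fixes f :: "real^'n \<Rightarrow> 'b::euclidean_space"
  assumes f: "integrable lborel f" and d: "d > 0"
  shows "continuous_on UNIV (convol f (bump d))"
proof -
  have m: "mollifier d (bump d :: real^'n \<Rightarrow> real)" by (rule bump_mollifier[OF d])
  note b0 = bump_outside[OF d]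
  have "continuous_on UNIV (\<lambda>x. convol f (bump d) x \<bullet> b)" for b
  proof -
    have i: "integrable lborel (\<lambda>x. f x \<bullet> b)" using f by auto
    have "convol (\<lambda>x. f x \<bullet> b) (bump d) x = convol f (bump d) x \<bullet> b" for x
      by (rule convol_bounded_linear[OF bounded_linear_inner_left f mollifierD(1)[OF m]])
    moreover have "continuous_on UNIV (convol (\<lambda>x. f x \<bullet> b) (bump d))"
      by (rule smoothD(3)[OF convol_smooth[OF i bump_smooth b0 compact_cball]])
    ultimately show ?thesis by simp
  qed
  then show ?thesis by (subst continuous_on_componentwise) auto
qed

section \<open>Strict supersolutions and monotonicity of the p-Laplacian\<close>

text \<open>\<open>V\<close> is the gradient of \<open>v\<close>, and the sum over \<open>Basis\<close> is the divergence of the field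
\<open>|V|\<^sup>p\<^sup>-\<^sup>2 V\<close>, that is, the \<open>p\<close>-Laplacian of \<open>v\<close>. Asking for the derivative of that field avoids second
derivatives of \<open>v\<close> and the degeneracy at critical points.\<close>

definition strict_supersolution ::
    "real \<Rightarrow> 'a::euclidean_space set \<Rightarrow> ('a \<Rightarrow> real) \<Rightarrow> ('a \<Rightarrow> 'a) \<Rightarrow> bool" where
  "strict_supersolution p U v V \<longleftrightarrow>
     (\<forall>x\<in>U. (v has_derivative (\<lambda>h. V x \<bullet> h)) (at x)) \<and> continuous_on U V \<and>
     (\<exists>A'. (\<forall>x\<in>U. ((\<lambda>x. norm (V x) powr (p - 2) *\<^sub>R V x) has_derivative A' x) (at x)) \<and>
        (\<forall>h. continuous_on U (\<lambda>x. A' x h)) \<and> (\<forall>x\<in>U. (\<Sum>b\<in>Basis. A' x b \<bullet> b) < 0))"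

text \<open>A bounded \<open>C\<^sup>1\<close> substitute for the positive part; it vanishes exactly for \<open>t \<le> 0\<close>.\<close>

definition ramp :: "real \<Rightarrow> real" where
  "ramp t = (max t 0)\<^sup>2 / (1 + (max t 0)\<^sup>2)"

definition ramp' :: "real \<Rightarrow> real" where
  "ramp' t = 2 * max t 0 / (1 + (max t 0)\<^sup>2)\<^sup>2"

lemma one_plus_square_nz: "1 + (x::real)\<^sup>2 \<noteq> 0" "1 + (x::real)\<^sup>2 > 0"
  using zero_le_power2[of x] by linarith+

lemma ramp_deriv: "(ramp has_real_derivative ramp' t) (at t)"
proof (cases t "0::real" rule: linorder_cases)
  case less
  have "((\<lambda>t. 0) has_real_derivative 0) (at t)" by auto
  then have "(ramp has_real_derivative 0) (at t)"
    by (rule has_field_derivative_transform_within_open[where S="{..<0}"]) (use less in \<open>auto simp: ramp_def\<close>)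
  then show ?thesis using less by (simp add: ramp'_def)
next
  case equal
  have l: "((\<lambda>h::real. max h 0 * \<bar>h\<bar> / (1 + (max h 0)\<^sup>2) / \<bar>h\<bar>) \<longlongrightarrow> 0) (at 0)"
  proof -
    have "((\<lambda>h::real. max h 0 / (1 + (max h 0)\<^sup>2)) \<longlongrightarrow> max 0 0 / (1 + (max 0 0)\<^sup>2)) (at 0)"
      by (intro tendsto_intros) (auto simp: one_plus_square_nz)
    then have "((\<lambda>h::real. max h 0 / (1 + (max h 0)\<^sup>2)) \<longlongrightarrow> 0) (at 0)" by simp
    then show ?thesis
      by (rule Lim_transform_eventually) (auto simp: eventually_at_filter)
  qed
  have "((\<lambda>h. (ramp (0 + h) - ramp 0) / h) \<longlongrightarrow> 0) (at 0)"
    by (rule Lim_transform_eventually[OF l])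
      (auto simp: eventually_at_filter ramp_def max_def power2_eq_square)
  then show ?thesis using equal by (simp add: DERIV_def ramp'_def)
next
  case greater
  have "((\<lambda>t. t\<^sup>2 / (1 + t\<^sup>2)) has_real_derivative ramp' t) (at t)"
  proof -
    have "((\<lambda>t. t\<^sup>2 / (1 + t\<^sup>2)) has_real_derivative (2 * t * (1 + t\<^sup>2) - t\<^sup>2 * (2 * t)) / ((1 + t\<^sup>2) * (1 + t\<^sup>2))) (at t)"
      by (auto intro!: derivative_eq_intros simp: one_plus_square_nz)
    moreover have "(2 * t * (1 + t\<^sup>2) - t\<^sup>2 * (2 * t)) / ((1 + t\<^sup>2) * (1 + t\<^sup>2)) = ramp' t"
      using greater by (simp add: ramp'_def power2_eq_square algebra_simps)
    ultimately show ?thesis by simp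
  qed
  then show ?thesis
    by (rule has_field_derivative_transform_within_open[where S="{0<..}"]) (use greater in \<open>auto simp: ramp_def max_def\<close>)
qed

lemma ramp_bounds: "0 \<le> ramp t" "ramp t \<le> 1" "ramp t = 0 \<longleftrightarrow> t \<le> 0" "t \<le> 0 \<Longrightarrow> ramp t = 0" "0 \<le> ramp' t" "ramp' t \<le> 2"
  "t \<le> 0 \<Longrightarrow> ramp' t = 0"
proof -
  show "0 \<le> ramp t" "0 \<le> ramp' t" by (auto simp: ramp_def ramp'_def)
  show "ramp t \<le> 1" using one_plus_square_nz(2)[of "max t 0"] by (simp add: ramp_def divide_le_eq)
  show "ramp t = 0 \<longleftrightarrow> t \<le> 0" using one_plus_square_nz(1)[of "max t 0"] by (auto simp: ramp_def max_def)
  then show "t \<le> 0 \<Longrightarrow> ramp t = 0" by simp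
  show "t \<le> 0 \<Longrightarrow> ramp' t = 0" by (simp add: ramp'_def)
  let ?m = "max t 0"
  have "?m \<le> 1 + ?m\<^sup>2" using zero_le_power2[of "?m - 1/2"] by (simp add: power2_eq_square algebra_simps)
  also have "\<dots> \<le> (1 + ?m\<^sup>2)\<^sup>2" using self_le_power[of "1 + ?m\<^sup>2" 2] by simp
  finally show "ramp' t \<le> 2" using one_plus_square_nz(2)[of ?m] by (simp add: ramp'_def divide_le_eq)
qed

lemma continuous_ramp [continuous_intros]:
  "continuous_on S f \<Longrightarrow> continuous_on S (\<lambda>x. ramp (f x))"
  "continuous_on S f \<Longrightarrow> continuous_on S (\<lambda>x. ramp' (f x))"
  unfolding ramp_def ramp'_def by (intro continuous_intros; auto simp: one_plus_square_nz)+

text \<open>By the Cauchy-Schwarz inequality the inner product is at least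
\<open>(|a|\<^sup>p\<^sup>-\<^sup>1 - |b|\<^sup>p\<^sup>-\<^sup>1) (|a| - |b|)\<close>, which has two factors of the same sign.\<close>

lemma p_monotone:
  fixes a b :: "'a::real_inner"
  assumes p: "p > 1"
  shows "0 \<le> (norm a powr (p - 2) *\<^sub>R a - norm b powr (p - 2) *\<^sub>R b) \<bullet> (a - b)"
proof -
  let ?A = "norm a" and ?B = "norm b"
  have aa: "norm a powr (p-2) * (a \<bullet> a) = norm a powr (p - 1) * norm a" for a :: 'a
    using norm_powr_mult_norm[of a p] by (simp add: power2_norm_eq_inner[symmetric] power2_eq_square mult.assoc[symmetric])
  have ab: "norm a powr (p-2) * (a \<bullet> b) \<le> norm a powr (p-1) * norm b" for a b :: 'a
    using mult_left_mono[OF norm_cauchy_schwarz[of a b], of "norm a powr (p-2)"] norm_powr_mult_norm[of a p]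
    by (simp add: mult.assoc[symmetric])
  have "0 \<le> (?A powr (p - 1) - ?B powr (p - 1)) * (?A - ?B)"
  proof (cases "?A \<le> ?B")
    case True
    then have "?A powr (p - 1) \<le> ?B powr (p - 1)" using p by (intro powr_mono2) auto
    then show ?thesis using True by (simp add: mult_nonpos_nonpos)
  next
    case False
    then have "?B powr (p - 1) \<le> ?A powr (p - 1)" using p by (intro powr_mono2) auto
    then show ?thesis using False by simp
  qed
  also have "\<dots> \<le> (norm a powr (p - 2) *\<^sub>R a - norm b powr (p - 2) *\<^sub>R b) \<bullet> (a - b)"
    using aa[of a] aa[of b] ab[of a b] ab[of b a] by (simp add: inner_diff_left inner_diff_right inner_commute algebra_simps)
  finally show ?thesis .
qed

section \<open>Comparison of weak subsolutions with strict supersolutions\<close>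

lemma integrable_Pair:
  fixes f :: "'a \<Rightarrow> 'b::euclidean_space" and g :: "'a \<Rightarrow> 'c::euclidean_space"
  assumes "integrable M f" "integrable M g" shows "integrable M (\<lambda>x. (f x, g x))"
proof -
  have "integrable M (\<lambda>x. (f x, 0::'c) + (0::'b, g x))"
    by (intro Bochner_Integration.integrable_add integrable_bounded_linear[OF _ assms(1)] integrable_bounded_linear[OF _ assms(2)]
        bounded_linear_Pair bounded_linear_ident bounded_linear_zero)
  then show ?thesis by simp
qed

text \<open>Test the subsolution inequality for \<open>u\<close> and the supersolution inequality for \<open>v\<close> with
\<open>\<zeta> * ramp (u\<^sub>n - v)\<close>, subtract and let \<open>n\<close> tend to infinity. The term with the gradient of \<open>\<zeta>\<close> drops
out because \<open>u < v\<close> off \<open>K\<close> and \<open>\<zeta>\<close> is constant near \<open>K\<close>. What remains on the left is nonnegative by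
monotonicity, while the right-hand side is the integral of \<open>\<zeta> * ramp (u - v)\<close> against the negative
divergence; so \<open>ramp (u - v)\<close> vanishes almost everywhere on \<open>K\<close>.\<close>

lemma weak_comparison:
  fixes u v :: "real^'n \<Rightarrow> real"
  assumes p: "p > 1" and \<Omega>: "open \<Omega>" and u: "weak_subsolution p \<Omega> u"
    and U: "open U" "U \<subseteq> \<Omega>" and v: "strict_supersolution p U v V"
    and K: "compact K" "K \<subseteq> U" and off: "\<And>x. x \<in> U - K \<Longrightarrow> u x < v x"
  shows "AE x in lborel. x \<in> U \<longrightarrow> u x \<le> v x"
proof -
  obtain G where G: "W1p_loc p \<Omega> u G"
    "\<And>\<theta>. test_fun \<Omega> \<theta> \<Longrightarrow> (\<forall>x. 0 \<le> \<theta> x) \<Longrightarrow>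
       (LINT x:\<Omega>|lebesgue. norm (G x) powr (p - 2) * (G x \<bullet> gradient \<theta> x)) \<le> 0"
    using u unfolding weak_subsolution_def by blast
  have G': "Lp_loc p \<Omega> u" "Lp_loc p \<Omega> G" "weak_gradient \<Omega> u G" using G(1) by (auto simp: W1p_loc_def)
  define A where "A x = norm (V x) powr (p - 2) *\<^sub>R V x" for x
  obtain A' where v': "\<And>x. x \<in> U \<Longrightarrow> (v has_derivative (\<lambda>h. V x \<bullet> h)) (at x)" "continuous_on U V"
    "\<And>x. x \<in> U \<Longrightarrow> (A has_derivative A' x) (at x)" "\<And>h. continuous_on U (\<lambda>x. A' x h)"
    "\<And>x. x \<in> U \<Longrightarrow> (\<Sum>b\<in>Basis. A' x b \<bullet> b) < 0"
    using v unfolding strict_supersolution_def A_def[abs_def] by blast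
  define D where "D x = (\<Sum>b\<in>Basis. A' x b \<bullet> b)" for x
  have cv: "continuous_on U v" and cA: "continuous_on U A"
    by (auto intro!: continuous_at_imp_continuous_on has_derivative_continuous v')
  have cD: "continuous_on U D" unfolding D_def by (intro continuous_intros v')
  obtain L \<zeta> g where L: "compact L" "L \<subseteq> U" "K \<subseteq> L" and \<zeta>: "C1c L \<zeta> g" "\<And>x. 0 \<le> \<zeta> x" "\<And>x. x \<in> K \<Longrightarrow> \<zeta> x = 1"
    "\<And>x. x \<in> K \<Longrightarrow> g x = 0"
    by (rule cutoff_exists[OF K(1) U(1) K(2)]) (rule that)
  obtain d where d: "d > 0" "thicken L d \<subseteq> U"
    using compact_subset_open_imp_cball_epsilon_subset[OF L(1) U(1) L(2)] by blast
  define N where "N = thicken L d"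
  have N: "compact N" "N \<subseteq> U" "N \<subseteq> \<Omega>" "L \<subseteq> N"
  proof -
    show "compact N" unfolding N_def by (rule compact_thicken[OF L(1)])
    show "N \<subseteq> U" using d by (simp add: N_def)
    then show "N \<subseteq> \<Omega>" using U by blast
    have "x \<in> cball x d" for x :: "real^'n" using d by simp
    then show "L \<subseteq> N" unfolding N_def by blast
  qed
  obtain u1 where u1: "u1 \<in> borel_measurable borel" "\<And>x. x \<notin> N \<Longrightarrow> u1 x = 0" "AE x in lborel. x \<in> N \<longrightarrow> u1 x = u x"
    "integrable lborel (\<lambda>x. norm (u1 x) powr p)"
    "\<And>q. 0 < q \<Longrightarrow> q \<le> p \<Longrightarrow> integrable lborel (\<lambda>x. norm (u1 x) powr q)" "integrable lborel u1"
    by (rule Lp_loc_truncation[OF G'(1) p \<Omega> N(1,3)]) (rule that)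
  obtain G1 where G1: "G1 \<in> borel_measurable borel" "\<And>x. x \<notin> N \<Longrightarrow> G1 x = 0" "AE x in lborel. x \<in> N \<longrightarrow> G1 x = G x"
    "integrable lborel (\<lambda>x. norm (G1 x) powr p)"
    "\<And>q. 0 < q \<Longrightarrow> q \<le> p \<Longrightarrow> integrable lborel (\<lambda>x. norm (G1 x) powr q)" "integrable lborel G1"
    by (rule Lp_loc_truncation[OF G'(2) p \<Omega> N(1,3)]) (rule that)
  have bdd: "\<exists>b\<ge>0. \<forall>x\<in>L. norm (f x) \<le> b" if "continuous_on U f" for f :: "real^'n \<Rightarrow> 'b::real_normed_vector"
  proof -
    have "bounded (f ` L)"
      using that L by (intro compact_imp_bounded compact_continuous_image) (auto intro: continuous_on_subset)
    then obtain b where "b > 0" "\<forall>y\<in>f ` L. norm y \<le> b" using bounded_pos by blast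
    then show ?thesis by (intro exI[of _ b]) auto
  qed
  obtain a where a: "a \<ge> 0" "\<And>x. x \<in> L \<Longrightarrow> norm (A x) \<le> a" using bdd[OF cA] by blast
  obtain b where b: "b \<ge> 0" "\<And>x. x \<in> L \<Longrightarrow> norm (V x) \<le> b" using bdd[OF v'(2)] by blast
  obtain c where c: "c \<ge> 0" "\<And>x. x \<in> L \<Longrightarrow> norm (\<zeta> x) \<le> c"
    using bdd[OF continuous_on_subset[OF C1cD(4)[OF \<zeta>(1)]]] by blast
  obtain l where l: "l \<ge> 0" "\<And>x. x \<in> L \<Longrightarrow> norm (g x) \<le> l"
    using bdd[OF continuous_on_subset[OF C1cD(2)[OF \<zeta>(1)]]] by blast
  obtain e where e: "e \<ge> 0" "\<And>x. x \<in> L \<Longrightarrow> norm (D x) \<le> e" using bdd[OF cD] by blast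
  have clL: "closed L" by (rule compact_imp_closed[OF L(1)])
  have z0: "\<zeta> x = 0" "g x = 0" if "x \<notin> L" for x
    using C1cD(3)[OF \<zeta>(1) that] C1c_gradient_outside[OF \<zeta>(1) clL that] by auto

  define Q where "Q x = norm (G1 x) powr p + a * norm (G1 x)" for x
  have Q: "integrable lborel Q" unfolding Q_def using G1 by auto
  (* Mollifying the triple at once yields one sequence of radii that serves u, its gradient and the bound Q. *)
  define f3 where "f3 x = (u1 x, G1 x, Q x)" for x
  have fi: "integrable lborel f3" unfolding f3_def by (intro integrable_Pair u1 G1 Q)
  obtain \<delta> where \<delta>: "\<And>n. 0 < \<delta> n" "\<And>n. \<delta> n \<le> d"
    "(\<lambda>n. LINT x|lborel. norm (convol f3 (bump (\<delta> n)) x - f3 x)) \<longlonglongrightarrow> 0"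
    "AE x in lborel. (\<lambda>n. convol f3 (bump (\<delta> n)) x) \<longlonglongrightarrow> f3 x"
    by (rule mollifier_sequence[OF fi d(1)]) (rule that)
  define \<rho> where "\<rho> n = (bump (\<delta> n) :: real^'n \<Rightarrow> real)" for n
  have m: "mollifier (\<delta> n) (\<rho> n)" for n unfolding \<rho>_def by (rule bump_mollifier[OF \<delta>(1)])
  define un where "un n = convol u1 (\<rho> n)" for n
  define Gn where "Gn n = convol G1 (\<rho> n)" for n
  define Qn where "Qn n = convol Q (\<rho> n)" for n
  have tri: "convol f3 (bump (\<delta> n)) x = (un n x, Gn n x, Qn n x)" for n x
  proof -
    note k = mollifierD(1)[OF m[of n], unfolded \<rho>_def]
    have "un n x = fst (convol f3 (bump (\<delta> n)) x)"
      using convol_bounded_linear[OF bounded_linear_fst fi k] by (simp add: un_def \<rho>_def f3_def)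
    moreover have "Gn n x = fst (snd (convol f3 (bump (\<delta> n)) x))"
      using convol_bounded_linear[OF bounded_linear_compose[OF bounded_linear_fst bounded_linear_snd] fi k] by (simp add: Gn_def \<rho>_def f3_def)
    moreover have "Qn n x = snd (snd (convol f3 (bump (\<delta> n)) x))"
      using convol_bounded_linear[OF bounded_linear_compose[OF bounded_linear_snd bounded_linear_snd] fi k] by (simp add: Qn_def \<rho>_def f3_def)
    ultimately show ?thesis by (simp add: prod_eq_iff)
  qed
  have conv: "AE x in lborel. (\<lambda>n. un n x) \<longlonglongrightarrow> u1 x \<and> (\<lambda>n. Gn n x) \<longlonglongrightarrow> G1 x \<and> (\<lambda>n. Qn n x) \<longlonglongrightarrow> Q x"
    using \<delta>(4)
  proof eventually_elim
    case (elim x)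
    note e1 = elim[unfolded tri f3_def]
    show ?case using tendsto_fst[OF e1] tendsto_fst[OF tendsto_snd[OF e1]] tendsto_snd[OF tendsto_snd[OF e1]] by simp
  qed
  have Qni: "integrable lborel (Qn n)" for n unfolding Qn_def by (rule convol_integrable[OF Q m])
  have QL1: "(\<lambda>n. LINT x|lborel. \<bar>Qn n x - Q x\<bar>) \<longlonglongrightarrow> 0"
  proof (rule tendsto_sandwich[OF _ _ tendsto_const \<delta>(3)])
    show "\<forall>\<^sub>F n in sequentially. (LINT x|lborel. \<bar>Qn n x - Q x\<bar>) \<le>
      (LINT x|lborel. norm (convol f3 (bump (\<delta> n)) x - f3 x))"
    proof (intro always_eventually allI integral_mono)
      fix n
      show "integrable lborel (\<lambda>x. \<bar>Qn n x - Q x\<bar>)" using Qni Q by auto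
      show "integrable lborel (\<lambda>x. norm (convol f3 (bump (\<delta> n)) x - f3 x))"
        using convol_integrable[OF fi m[of n, unfolded \<rho>_def]] fi by (intro integrable_norm Bochner_Integration.integrable_diff)
      fix x
      have "\<bar>Qn n x - Q x\<bar> \<le> norm (Gn n x - G1 x, Qn n x - Q x)" using norm_snd_le[of "Qn n x - Q x" "Gn n x - G1 x"] by simp
      also have "\<dots> \<le> norm (un n x - u1 x, Gn n x - G1 x, Qn n x - Q x)"
        using norm_snd_le[of "(Gn n x - G1 x, Qn n x - Q x)" "un n x - u1 x"] by simp
      finally show "\<bar>Qn n x - Q x\<bar> \<le> norm (convol f3 (bump (\<delta> n)) x - f3 x)"
        by (simp add: tri f3_def)
    qed
  qed auto

  define \<theta> where "\<theta> n x = \<zeta> x * ramp (un n x - v x)" for n x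
  define h where "h n x = (\<zeta> x * ramp' (un n x - v x)) *\<^sub>R (Gn n x - V x) + ramp (un n x - v x) *\<^sub>R g x" for n x
  have cun: "continuous_on UNIV (un n)" and cGn: "continuous_on UNIV (Gn n)" for n
    unfolding un_def Gn_def \<rho>_def using \<delta>(1) u1 G1 by (auto intro: convol_continuous)
  have t\<theta>: "C1c L (\<theta> n) (h n)" for n
    unfolding C1c_def
  proof (intro conjI allI impI)
    show "\<theta> n x = 0" if "x \<notin> L" for x using z0[OF that] by (simp add: \<theta>_def)
    show "continuous_on UNIV (h n)"
      unfolding h_def
      by (rule continuous_on_zero_extension[OF _ U(1) clL L(2)])
        (use z0 in \<open>auto intro!: continuous_intros cv v'(2) continuous_on_subset[OF cun] continuous_on_subset[OF cGn]
           continuous_on_subset[OF C1cD(4)[OF \<zeta>(1)]] continuous_on_subset[OF C1cD(2)[OF \<zeta>(1)]]\<close>)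
    show "(\<theta> n has_derivative (\<lambda>k. h n x \<bullet> k)) (at x)" for x
    proof (cases "x \<in> L")
      case True
      then have "x \<in> U" using L by auto
      have "cball x (\<delta> n) \<subseteq> N" using True \<delta>(2)[of n] by (force simp: N_def)
      then have un': "(un n has_derivative (\<lambda>k. Gn n x \<bullet> k)) (at x)"
        unfolding un_def Gn_def \<rho>_def
        by (intro convol_weak_gradient[OF G'(3) N(1,3) u1(6,2,3) G1(6,2,3) \<delta>(1)])
      have r': "(ramp has_derivative (\<lambda>k. ramp' (un n x - v x) * k)) (at (un n x - v x))"
        using ramp_deriv unfolding has_field_derivative_def .
      have "((\<lambda>x. ramp (un n x - v x)) has_derivative (\<lambda>k. ramp' (un n x - v x) * (Gn n x \<bullet> k - V x \<bullet> k))) (at x)"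
        by (rule has_derivative_compose[OF has_derivative_diff[OF un' v'(1)[OF \<open>x \<in> U\<close>]] r'])
      from has_derivative_mult[OF C1cD(1)[OF \<zeta>(1)] this] show ?thesis
        unfolding \<theta>_def[abs_def] h_def by (simp add: inner_add_left inner_diff_left algebra_simps)
    next
      case False
      then have "(\<lambda>k. h n x \<bullet> k) = (\<lambda>k. 0)" using z0[OF False] by (simp add: h_def)
      then show ?thesis using has_derivative_zero_outside[OF clL False, of "\<theta> n"] z0 by (simp add: \<theta>_def)
    qed
  qed
  have \<theta>nn: "0 \<le> \<theta> n x" for n x using \<zeta>(2) ramp_bounds(1) by (simp add: \<theta>_def)
  define F where "F x = norm (G1 x) powr (p - 2) *\<^sub>R G1 x" for x
  have L\<Omega>: "L \<subseteq> \<Omega>" using L U by blast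
  have I1: "(LINT x|lborel. F x \<bullet> h n x) \<le> 0" for n
  proof -
    have "AE x in lborel. x \<in> L \<longrightarrow> G1 x = G x" using G1(3) by eventually_elim (use N(4) in auto)
    from weak_subsolution_C1c[OF p \<Omega> G'(2) G(2) t\<theta> \<theta>nn L(1) L\<Omega> G1(1) this, of n]
    show ?thesis by (simp add: F_def)
  qed
  note I2 = integration_by_parts[OF U(1) v'(3,4) t\<theta> L(1,2), folded D_def]
  (* T n is the integrand after subtraction, T' its limit; S and multiples of the mollified Q dominate it. *)
  define T where "T n x = (F x - A x) \<bullet> h n x" for n x
  define T' where "T' x = (F x - A x) \<bullet> ((\<zeta> x * ramp' (u1 x - v x)) *\<^sub>R (G1 x - V x) + ramp (u1 x - v x) *\<^sub>R g x)" for x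
  define S where "S x = indicator L x * ((2*c) * (norm (G1 x) powr p + b * (norm (G1 x) powr (p - 1) + a)) + l * (norm (G1 x) powr (p-1) + a))" for x
  have Lm [measurable]: "L \<in> sets borel" by (rule borel_closed[OF clL])
  have iL: "integrable lborel (indicator L :: real^'n \<Rightarrow> real)"
    by (rule integrable_indicator_bounded[OF compact_imp_bounded[OF L(1)] Lm])
  have indm: "(\<lambda>x. indicator L x *\<^sub>R f x) \<in> borel_measurable borel" if "continuous_on U f" for f :: "real^'n \<Rightarrow> 'b::euclidean_space"
    by (rule borel_measurable_continuous_on_indicator[OF Lm continuous_on_subset[OF that L(2)]])
  (* Off L all integrands vanish, so v, A and V may be cut off there; this makes them Borel measurable. *)
  define vL where "vL x = indicator L x *\<^sub>R v x" for x
  define AL where "AL x = indicator L x *\<^sub>R A x" for x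
  define VL where "VL x = indicator L x *\<^sub>R V x" for x
  have [measurable]: "vL \<in> borel_measurable borel" "AL \<in> borel_measurable borel" "VL \<in> borel_measurable borel"
    unfolding vL_def AL_def VL_def by (rule indm[OF cv], rule indm[OF cA], rule indm[OF v'(2)])
  have [measurable]: "u1 \<in> borel_measurable borel" "G1 \<in> borel_measurable borel" using u1 G1 by auto
  have [measurable]: "F \<in> borel_measurable borel" unfolding F_def by measurable
  have [measurable]: "\<zeta> \<in> borel_measurable borel" "g \<in> borel_measurable borel" "h n \<in> borel_measurable borel" for n
    using C1cD(2,4)[OF \<zeta>(1)] C1cD(2)[OF t\<theta>] by (auto intro: borel_measurable_continuous_onI)
  have [measurable]: "ramp \<in> borel_measurable borel" "ramp' \<in> borel_measurable borel"
    unfolding ramp_def ramp'_def by measurable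
  have h0: "h n x = 0" if "x \<notin> L" for n x using z0[OF that] by (simp add: h_def)
  have TL: "T n = (\<lambda>x. (F x - AL x) \<bullet> h n x)" for n
    by (rule ext) (use h0 in \<open>auto simp: T_def AL_def indicator_def\<close>)
  have T'L: "T' = (\<lambda>x. (F x - AL x) \<bullet> ((\<zeta> x * ramp' (u1 x - vL x)) *\<^sub>R (G1 x - VL x) + ramp (u1 x - vL x) *\<^sub>R g x))"
    by (rule ext) (use z0 in \<open>auto simp: T'_def AL_def vL_def VL_def indicator_def\<close>)
  have Fn: "norm (F x) = norm (G1 x) powr (p - 1)" for x unfolding F_def using norm_powr_mult_norm[of "G1 x" p] by simp
  have Tb: "\<bar>T n x\<bar> \<le> S x + (2*c) * Qn n x" for n x
  proof (cases "x \<in> L")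
    case True
    have Qnn: "0 \<le> Qn n x"
      unfolding Qn_def convol_def using mollifierD(2)[OF m] a by (auto simp: Q_def intro!: integral_nonneg_AE)
    have 1: "norm (F x - A x) \<le> norm (G1 x) powr (p-1) + a"
      using norm_triangle_ineq4[of "F x" "A x"] Fn[of x] a(2)[OF True] by linarith
    have "norm (h n x) \<le> \<bar>\<zeta> x * ramp' (un n x - v x)\<bar> * norm (Gn n x - V x) + \<bar>ramp (un n x - v x)\<bar> * norm (g x)"
      unfolding h_def by (rule order_trans[OF norm_triangle_ineq]) simp
    also have "\<dots> \<le> (c * 2) * (norm (Gn n x) + b) + 1 * l"
    proof (intro add_mono mult_mono)
      show "\<bar>\<zeta> x * ramp' (un n x - v x)\<bar> \<le> c * 2"
        using c(2)[OF True] c(1) ramp_bounds(5,6)[of "un n x - v x"] by (auto simp: abs_mult intro!: mult_mono)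
      show "norm (Gn n x - V x) \<le> norm (Gn n x) + b"
        using norm_triangle_ineq4[of "Gn n x" "V x"] b(2)[OF True] by linarith
      show "\<bar>ramp (un n x - v x)\<bar> \<le> 1" using ramp_bounds(1,2)[of "un n x - v x"] by simp
    qed (use b c l True in auto)
    finally have 2: "norm (h n x) \<le> (c * 2) * (norm (Gn n x) + b) + 1 * l" .
    have y: "(norm (G1 x) powr (p-1) + a) * norm (Gn n x) \<le> norm (G1 x) powr p + Qn n x"
      unfolding Gn_def Qn_def Q_def[abs_def] using convol_young[OF G1(6,4) m p norm_ge_zero a(1)] .
    have "\<bar>T n x\<bar> \<le> norm (F x - A x) * norm (h n x)" unfolding T_def by (rule Cauchy_Schwarz_ineq2)
    also have "\<dots> \<le> (norm (G1 x) powr (p-1) + a) * ((c * 2) * (norm (Gn n x) + b) + 1 * l)"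
      using 1 2 a by (intro mult_mono) auto
    also have "\<dots> = (2*c) * ((norm (G1 x) powr (p-1) + a) * norm (Gn n x)) + (2*c) * (b * (norm (G1 x) powr (p-1) + a)) + l * (norm (G1 x) powr (p-1) + a)"
      by (simp add: algebra_simps)
    also have "\<dots> \<le> (2*c) * (norm (G1 x) powr p + Qn n x) + (2*c) * (b * (norm (G1 x) powr (p-1) + a)) + l * (norm (G1 x) powr (p-1) + a)"
      using y c by (intro add_right_mono mult_left_mono) auto
    also have "\<dots> = S x + (2*c) * Qn n x" using True by (simp add: S_def algebra_simps)
    finally show ?thesis .
  next
    case False
    have "0 \<le> Qn n x"
      unfolding Qn_def convol_def using mollifierD(2)[OF m] a by (auto simp: Q_def intro!: integral_nonneg_AE)
    then show ?thesis using False h0[OF False] c by (simp add: T_def S_def)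
  qed
  have Si: "integrable lborel S"
  proof -
    have i1: "integrable lborel (\<lambda>x. norm (G1 x) powr (p - 1))" using G1(5)[of "p-1"] p by auto
    have "integrable lborel (\<lambda>x. (2*c) * (indicator L x * norm (G1 x) powr p + b * (indicator L x * norm (G1 x) powr (p - 1) + a * indicator L x)) + l * (indicator L x * norm (G1 x) powr (p-1) + a * indicator L x))"
    proof -
      have "integrable lborel (\<lambda>x. indicator L x * norm (G1 x) powr p)"
        using integrable_real_mult_indicator[OF _ G1(4), of L] Lm by (simp add: mult.commute)
      moreover have "integrable lborel (\<lambda>x. indicator L x * norm (G1 x) powr (p - 1))"
        using integrable_real_mult_indicator[OF _ i1, of L] Lm by (simp add: mult.commute)
      ultimately show ?thesis
        using iL by (intro Bochner_Integration.integrable_add integrable_mult_right)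
    qed
    then show ?thesis unfolding S_def by (simp add: algebra_simps)
  qed
  have lim: "(\<lambda>n. LINT x|lborel. T n x) \<longlonglongrightarrow> (LINT x|lborel. T' x)" and Ti: "\<And>n. integrable lborel (T n)" and T'i: "integrable lborel T'"
  proof -
    have m1: "T n \<in> borel_measurable lborel" for n unfolding TL by measurable
    have m2: "T' \<in> borel_measurable lborel" unfolding T'L by measurable
    have ptw: "AE x in lborel. (\<lambda>n. T n x) \<longlonglongrightarrow> T' x"
      using conv
    proof eventually_elim
      case (elim x)
      have cr: "isCont ramp t" "isCont ramp' t" for t
        using continuous_ramp[OF continuous_on_id, of UNIV] by (auto simp: continuous_on_eq_continuous_at)
      have w: "(\<lambda>n. un n x - v x) \<longlonglongrightarrow> u1 x - v x" using elim by (intro tendsto_intros) auto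
      show ?case unfolding T_def T'_def h_def
        using elim isCont_tendsto_compose[OF cr(1) w] isCont_tendsto_compose[OF cr(2) w] by (intro tendsto_intros) auto
    qed
    have D1: "integrable lborel (\<lambda>x. S x + (2*c) * Qn n x)" for n using Si Qni by auto
    have D2: "integrable lborel (\<lambda>x. S x + (2*c) * Q x)" using Si Q by auto
    have D3: "(\<lambda>n. LINT x|lborel. \<bar>(S x + (2*c) * Qn n x) - (S x + (2*c) * Q x)\<bar>) \<longlonglongrightarrow> 0"
    proof -
      have "\<bar>(S x + (2*c) * Qn n x) - (S x + (2*c) * Q x)\<bar> = (2*c) * \<bar>Qn n x - Q x\<bar>" for n x
        using c(1) by (simp add: abs_mult flip: right_diff_distrib)
      then show ?thesis using tendsto_mult_right_zero[OF QL1, of "2*c"] by simp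
    qed
    have D4: "AE x in lborel. (\<lambda>n. S x + (2*c) * Qn n x) \<longlonglongrightarrow> S x + (2*c) * Q x"
      using conv by eventually_elim (intro tendsto_intros, auto)
    have D5: "AE x in lborel. \<bar>T n x\<bar> \<le> S x + (2*c) * Qn n x" for n using Tb by simp
    note dc = dominated_convergence_L1[OF m1 m2 ptw D1 D2 D3 D4 D5]
    show "(\<lambda>n. LINT x|lborel. T n x) \<longlonglongrightarrow> (LINT x|lborel. T' x)" "\<And>n. integrable lborel (T n)" "integrable lborel T'"
      using dc by blast+
  qed
  (* W is the limit of the right-hand side, the test function times the divergence. *)
  define W where "W x = \<zeta> x * ramp (u1 x - v x) * D x" for x
  define DL where "DL x = indicator L x *\<^sub>R D x" for x
  have [measurable]: "DL \<in> borel_measurable borel" unfolding DL_def by (rule indm[OF cD])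
  have [measurable]: "un n \<in> borel_measurable borel" for n using cun by (rule borel_measurable_continuous_onI)
  have WL: "W = (\<lambda>x. \<zeta> x * ramp (u1 x - vL x) * DL x)"
    by (rule ext) (use z0 in \<open>auto simp: W_def vL_def DL_def indicator_def\<close>)
  have \<theta>L: "(\<lambda>x. \<theta> n x * D x) = (\<lambda>x. \<zeta> x * ramp (un n x - vL x) * DL x)" for n
    by (rule ext) (use z0 in \<open>auto simp: \<theta>_def vL_def DL_def indicator_def\<close>)
  have Wb: "\<bar>\<zeta> x * ramp t * D x\<bar> \<le> c * e * indicator L x" for x t
  proof (cases "x \<in> L")
    case True
    have "\<bar>\<zeta> x\<bar> * \<bar>ramp t\<bar> * \<bar>D x\<bar> \<le> c * 1 * e"
      using c e ramp_bounds(1,2)[of t] c(2)[OF True] e(2)[OF True] by (intro mult_mono) auto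
    then show ?thesis using True by (simp add: abs_mult)
  qed (use z0 in auto)
  have dom: "integrable lborel (\<lambda>x. c * e * indicator L x)" using iL by (rule integrable_mult_right)
  have limW: "(\<lambda>n. LINT x|lborel. \<theta> n x * D x) \<longlonglongrightarrow> (LINT x|lborel. W x)"
  proof (rule integral_dominated_convergence[OF _ _ dom])
    show "W \<in> borel_measurable lborel" unfolding WL by measurable
    show "(\<lambda>x. \<theta> n x * D x) \<in> borel_measurable lborel" for n unfolding \<theta>L by measurable
    show "AE x in lborel. (\<lambda>n. \<theta> n x * D x) \<longlonglongrightarrow> W x"
      using conv
    proof eventually_elim
      case (elim x)
      have cr: "isCont ramp t" for t
        using continuous_ramp[OF continuous_on_id, of UNIV] by (auto simp: continuous_on_eq_continuous_at)
      have w: "(\<lambda>n. un n x - v x) \<longlonglongrightarrow> u1 x - v x" using elim by (intro tendsto_intros) auto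
      show ?case unfolding \<theta>_def W_def
        using isCont_tendsto_compose[OF cr w] by (intro tendsto_intros)
    qed
    show "AE x in lborel. norm (\<theta> n x * D x) \<le> c * e * indicator L x" for n
      using Wb by (simp add: \<theta>_def)
  qed
  have Wi: "integrable lborel W"
    by (rule Bochner_Integration.integrable_bound[OF dom])
      (unfold WL, measurable, use Wb c e in \<open>auto simp: W_def simp flip: WL[THEN fun_cong]\<close>)
  have le: "(LINT x|lborel. T n x) \<le> (LINT x|lborel. \<theta> n x * D x)" for n
  proof -
    have "integrable lborel (\<lambda>x. T n x + A x \<bullet> h n x)" using Ti I2(2) by (rule Bochner_Integration.integrable_add)
    moreover have TF: "T n x + A x \<bullet> h n x = F x \<bullet> h n x" for x by (simp add: T_def inner_diff_left)
    ultimately have "(LINT x|lborel. T n x) + (LINT x|lborel. A x \<bullet> h n x) = (LINT x|lborel. F x \<bullet> h n x)"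
      using Bochner_Integration.integral_add[OF Ti[of n] I2(2)[of n]] by (simp only: TF)
    then show ?thesis using I1[of n] I2(1)[of n] by linarith
  qed
  have 1: "(LINT x|lborel. T' x) \<le> (LINT x|lborel. W x)"
    by (rule LIMSEQ_le[OF lim limW]) (use le in auto)
  have "AE x in lborel. 0 \<le> T' x"
    using u1(3)
  proof eventually_elim
    case (elim x)
    show ?case
    proof (cases "x \<in> L")
      case True
      have "ramp (u1 x - v x) *\<^sub>R g x = 0"
      proof (cases "x \<in> K")
        case False
        then have "u1 x < v x" using off[of x] True L N elim by auto
        then show ?thesis by (simp add: ramp_bounds(4))
      qed (use \<zeta>(4) in simp)
      moreover have "0 \<le> (\<zeta> x * ramp' (u1 x - v x)) * ((F x - A x) \<bullet> (G1 x - V x))"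
        using \<zeta>(2)[of x] ramp_bounds(5) p_monotone[OF p, of "G1 x" "V x"] by (simp add: F_def A_def)
      ultimately show ?thesis unfolding T'_def inner_add_right by (simp only: inner_scaleR_right inner_zero_right add_0_right)
    qed (use z0 in \<open>simp add: T'_def\<close>)
  qed
  then have "0 \<le> (LINT x|lborel. T' x)" by (rule integral_nonneg_AE)
  then have "0 \<le> (LINT x|lborel. W x)" using 1 by simp
  moreover have Wn: "W x \<le> 0" for x
  proof (cases "x \<in> L")
    case True
    then have "D x \<le> 0" using v'(5)[of x] L by (auto simp: D_def less_imp_le)
    then show ?thesis using \<zeta>(2)[of x] ramp_bounds(1)[of "u1 x - v x"] by (simp add: W_def mult_nonneg_nonpos)
  qed (use z0 in \<open>simp add: W_def\<close>)
  ultimately have "(LINT x|lborel. - W x) = 0"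
    using integral_nonneg_AE[where M=lborel and f="\<lambda>x. - W x"] by simp
  then have "AE x in lborel. - W x = 0"
    using integral_nonneg_eq_0_iff_AE[where M=lborel and f="\<lambda>x. - W x"] Wi Wn by simp
  then show ?thesis
    using u1(3)
  proof eventually_elim
    case (elim x)
    show ?case
    proof
      assume x: "x \<in> U"
      show "u x \<le> v x"
      proof (cases "x \<in> K")
        case True
        then have "D x < 0" using v'(5)[OF x] by (simp add: D_def)
        then have "ramp (u1 x - v x) = 0" using elim(1) \<zeta>(3)[OF True] by (simp add: W_def)
        then have "u1 x \<le> v x" using ramp_bounds(3)[of "u1 x - v x"] by simp
        then show ?thesis using elim(2) True L N by auto
      qed (use off[of x] x in auto)
    qed
  qed
qed

section \<open>Pointwise comparison in balls\<close>

lemma usc_on_nbhd: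
  assumes "usc_on \<Omega> u" "open \<Omega>" "y \<in> \<Omega>" "u y < c"
  obtains T where "open T" "y \<in> T" "T \<subseteq> \<Omega>" "\<And>x. x \<in> T \<Longrightarrow> u x < c"
proof (rule that[of "{x\<in>\<Omega>. u x < c}"])
  show "open {x\<in>\<Omega>. u x < c}"
    using assms(1,2) by (auto simp: usc_on_def openin_open_eq)
qed (use assms in auto)

text \<open>The boundary values of \<open>u\<close> keep the set where \<open>u \<ge> v\<close> away from the boundary of \<open>\<Omega>\<close>, since \<open>v \<ge> e > 0\<close>;
upper semicontinuity of \<open>u\<close> keeps it away from the sphere.\<close>

lemma superlevel_compact:
  fixes u v :: "real^'n \<Rightarrow> real"
  assumes \<Omega>: "open \<Omega>" and usc: "usc_on \<Omega> u"
    and bd: "\<And>y. y \<in> frontier \<Omega> \<Longrightarrow> Limsup (at y within \<Omega>) (\<lambda>x. ereal (u x)) \<le> 0"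
    and cont: "\<And>y. y \<in> \<Omega> \<inter> cball w R \<Longrightarrow> isCont v y"
    and e: "e > 0" "\<And>x. x \<in> \<Omega> \<inter> ball w R \<Longrightarrow> e \<le> v x"
    and sph: "\<And>y. y \<in> \<Omega> \<inter> sphere w R \<Longrightarrow> u y < v y"
  shows "compact (closure {x \<in> \<Omega> \<inter> ball w R. v x \<le> u x})"
    and "closure {x \<in> \<Omega> \<inter> ball w R. v x \<le> u x} \<subseteq> \<Omega> \<inter> ball w R"
proof -
  let ?D = "{x \<in> \<Omega> \<inter> ball w R. v x \<le> u x}"
  have sub: "closure ?D \<subseteq> cball w R" by (rule closure_minimal) auto
  have "y \<in> \<Omega> \<inter> ball w R" if y: "y \<in> closure ?D" for y
  proof (rule ccontr)
    assume n: "y \<notin> \<Omega> \<inter> ball w R"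
    have yR: "y \<in> cball w R" using sub y by auto
    show False
    proof (cases "y \<in> \<Omega>")
      case True
      then have s: "y \<in> \<Omega> \<inter> sphere w R" using n yR by auto
      obtain c where c: "u y < c" "c < v y" using sph[OF s] dense by blast
      obtain T where T: "open T" "y \<in> T" "T \<subseteq> \<Omega>" "\<And>x. x \<in> T \<Longrightarrow> u x < c"
        using usc_on_nbhd[OF usc \<Omega> True c(1)] by blast
      have "isCont v y" using cont True yR by auto
      then have "\<forall>\<^sub>F x in at y. c < v x" using order_tendstoD(1) c(2) unfolding isCont_def by blast
      then have "\<forall>\<^sub>F x in nhds y. c < v x" using c(2) by (auto simp: eventually_at_filter elim: eventually_mono)
      then obtain T' where T': "open T'" "y \<in> T'" "\<And>x. x \<in> T' \<Longrightarrow> c < v x" by (auto simp: eventually_nhds)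
      have "(T \<inter> T') \<inter> ?D \<noteq> {}"
        using y closure_iff_nhds_not_empty[of y ?D] open_Int[OF T(1) T'(1)] T(2) T'(2) by blast
      then obtain x where "x \<in> T" "x \<in> T'" "v x \<le> u x" by blast
      then show False using T(4)[of x] T'(3)[of x] by linarith
    next
      case False
      have "y \<in> closure \<Omega>" using y closure_mono[of ?D \<Omega>] by auto
      then have "y \<in> frontier \<Omega>" using False \<Omega> by (auto simp: frontier_def interior_open)
      then have "Limsup (at y within \<Omega>) (\<lambda>x. ereal (u x)) < ereal e" using bd e(1) by (metis ereal_less(2) le_less_trans)
      then have "\<forall>\<^sub>F x in at y within \<Omega>. ereal (u x) < ereal e" by (rule Limsup_lessD)
      then obtain d where d: "d > 0" "\<And>x. x \<in> \<Omega> \<Longrightarrow> x \<noteq> y \<Longrightarrow> dist x y < d \<Longrightarrow> u x < e"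
        by (auto simp: eventually_at)
      obtain x where "x \<in> ?D" "dist x y < d" using y d(1) closure_approachable by blast
      then show False using d(2)[of x] e(2)[of x] False by auto
    qed
  qed
  then show "closure ?D \<subseteq> \<Omega> \<inter> ball w R" by blast
  show "compact (closure ?D)"
    by (rule closed_subset_compact[OF compact_cball closed_closure sub])
qed

lemma canonical_representative_le:
  fixes u v :: "real^'n \<Rightarrow> real"
  assumes \<Omega>: "open \<Omega>" and can: "canonical_representative \<Omega> u" and um: "u \<in> borel_measurable (lebesgue_on \<Omega>)"
    and U: "open U" "U \<subseteq> \<Omega>" "x \<in> U" and ae: "AE x in lborel. x \<in> U \<longrightarrow> u x \<le> v x" and v: "isCont v x"
  shows "u x \<le> v x"
proof (rule dense_ge)
  fix c assume c: "v x < c"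
  have "\<forall>\<^sub>F y in at x. v y < c" using order_tendstoD(2) v c unfolding isCont_def by blast
  then have "\<forall>\<^sub>F y in nhds x. v y < c" using c by (auto simp: eventually_at_filter elim: eventually_mono)
  then obtain T where T: "open T" "x \<in> T" "\<And>y. y \<in> T \<Longrightarrow> v y < c" by (auto simp: eventually_nhds)
  have "open (T \<inter> U)" "x \<in> T \<inter> U" using T U by auto
  then obtain r where r: "r > 0" "ball x r \<subseteq> T \<inter> U" using open_contains_ball by blast
  let ?B = "ball x r \<inter> \<Omega>"
  have B: "?B \<in> sets lebesgue" using \<Omega> by auto
  have "u \<in> borel_measurable (lebesgue_on ?B)"
    using measurable_restrict_mono[OF um, of ?B] by auto
  then have m: "(\<lambda>y. ereal (u y)) \<in> borel_measurable (lebesgue_on ?B)" by auto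
  have "AE y in lebesgue_on ?B. ereal (u y) \<le> ereal c"
  proof -
    have "AE y in lebesgue. y \<in> ?B \<longrightarrow> ereal (u y) \<le> ereal c"
      using AE_completion[OF ae]
    proof eventually_elim
      case (elim y)
      show ?case
      proof
        assume "y \<in> ?B"
        then have "y \<in> T" "y \<in> U" using r(2) by auto
        then show "ereal (u y) \<le> ereal c" using elim T(3)[of y] by auto
      qed
    qed
    then show ?thesis using B by (subst AE_restrict_space_iff) auto
  qed
  then have "esssup (lebesgue_on ?B) (\<lambda>y. ereal (u y)) \<le> ereal c" by (rule esssup_I[OF m])
  then have "(INF r\<in>{0<..}. esssup (lebesgue_on (ball x r \<inter> \<Omega>)) (\<lambda>y. ereal (u y))) \<le> ereal c"
    by (intro INF_lower2[of r]) (use r in auto)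
  moreover have "ereal (u x) = (INF r\<in>{0<..}. esssup (lebesgue_on (ball x r \<inter> \<Omega>)) (\<lambda>y. ereal (u y)))"
    using can U unfolding canonical_representative_def by blast
  ultimately have "ereal (u x) \<le> ereal c" by (rule ord_eq_le_trans[rotated])
  then show "u x \<le> c" by simp
qed

lemma p_subharmonic_comparison:
  fixes u v :: "real^'n \<Rightarrow> real"
  assumes p: "p > 1" and \<Omega>: "open \<Omega>" and sub: "p_subharmonic (ereal p) \<Omega> u"
    and bd: "\<And>y. y \<in> frontier \<Omega> \<Longrightarrow> Limsup (at y within \<Omega>) (\<lambda>x. ereal (u x)) \<le> 0"
    and sup: "strict_supersolution p (\<Omega> \<inter> ball w R) v V"
    and cont: "\<And>y. y \<in> \<Omega> \<inter> cball w R \<Longrightarrow> isCont v y"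
    and e: "e > 0" "\<And>x. x \<in> \<Omega> \<inter> ball w R \<Longrightarrow> e \<le> v x"
    and sph: "\<And>y. y \<in> \<Omega> \<inter> sphere w R \<Longrightarrow> u y < v y"
    and x: "x \<in> \<Omega> \<inter> ball w R"
  shows "u x \<le> v x"
proof -
  have u: "usc_on \<Omega> u" "weak_subsolution p \<Omega> u" "canonical_representative \<Omega> u"
    using sub by (auto simp: p_subharmonic_def)
  let ?U = "\<Omega> \<inter> ball w R"
  have U: "open ?U" "?U \<subseteq> \<Omega>" using \<Omega> by auto
  let ?K = "closure {x \<in> ?U. v x \<le> u x}"
  have K: "compact ?K" "?K \<subseteq> ?U" by (rule superlevel_compact[where e=e]; fact)+
  have off: "u x < v x" if "x \<in> ?U - ?K" for x
    using that closure_subset[of "{x \<in> ?U. v x \<le> u x}"] by fastforce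
  have ae: "AE x in lborel. x \<in> ?U \<longrightarrow> u x \<le> v x"
    by (rule weak_comparison[OF p \<Omega> u(2) U sup K off])
  have "u \<in> borel_measurable (lebesgue_on \<Omega>)"
    using u(2) by (auto simp: weak_subsolution_def W1p_loc_def Lp_loc_def)
  moreover have "isCont v x" using cont x by auto
  ultimately show ?thesis using canonical_representative_le[OF \<Omega> u(3) _ U x ae] by blast
qed

lemma usc_attains_sup:
  fixes u v :: "real^'n \<Rightarrow> real"
  assumes \<Omega>: "open \<Omega>" and usc: "usc_on \<Omega> u" and K: "compact K" "K \<subseteq> \<Omega>" "K \<noteq> {}"
    and v: "\<And>x. x \<in> K \<Longrightarrow> isCont v x"
  shows "\<exists>x0\<in>K. \<forall>x\<in>K. u x - v x \<le> u x0 - v x0"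
proof (rule ccontr)
  assume "\<not> ?thesis"
  then have n: "\<forall>x\<in>K. \<exists>y\<in>K. u x - v x < u y - v y" by force
  have "\<exists>T y. open T \<and> x \<in> T \<and> y \<in> K \<and> (\<forall>z\<in>T. u z - v z < u y - v y)" if x: "x \<in> K" for x
  proof -
    obtain y where y: "y \<in> K" "u x - v x < u y - v y" using n x by blast
    define e where "e = (u y - v y - (u x - v x)) / 2"
    have e: "e > 0" using y by (simp add: e_def)
    have "x \<in> \<Omega>" "u x < u x + e" using x K(2) e by auto
    then obtain T where T: "open T" "x \<in> T" "T \<subseteq> \<Omega>" "\<And>z. z \<in> T \<Longrightarrow> u z < u x + e"
      using usc_on_nbhd[OF usc \<Omega>] by blast
    have "\<forall>\<^sub>F z in at x. v x - e < v z"
      using order_tendstoD(1)[OF v[OF x, unfolded isCont_def], of "v x - e"] e by simp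
    then have "\<forall>\<^sub>F z in nhds x. v x - e < v z" using e by (auto simp: eventually_at_filter elim: eventually_mono)
    then obtain T' where T': "open T'" "x \<in> T'" "\<And>z. z \<in> T' \<Longrightarrow> v x - e < v z" by (auto simp: eventually_nhds)
    have "u z - v z < u y - v y" if "z \<in> T \<inter> T'" for z
      using T(4)[of z] T'(3)[of z] that by (auto simp: e_def field_simps)
    then show ?thesis using T T' y by (intro exI[of _ "T \<inter> T'"] exI[of _ y]) auto
  qed
  then obtain T y where T: "\<And>x. x \<in> K \<Longrightarrow> open (T x)" "\<And>x. x \<in> K \<Longrightarrow> x \<in> T x" "\<And>x. x \<in> K \<Longrightarrow> y x \<in> K"
    "\<And>x z. x \<in> K \<Longrightarrow> z \<in> T x \<Longrightarrow> u z - v z < u (y x) - v (y x)" by metis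
  obtain C where C: "C \<subseteq> K" "finite C" "K \<subseteq> (\<Union>x\<in>C. T x)"
    using compactE_image[OF K(1), of K T] T(1,2) by blast
  let ?f = "\<lambda>x. u (y x) - v (y x)"
  have "C \<noteq> {}" using C K(3) by auto
  then have "Max (?f ` C) \<in> ?f ` C" using C(2) by (intro Max_in) auto
  then obtain x where x: "x \<in> C" "Max (?f ` C) = ?f x" by (rule imageE)
  have xm: "?f x' \<le> ?f x" if "x' \<in> C" for x'
    using Max_ge[of "?f ` C" "?f x'"] that C(2) x(2) by simp
  have "y x \<in> K" using T(3) x C by blast
  then obtain x' where x': "x' \<in> C" "y x \<in> T x'" using C by blast
  then have "u (y x) - v (y x) < u (y x') - v (y x')" using T(4)[of x' "y x"] C by blast
  then show False using xm[OF x'(1)] by simp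
qed

section \<open>The barrier\<close>

text \<open>With \<open>f r = A * r powr b - K * r powr c\<close>, the values \<open>\<phi>\<close> and \<open>\<psi>\<close> are \<open>f' s\<close> and \<open>s * f'' s\<close>, and the last
expression is the \<open>p\<close>-Laplacian of \<open>f s + t\<close> up to a positive factor. By \<open>rel\<close> the power \<open>b\<close> drops out
of the first bracket, so there \<open>K\<close> only has to beat \<open>m\<close>. That bracket is multiplied by \<open>\<phi>\<^sup>2\<close>, of order
\<open>A\<^sup>2\<close>, while the second bracket grows only linearly in \<open>A\<close>; by \<open>alt\<close> and \<open>c \<le> 1\<close> no power of \<open>s\<close> spoils this.\<close>

lemma barrier_constants:
  fixes b c k m p :: real
  assumes p: "p > 1" and b: "0 < b" "b \<le> 1/2" and c: "b < c" "c \<le> 1" and k: "k \<ge> 1" and m: "m \<ge> 0"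
    and rel: "2 * (p - 1) * (b - 1) + p - 2 + k = 0"
    and alt: "k + 2 * b - 2 \<le> 0 \<or> b + c \<le> 1" and kc: "0 \<le> k + 2 * c - 2"
  obtains A K where "K > 0" "A \<ge> K + 1"
    "\<And>s. 0 < s \<Longrightarrow> s \<le> 1 \<Longrightarrow> 0 < A * b * s powr (b - 1) - K * c * s powr (c - 1)"
    "\<And>s t \<phi> \<psi>. 0 < s \<Longrightarrow> s \<le> 1 \<Longrightarrow> 0 \<le> t \<Longrightarrow> t \<le> 1 \<Longrightarrow>
       \<phi> = A * b * s powr (b - 1) - K * c * s powr (c - 1) \<Longrightarrow>
       \<psi> = A * b * (b - 1) * s powr (b - 1) - K * c * (c - 1) * s powr (c - 1) \<Longrightarrow>
       \<phi>\<^sup>2 * s * (2 * (p - 1) * \<psi> + (p - 2 + k) * \<phi> + m) + t * (k * \<phi> + 2 * \<psi> + m + p - 2) < 0"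
proof -
  (* this value makes the first bracket at most - (s powr (c - 1)) *)
  define K where "K = (m + 1) / (2 * c * (p - 1) * (c - b))"
  have den: "2 * c * (p - 1) * (c - b) > 0" using assms by simp
  have K: "K > 0" using den m by (simp add: K_def)
  have Keq: "2 * K * c * (p - 1) * (c - b) = m + 1" using den by (simp add: K_def field_simps)
  (* the first summand keeps phi positive, the second beats the bracket multiplied by t *)
  define A where "A = (2 * K * c + 4 * (k + m + p) + 2) / b + K + 1"
  have Ab: "A * b = 2 * K * c + 4 * (k + m + p) + 2 + (K + 1) * b" using b by (simp add: A_def field_simps)
  have Ab1: "A * b \<ge> 2 * K * c" "A * b \<ge> 4 * (k + m + p)" "A * b > 1"
  proof -
    have 1: "2 * K * c + 4 * (k + m + p) + 2 \<le> A * b" unfolding Ab using K b by simp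
    have 2: "0 \<le> 2 * K * c" using K b c by simp
    have 3: "1 \<le> k + m + p" using k m p by simp
    show "A * b \<ge> 2 * K * c" using 1 3 by simp
    show "A * b \<ge> 4 * (k + m + p)" using 1 2 by linarith
    show "A * b > 1" using 1 2 3 by argo
  qed
  have AK: "A \<ge> K + 1"
    using K b c k m p by (simp add: A_def)
  have low: "A * b / 2 * s powr (b - 1) \<le> A * b * s powr (b - 1) - K * c * s powr (c - 1)" if s: "0 < s" "s \<le> 1" for s
  proof -
    have "s powr (c - 1) \<le> s powr (b - 1)" using s c by (intro powr_mono') auto
    then have "K * c * s powr (c - 1) \<le> K * c * s powr (b - 1)" using K b c by (intro mult_left_mono) auto
    also have "\<dots> \<le> A * b / 2 * s powr (b - 1)" using Ab1(1) by (intro mult_right_mono) auto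
    finally show ?thesis by (simp add: field_simps)
  qed
  have pos: "0 < A * b * s powr (b - 1) - K * c * s powr (c - 1)" if s: "0 < s" "s \<le> 1" for s
  proof -
    have "0 < A * b / 2 * s powr (b - 1)" using Ab1(3) s by (intro mult_pos_pos) auto
    then show ?thesis using low[OF s] by linarith
  qed
  show ?thesis
  proof (rule that[OF K AK pos])
    fix s t \<phi> \<psi> :: real
    assume s: "0 < s" "s \<le> 1" and t: "0 \<le> t" "t \<le> 1"
      and \<phi>: "\<phi> = A * b * s powr (b - 1) - K * c * s powr (c - 1)"
      and \<psi>: "\<psi> = A * b * (b - 1) * s powr (b - 1) - K * c * (c - 1) * s powr (c - 1)"
    (* every term is compared with this power of s, the order of the first summand *)
    let ?e = "s powr (2 * b + c - 2)"
    have one_le: "1 \<le> s powr a" if "a \<le> 0" for a using powr_mono'[of a 0 s] s that by simp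
    have "2 * (p - 1) * \<psi> + (p - 2 + k) * \<phi> =
       A * b * s powr (b - 1) * (2 * (p - 1) * (b - 1) + p - 2 + k) - K * c * s powr (c - 1) * (2 * (p - 1) * (c - 1) + p - 2 + k)"
      by (simp add: \<phi> \<psi> algebra_simps)
    also have "2 * (p - 1) * (c - 1) + p - 2 + k = 2 * (p - 1) * (c - b)" using rel by (simp add: algebra_simps)
    also have "A * b * s powr (b - 1) * (2 * (p - 1) * (b - 1) + p - 2 + k) - K * c * s powr (c - 1) * (2 * (p - 1) * (c - b)) = - (m + 1) * s powr (c - 1)"
      unfolding rel Keq[symmetric] by (simp add: algebra_simps)
    finally have "2 * (p - 1) * \<psi> + (p - 2 + k) * \<phi> = - (m + 1) * s powr (c - 1)" .
    then have br: "2 * (p - 1) * \<psi> + (p - 2 + k) * \<phi> + m \<le> - (s powr (c - 1))"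
      using mult_left_mono[OF one_le[of "c - 1"] m] c by (simp add: algebra_simps)
    have "(A * b / 2 * s powr (b - 1))\<^sup>2 \<le> \<phi>\<^sup>2"
      using low[OF s] Ab1(3) unfolding \<phi> by (intro power_mono) auto
    then have "(A * b / 2 * s powr (b - 1))\<^sup>2 * s * s powr (c - 1) \<le> \<phi>\<^sup>2 * s * s powr (c - 1)"
      using s by (intro mult_right_mono) auto
    moreover have "(A * b / 2 * s powr (b - 1))\<^sup>2 * s * s powr (c - 1) = (A * b)\<^sup>2 / 4 * ?e"
    proof -
      have "(s powr (b - 1))\<^sup>2 * s * s powr (c - 1) = s powr (b - 1) * s powr (b - 1) * s powr 1 * s powr (c - 1)"
        using s by (simp add: power2_eq_square)
      also have "\<dots> = ?e" by (simp only: powr_add[symmetric]) (simp add: algebra_simps)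
      finally show ?thesis by (simp add: power_mult_distrib power_divide)
    qed
    moreover have "\<phi>\<^sup>2 * s * (2 * (p - 1) * \<psi> + (p - 2 + k) * \<phi> + m) \<le> \<phi>\<^sup>2 * s * (- (s powr (c - 1)))"
      using br s by (intro mult_left_mono) auto
    ultimately have P1: "\<phi>\<^sup>2 * s * (2 * (p - 1) * \<psi> + (p - 2 + k) * \<phi> + m) \<le> - ((A * b)\<^sup>2 / 4 * ?e)" by simp
    have e1: "1 \<le> ?e" using b c by (intro one_le) auto
    have kk: "k * \<phi> + 2 * \<psi> = A * b * s powr (b - 1) * (k + 2 * b - 2) - K * c * s powr (c - 1) * (k + 2 * c - 2)"
      by (simp add: \<phi> \<psi> algebra_simps)
    also have "\<dots> \<le> A * b * s powr (b - 1) * (k + 2 * b - 2)"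
      using K b c kc by simp
    also have "\<dots> \<le> A * b * k * ?e"
    proof (cases "k + 2 * b - 2 \<le> 0")
      case True
      then have "A * b * s powr (b - 1) * (k + 2 * b - 2) \<le> 0" using Ab1(3) by (intro mult_nonneg_nonpos) auto
      also have "0 \<le> A * b * k * ?e" using Ab1(3) k by simp
      finally show ?thesis .
    next
      case False
      then have "s powr (b - 1) \<le> ?e" using alt s by (intro powr_mono') auto
      then have "s powr (b - 1) * (k + 2 * b - 2) \<le> ?e * k" using False b k by (intro mult_mono) auto
      then have "A * b * (s powr (b - 1) * (k + 2 * b - 2)) \<le> A * b * (?e * k)" using Ab1(3) by (intro mult_left_mono) auto
      then show ?thesis by (simp add: algebra_simps)
    qed
    finally have "k * \<phi> + 2 * \<psi> \<le> A * b * k * ?e" .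
    moreover have "m + p - 2 \<le> (m + p) * ?e"   proof -
      have "(m + p) * 1 \<le> (m + p) * ?e" using e1 m p by (intro mult_left_mono) auto
      then show ?thesis by simp
    qed
    ultimately have "k * \<phi> + 2 * \<psi> + m + p - 2 \<le> (A * b * k + (m + p)) * ?e" by (simp add: algebra_simps)
    then have "t * (k * \<phi> + 2 * \<psi> + m + p - 2) \<le> t * ((A * b * k + (m + p)) * ?e)"
      using t by (intro mult_left_mono) auto
    also have "\<dots> \<le> 1 * ((A * b * k + (m + p)) * ?e)"
      using t Ab1(3) k m p by (intro mult_right_mono) auto
    finally have P2: "t * (k * \<phi> + 2 * \<psi> + m + p - 2) \<le> (A * b * k + (m + p)) * ?e" by simp
    have "A * b * k + (m + p) < A * b * k + A * b * (m + p)"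
      using mult_strict_right_mono[OF Ab1(3), of "m + p"] m p by simp
    also have "\<dots> = A * b * (k + m + p)" by (simp add: algebra_simps)
    also have "\<dots> \<le> A * b * (A * b / 4)" using Ab1 by (intro mult_left_mono) auto
    also have "\<dots> = (A * b)\<^sup>2 / 4" by (simp add: power2_eq_square)
    finally have "(A * b * k + (m + p)) * ?e < (A * b)\<^sup>2 / 4 * ?e" using s by (intro mult_strict_right_mono) auto
    then show "\<phi>\<^sup>2 * s * (2 * (p - 1) * \<psi> + (p - 2 + k) * \<phi> + m) + t * (k * \<phi> + 2 * \<psi> + m + p - 2) < 0"
      using P1 P2 by linarith
  qed
qed

text \<open>The projection onto an \<open>m\<close>-dimensional subspace, described by the algebra that the computation of the
divergence uses. The trace supplies the dimension.\<close>

locale orthogonal_projection =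
  fixes P :: "'a::euclidean_space \<Rightarrow> 'a" and m :: nat
  assumes lin: "bounded_linear P" and idem: "\<And>z. P (P z) = P z" and adj: "\<And>x y. P x \<bullet> y = x \<bullet> P y"
    and tr: "(\<Sum>b\<in>Basis. P b \<bullet> b) = real m"
begin

abbreviation "q z \<equiv> z - P z"
abbreviation "s z \<equiv> q z \<bullet> q z"
abbreviation "t z \<equiv> P z \<bullet> P z"

lemma P_diff: "P (x - y) = P x - P y"
  using lin by (simp add: bounded_linear.linear linear_diff)

lemma qP: "q x \<bullet> P y = 0" by (simp add: adj[symmetric] P_diff idem)

lemma norm_split: "(norm z)\<^sup>2 = s z + t z"
proof -
  have "z \<bullet> z = (q z + P z) \<bullet> (q z + P z)" by simp
  also have "\<dots> = s z + t z" using qP[of z z] by (simp only: inner_add_left inner_add_right) (simp add: inner_commute)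
  finally show ?thesis by (simp add: power2_norm_eq_inner)
qed

lemma s_deriv: "(s has_derivative (\<lambda>h. 2 * (q z \<bullet> h))) (at z)"
proof -
  have "(s has_derivative (\<lambda>h. q z \<bullet> (h - P h) + (h - P h) \<bullet> q z)) (at z)"
    by (intro derivative_intros bounded_linear.has_derivative[OF lin])
  moreover have "q z \<bullet> (h - P h) + (h - P h) \<bullet> q z = 2 * (q z \<bullet> h)" for h
  proof -
    have "(h - P h) \<bullet> q z = q z \<bullet> h - q z \<bullet> P h" "q z \<bullet> (h - P h) = q z \<bullet> h - q z \<bullet> P h"
      by (simp_all only: inner_commute[of "h - P h" "q z"] inner_diff_right[of "q z" h "P h"])
    then show ?thesis using qP[of z h] by simp
  qed
  ultimately show ?thesis by simp
qed

lemma t_deriv: "(t has_derivative (\<lambda>h. 2 * (P z \<bullet> h))) (at z)"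
proof -
  have "(t has_derivative (\<lambda>h. P z \<bullet> P h + P h \<bullet> P z)) (at z)"
    by (intro derivative_intros bounded_linear.has_derivative[OF lin])
  moreover have "P z \<bullet> P h + P h \<bullet> P z = 2 * (P z \<bullet> h)" for h
    by (simp add: inner_commute[of "P h"] adj[symmetric] idem)
  ultimately show ?thesis by simp
qed

lemma P_cont [continuous_intros]: "continuous_on S f \<Longrightarrow> continuous_on S (\<lambda>x. P (f x))"
  by (rule bounded_linear.continuous_on[OF lin])

text \<open>The gradient of the barrier is \<open>2 X\<close> with \<open>X z = \<phi> (s z) q z + P z\<close>, and \<open>N = |X|\<^sup>2\<close> since \<open>q\<close> and
\<open>P\<close> are orthogonal. The field of the \<open>p\<close>-Laplacian is a constant multiple
of \<open>N powr \<alpha> X\<close>. Its divergence, evaluated through the traces of \<open>P\<close> and of its complement, is a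
positive multiple of the expression in \<open>neg\<close>.\<close>

lemma strict_supersolution_barrier:
  fixes A K b c p :: real
  defines "\<phi> \<equiv> \<lambda>r. A * b * r powr (b - 1) - K * c * r powr (c - 1)"
  assumes pos: "\<And>r. 0 < r \<Longrightarrow> r \<le> 1 \<Longrightarrow> 0 < \<phi> r"
    and neg: "\<And>r \<tau> \<psi>. 0 < r \<Longrightarrow> r \<le> 1 \<Longrightarrow> 0 \<le> \<tau> \<Longrightarrow> \<tau> \<le> 1 \<Longrightarrow>
       \<psi> = A * b * (b - 1) * r powr (b - 1) - K * c * (c - 1) * r powr (c - 1) \<Longrightarrow>
       (\<phi> r)\<^sup>2 * r * (2 * (p - 1) * \<psi> + (p - 2 + (real DIM('a) - real m)) * \<phi> r + real m) +
       \<tau> * ((real DIM('a) - real m) * \<phi> r + 2 * \<psi> + real m + p - 2) < 0"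
  shows "strict_supersolution p {z. 0 < s z \<and> norm z < 1}
    (\<lambda>z. A * s z powr b - K * s z powr c + t z) (\<lambda>z. 2 *\<^sub>R (\<phi> (s z) *\<^sub>R q z + P z))"
proof -
  let ?U = "{z. 0 < s z \<and> norm z < 1}"
  define \<phi>' where "\<phi>' r = A * b * (b - 1) * r powr (b - 2) - K * c * (c - 1) * r powr (c - 2)" for r
  define \<alpha> where "\<alpha> = (p - 2) / 2"
  define X where "X z = \<phi> (s z) *\<^sub>R q z + P z" for z
  define N where "N z = (\<phi> (s z))\<^sup>2 * s z + t z" for z
  define N' where "N' z h = (4 * \<phi> (s z) * \<phi>' (s z) * s z + 2 * (\<phi> (s z))\<^sup>2) * (q z \<bullet> h) + 2 * (P z \<bullet> h)" for z h
  define X' where "X' z h = (2 * \<phi>' (s z) * (q z \<bullet> h)) *\<^sub>R q z + \<phi> (s z) *\<^sub>R (h - P h) + P h" for z h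
  define A' where "A' z h = 2 powr (p - 1) *\<^sub>R ((\<alpha> * N z powr (\<alpha> - 1) * N' z h) *\<^sub>R X z + N z powr \<alpha> *\<^sub>R X' z h)" for z h
  have U: "s z > 0" "s z \<le> 1" "0 \<le> t z" "t z \<le> 1" if "z \<in> ?U" for z
  proof -
    have "(norm z)\<^sup>2 \<le> 1" using that by (simp add: power_le_one)
    then have "s z + t z \<le> 1" by (simp only: norm_split)
    moreover have "0 \<le> t z" "s z > 0" using that inner_ge_zero by auto
    ultimately show "s z > 0" "s z \<le> 1" "0 \<le> t z" "t z \<le> 1" by linarith+
  qed
  have ph: "\<phi> (s z) > 0" if "z \<in> ?U" for z using pos U[OF that] by blast
  have Npos: "N z > 0" if "z \<in> ?U" for z using ph[OF that] U[OF that] by (simp add: N_def add_pos_nonneg)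
  have NX: "X z \<bullet> X z = N z" for z
  proof -
    have "P z \<bullet> q z = 0" using qP[of z z] by (simp only: inner_commute)
    then show ?thesis using qP[of z z] unfolding X_def N_def
      by (simp only: inner_add_left inner_add_right inner_scaleR_left inner_scaleR_right) (simp add: power2_eq_square)
  qed
  have qX: "q z \<bullet> X z = \<phi> (s z) * s z" for z
    using qP[of z z] unfolding X_def by (simp only: inner_add_right inner_scaleR_right add_0_right)
  have PX: "P z \<bullet> X z = t z" for z
    using qP[of z z] unfolding X_def by (simp only: inner_add_right inner_scaleR_right inner_commute[of "P z" "q z"] mult_zero_right add_0_left)
  have \<phi>_deriv: "((\<lambda>z. \<phi> (s z)) has_derivative (\<lambda>h. \<phi>' (s z) * (2 * (q z \<bullet> h)))) (at z)" if z: "z \<in> ?U" for z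
  proof -
    have "(\<phi> has_real_derivative \<phi>' (s z)) (at (s z))"
    proof -
      have "(\<phi> has_real_derivative A * b * ((b - 1) * s z powr (b - 1 - 1)) - K * c * ((c - 1) * s z powr (c - 1 - 1))) (at (s z))"
        unfolding \<phi>_def by (intro DERIV_diff DERIV_cmult has_real_derivative_powr U[OF z])
      then show ?thesis by (simp add: \<phi>'_def algebra_simps)
    qed
    from has_derivative_compose[OF s_deriv this[unfolded has_field_derivative_def]] show ?thesis .
  qed
  have v_deriv: "((\<lambda>z. A * s z powr b - K * s z powr c + t z) has_derivative (\<lambda>h. (2 *\<^sub>R X z) \<bullet> h)) (at z)" if z: "z \<in> ?U" for z
  proof -
    have "((\<lambda>r. A * r powr b - K * r powr c) has_real_derivative \<phi> (s z)) (at (s z))"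
    proof -
      have "((\<lambda>r. A * r powr b - K * r powr c) has_real_derivative A * (b * s z powr (b - 1)) - K * (c * s z powr (c - 1))) (at (s z))"
        by (intro DERIV_diff DERIV_cmult has_real_derivative_powr U[OF z])
      then show ?thesis by (simp add: \<phi>_def algebra_simps)
    qed
    from has_derivative_compose[OF s_deriv this[unfolded has_field_derivative_def]]
    have "((\<lambda>z. A * s z powr b - K * s z powr c) has_derivative (\<lambda>h. \<phi> (s z) * (2 * (q z \<bullet> h)))) (at z)" .
    from has_derivative_add[OF this t_deriv]
    have "((\<lambda>z. A * s z powr b - K * s z powr c + t z) has_derivative (\<lambda>h. \<phi> (s z) * (2 * (q z \<bullet> h)) + 2 * (P z \<bullet> h))) (at z)" .
    moreover have "\<phi> (s z) * (2 * (q z \<bullet> h)) + 2 * (P z \<bullet> h) = (2 *\<^sub>R X z) \<bullet> h" for h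
      unfolding X_def by (simp only: inner_scaleR_left inner_add_left) (simp add: algebra_simps)
    ultimately show ?thesis by simp
  qed
  have P_deriv: "(P has_derivative P) (at z)" for z
    by (rule bounded_linear_imp_has_derivative[OF lin])
  have q_deriv: "(q has_derivative (\<lambda>h. h - P h)) (at z)" for z
    by (intro has_derivative_diff has_derivative_ident P_deriv)
  have N_deriv: "(N has_derivative N' z) (at z)" if z: "z \<in> ?U" for z
  proof -
    have "((\<lambda>z. \<phi> (s z) * \<phi> (s z) * s z + t z) has_derivative
      (\<lambda>h. \<phi> (s z) * \<phi> (s z) * (2 * (q z \<bullet> h)) + (\<phi> (s z) * (\<phi>' (s z) * (2 * (q z \<bullet> h))) + \<phi>' (s z) * (2 * (q z \<bullet> h)) * \<phi> (s z)) * s z + 2 * (P z \<bullet> h))) (at z)"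
      by (intro has_derivative_add has_derivative_mult \<phi>_deriv[OF z] s_deriv t_deriv)
    moreover have "\<phi> (s z) * \<phi> (s z) * (2 * x) + (\<phi> (s z) * (\<phi>' (s z) * (2 * x)) + \<phi>' (s z) * (2 * x) * \<phi> (s z)) * s z + 2 * y =
       (4 * \<phi> (s z) * \<phi>' (s z) * s z + 2 * (\<phi> (s z))\<^sup>2) * x + 2 * y" for x y
      by (simp add: power2_eq_square algebra_simps)
    ultimately show ?thesis unfolding N_def[abs_def] N'_def[abs_def] by (simp only: power2_eq_square)
  qed
  have X_deriv: "(X has_derivative X' z) (at z)" if z: "z \<in> ?U" for z
  proof -
    have "((\<lambda>z. \<phi> (s z) *\<^sub>R q z + P z) has_derivative
       (\<lambda>h. (\<phi> (s z) *\<^sub>R (h - P h) + (\<phi>' (s z) * (2 * (q z \<bullet> h))) *\<^sub>R q z) + P h)) (at z)"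
      by (intro has_derivative_add has_derivative_scaleR \<phi>_deriv[OF z] q_deriv P_deriv)
    moreover have "(\<phi> (s z) *\<^sub>R (h - P h) + (\<phi>' (s z) * (2 * (q z \<bullet> h))) *\<^sub>R q z) + P h = X' z h" for h
      unfolding X'_def by (simp only: add.commute add.left_commute mult_ac)
    ultimately show ?thesis unfolding X_def[abs_def] by (simp only: eta_contract_eq)
  qed
  have field: "norm (2 *\<^sub>R X z) powr (p - 2) *\<^sub>R (2 *\<^sub>R X z) = 2 powr (p - 1) *\<^sub>R (N z powr \<alpha> *\<^sub>R X z)" for z
  proof -
    have nX: "norm (X z) powr (p - 2) = N z powr \<alpha>"
    proof -
      have "norm (X z) = N z powr (1/2)" using NX[of z] inner_ge_zero[of "X z"] by (simp add: norm_eq_sqrt_inner powr_half_sqrt)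
      then show ?thesis by (simp add: powr_powr \<alpha>_def)
    qed
    have "(2::real) powr (p - 2) * 2 = 2 powr (p - 1)"
      using powr_add[of "2::real" "p - 2" 1] by simp
    then show ?thesis by (simp add: powr_mult nX mult.assoc[symmetric] mult.commute)
  qed
  have A_deriv: "((\<lambda>z. 2 powr (p - 1) *\<^sub>R (N z powr \<alpha> *\<^sub>R X z)) has_derivative A' z) (at z)" if z: "z \<in> ?U" for z
  proof -
    from has_derivative_compose[OF N_deriv[OF z] has_real_derivative_powr[OF Npos[OF z], of \<alpha>, unfolded has_field_derivative_def]]
    have "((\<lambda>z. N z powr \<alpha>) has_derivative (\<lambda>h. \<alpha> * N z powr (\<alpha> - 1) * N' z h)) (at z)" .
    from has_derivative_scaleR_right[OF has_derivative_scaleR[OF this X_deriv[OF z]], of "2 powr (p - 1)"]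
    show ?thesis unfolding A'_def[abs_def] by (simp only: add.commute)
  qed
  have tr2: "(\<Sum>b\<in>Basis. (x \<bullet> b) * (y \<bullet> b)) = x \<bullet> y" for x y :: 'a
    by (subst euclidean_inner[of x y]) simp
  have divA: "(\<Sum>b\<in>Basis. A' z b \<bullet> b) < 0" if z: "z \<in> ?U" for z
  proof -
    let ?k = "real DIM('a) - real m"
    have 1: "(\<Sum>b\<in>Basis. N' z b * (X z \<bullet> b)) = (4 * \<phi> (s z) * \<phi>' (s z) * s z + 2 * (\<phi> (s z))\<^sup>2) * (\<phi> (s z) * s z) + 2 * t z"
    proof -
      have "(\<Sum>b\<in>Basis. N' z b * (X z \<bullet> b)) = (4 * \<phi> (s z) * \<phi>' (s z) * s z + 2 * (\<phi> (s z))\<^sup>2) * (\<Sum>b\<in>Basis. (q z \<bullet> b) * (X z \<bullet> b))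
         + 2 * (\<Sum>b\<in>Basis. (P z \<bullet> b) * (X z \<bullet> b))"
        unfolding N'_def by (simp only: distrib_right sum.distrib sum_distrib_left mult.assoc)
      then show ?thesis unfolding tr2 qX PX .
    qed
    have 2: "(\<Sum>b\<in>Basis. X' z b \<bullet> b) = 2 * \<phi>' (s z) * s z + \<phi> (s z) * ?k + real m"
    proof -
      have "(\<Sum>b\<in>Basis. X' z b \<bullet> b) = 2 * \<phi>' (s z) * (\<Sum>b\<in>Basis. (q z \<bullet> b) * (q z \<bullet> b)) + \<phi> (s z) * (\<Sum>b\<in>Basis. b \<bullet> b - P b \<bullet> b) + (\<Sum>b\<in>Basis. P b \<bullet> b)"
        unfolding X'_def by (simp only: inner_add_left inner_scaleR_left inner_diff_left[of _ "P _"] sum.distrib sum_distrib_left mult.assoc)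
      moreover have "(\<Sum>b\<in>Basis. b \<bullet> b - P b \<bullet> b) = ?k" using tr by (simp add: sum_subtractf)
      ultimately show ?thesis unfolding tr2 tr by simp
    qed
    have "(\<Sum>b\<in>Basis. A' z b \<bullet> b) = 2 powr (p - 1) * (\<alpha> * N z powr (\<alpha> - 1) * (\<Sum>b\<in>Basis. N' z b * (X z \<bullet> b)) + N z powr \<alpha> * (\<Sum>b\<in>Basis. X' z b \<bullet> b))"
      unfolding A'_def by (simp only: inner_add_left inner_scaleR_left sum.distrib sum_distrib_left mult.assoc distrib_left)
    also have "N z powr \<alpha> = N z powr (\<alpha> - 1) * N z"
      using Npos[OF z] powr_add[of "N z" "\<alpha> - 1" 1] by simp
    finally have eq: "(\<Sum>b\<in>Basis. A' z b \<bullet> b) = 2 powr (p - 1) * N z powr (\<alpha> - 1) *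
      (\<alpha> * (\<Sum>b\<in>Basis. N' z b * (X z \<bullet> b)) + N z * (\<Sum>b\<in>Basis. X' z b \<bullet> b))" by (simp add: algebra_simps)
    define \<psi> where "\<psi> = s z * \<phi>' (s z)"
    have \<psi>: "\<psi> = A * b * (b - 1) * s z powr (b - 1) - K * c * (c - 1) * s z powr (c - 1)"
    proof -
      have "s z * s z powr (b - 2) = s z powr (b - 1)" "s z * s z powr (c - 2) = s z powr (c - 1)"
        using U(1)[OF z] powr_add[of "s z" 1 "b - 2"] powr_add[of "s z" 1 "c - 2"] by simp_all
      moreover have "\<psi> = A * b * (b - 1) * (s z * s z powr (b - 2)) - K * c * (c - 1) * (s z * s z powr (c - 2))"
        unfolding \<psi>_def \<phi>'_def by (simp only: right_diff_distrib mult_ac)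
      ultimately show ?thesis by simp
    qed
    have gen: "\<alpha> * ((4 * f * f' * r + 2 * f\<^sup>2) * (f * r) + 2 * \<tau>) + (f\<^sup>2 * r + \<tau>) * (2 * f' * r + f * k + \<mu>)
       = f\<^sup>2 * r * (2 * (p - 1) * (r * f') + (p - 2 + k) * f + \<mu>) + \<tau> * (k * f + 2 * (r * f') + \<mu> + p - 2)" for f f' r \<tau> k \<mu> :: real
      unfolding \<alpha>_def by (simp add: power2_eq_square field_simps)
    have "\<alpha> * (\<Sum>b\<in>Basis. N' z b * (X z \<bullet> b)) + N z * (\<Sum>b\<in>Basis. X' z b \<bullet> b) < 0"
      unfolding 1 2 N_def gen \<psi>_def[symmetric] by (rule neg[OF U[OF z] \<psi>])
    then show ?thesis unfolding eq using Npos[OF z] by (intro mult_pos_neg) auto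
  qed
  have cs: "continuous_on S s" "continuous_on S t" for S by (intro continuous_intros)+
  have c\<phi>: "continuous_on ?U (\<lambda>z. \<phi> (s z))" "continuous_on ?U (\<lambda>z. \<phi>' (s z))"
    unfolding \<phi>_def \<phi>'_def by (intro continuous_intros cs; force)+
  have cN: "continuous_on ?U N" "continuous_on ?U X" unfolding N_def X_def by (intro continuous_intros cs c\<phi>)+
  have cN': "continuous_on ?U (\<lambda>z. N' z h)" "continuous_on ?U (\<lambda>z. X' z h)" for h
    unfolding N'_def X'_def by (intro continuous_intros cs c\<phi>)+
  have cA': "continuous_on ?U (\<lambda>z. A' z h)" for h
    unfolding A'_def by (intro continuous_intros cN cN') (use Npos in force)+
  show ?thesis
    unfolding strict_supersolution_def X_def[symmetric] field
  proof (intro conjI exI[of _ A'] ballI allI)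
    show "continuous_on ?U (\<lambda>z. 2 *\<^sub>R X z)" by (intro continuous_intros cN(2))
  qed (fact v_deriv A_deriv cA' divA)+
qed

end

section \<open>Growth estimates\<close>

text \<open>The \<open>p\<close>-Laplacian is homogeneous of degree \<open>p - 1\<close> and scales under dilations.\<close>

lemma strict_supersolution_rescale:
  fixes v :: "'a::euclidean_space \<Rightarrow> real"
  assumes v: "strict_supersolution p U v V" and l: "l > 0" and R: "R > 0"
    and W: "\<And>x. x \<in> W \<Longrightarrow> (1 / R) *\<^sub>R (x - w) \<in> U"
  shows "strict_supersolution p W (\<lambda>x. l * v ((1 / R) *\<^sub>R (x - w)) + e) (\<lambda>x. (l / R) *\<^sub>R V ((1 / R) *\<^sub>R (x - w)))"
proof -
  let ?g = "\<lambda>x. (1 / R) *\<^sub>R (x - w)"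
  let ?c = "(l / R) powr (p - 1)"
  obtain A' where v': "\<And>x. x \<in> U \<Longrightarrow> (v has_derivative (\<lambda>h. V x \<bullet> h)) (at x)" "continuous_on U V"
    "\<And>x. x \<in> U \<Longrightarrow> ((\<lambda>x. norm (V x) powr (p - 2) *\<^sub>R V x) has_derivative A' x) (at x)" "\<And>h. continuous_on U (\<lambda>x. A' x h)"
    "\<And>x. x \<in> U \<Longrightarrow> (\<Sum>b\<in>Basis. A' x b \<bullet> b) < 0"
    using v unfolding strict_supersolution_def by blast
  have g': "(?g has_derivative (\<lambda>h. (1 / R) *\<^sub>R h)) (at x)" for x
    by (auto intro!: derivative_eq_intros)
  have cg: "continuous_on W ?g" by (intro continuous_intros)
  have pull: "continuous_on W (\<lambda>x. f (?g x))" if "continuous_on U f" for f :: "'a \<Rightarrow> 'a"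
    by (rule continuous_on_compose2[OF that cg]) (use W in auto)
  have field: "norm ((l / R) *\<^sub>R y) powr (p - 2) *\<^sub>R ((l / R) *\<^sub>R y) = ?c *\<^sub>R (norm y powr (p - 2) *\<^sub>R y)" for y :: 'a
  proof -
    have "(l / R) powr (p - 2) * (l / R) = ?c"
      using l R powr_add[of "l / R" "p - 2" 1] by simp
    then have "(l / R) powr (p - 2) * norm y powr (p - 2) * (l / R) = ?c * norm y powr (p - 2)" by (metis mult.assoc mult.commute)
    moreover have "norm ((l / R) *\<^sub>R y) powr (p - 2) = (l / R) powr (p - 2) * norm y powr (p - 2)"
    proof -
      have "norm ((l / R) *\<^sub>R y) = (l / R) * norm y" using l R by simp
      then show ?thesis using l R by (simp only:) (rule powr_mult; simp)
    qed
    ultimately show ?thesis by (simp only: scaleR_scaleR)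
  qed
  show ?thesis
    unfolding strict_supersolution_def field
  proof (intro conjI ballI exI[of _ "\<lambda>x h. ?c *\<^sub>R A' (?g x) ((1 / R) *\<^sub>R h)"] allI)
    show "continuous_on W (\<lambda>x. (l / R) *\<^sub>R V (?g x))" by (intro continuous_intros pull v'(2))
    show "continuous_on W (\<lambda>x. ?c *\<^sub>R A' (?g x) ((1 / R) *\<^sub>R h))" for h
      by (intro continuous_intros pull v'(4))
    fix x assume "x \<in> W"
    then have x: "?g x \<in> U" by (rule W)
    have "((\<lambda>x. l * v (?g x) + e) has_derivative (\<lambda>h. l * (V (?g x) \<bullet> (1 / R) *\<^sub>R h) + 0)) (at x)"
      by (intro has_derivative_add has_derivative_const has_derivative_mult_right has_derivative_compose[OF g' v'(1)[OF x]])
    then show "((\<lambda>x. l * v (?g x) + e) has_derivative (\<lambda>h. ((l / R) *\<^sub>R V (?g x)) \<bullet> h)) (at x)" by simp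
    show "((\<lambda>x. ?c *\<^sub>R (norm (V (?g x)) powr (p - 2) *\<^sub>R V (?g x))) has_derivative (\<lambda>h. ?c *\<^sub>R A' (?g x) ((1 / R) *\<^sub>R h))) (at x)"
      by (intro has_derivative_scaleR_right has_derivative_compose[OF g' v'(3)[OF x]])
    have lin: "linear (A' (?g x))" using v'(3)[OF x] by (rule has_derivative_linear)
    have "(\<Sum>b\<in>Basis. (?c *\<^sub>R A' (?g x) ((1 / R) *\<^sub>R b)) \<bullet> b) = ?c * (1 / R) * (\<Sum>b\<in>Basis. A' (?g x) b \<bullet> b)"
      by (simp add: linear_cmul[OF lin] sum_distrib_left)
    then show "(\<Sum>b\<in>Basis. (?c *\<^sub>R A' (?g x) ((1 / R) *\<^sub>R b)) \<bullet> b) < 0"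
      using v'(5)[OF x] l R by (simp add: mult_pos_neg divide_neg_pos)
  qed
qed

lemma orthogonal_projection_exists:
  fixes \<Lambda> :: "'a::euclidean_space set"
  assumes aff: "affine \<Lambda>" "aff_dim \<Lambda> = int m" and w: "w \<in> \<Lambda>"
  obtains P where "orthogonal_projection P m" "\<And>x. x \<notin> \<Lambda> \<Longrightarrow> P (x - w) \<noteq> x - w"
proof -
  define S where "S = (\<lambda>x. x - w) ` \<Lambda>"
  have S: "subspace S" using affine_diffs_subspace_subtract[OF aff(1) w] by (simp add: S_def)
  have "aff_dim \<Lambda> = int (dim S)" unfolding S_def
    using aff_dim_eq_dim_subtract[of w \<Lambda>] w by (simp add: hull_inc)
  then have dim: "dim S = m" using aff(2) by simp
  obtain B where B: "B \<subseteq> S" "pairwise orthogonal B" "\<And>x. x \<in> B \<Longrightarrow> norm x = 1" "independent B" "card B = dim S" "span B = S"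
    using orthonormal_basis_subspace[OF S] by blast
  have fin: "finite B" using B(4) independent_imp_finite by blast
  have on: "b \<bullet> c = (if b = c then 1 else 0)" if "b \<in> B" "c \<in> B" for b c
    using B(2,3) that by (auto simp: pairwise_def orthogonal_def norm_eq_1)
  define P where "P z = (\<Sum>b\<in>B. (z \<bullet> b) *\<^sub>R b)" for z
  have Pb: "P z \<bullet> c = z \<bullet> c" if "c \<in> B" for z c
    using that fin by (simp add: P_def inner_sum_left on sum.delta' if_distrib cong: sum.cong if_cong)
  have "orthogonal_projection P m"
  proof (rule orthogonal_projection.intro)
    show "bounded_linear P" unfolding P_def
      by (intro bounded_linear_sum bounded_linear_scaleR_const bounded_linear_inner_left)
    show "P (P z) = P z" for z unfolding P_def[of "P z"] using Pb by (simp add: P_def)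
    show "P x \<bullet> y = x \<bullet> P y" for x y :: 'a
      by (simp add: P_def inner_sum_left inner_sum_right inner_commute mult.commute)
    have "(\<Sum>e\<in>Basis. P e \<bullet> e) = (\<Sum>b\<in>B. \<Sum>e\<in>Basis. (b \<bullet> e) * (b \<bullet> e))"
      unfolding P_def inner_sum_left inner_scaleR_left by (subst sum.swap) (simp only: inner_commute)
    also have "\<dots> = (\<Sum>b\<in>B. b \<bullet> b)" by (simp flip: euclidean_inner)
    also have "\<dots> = real m" using on B(5) dim by simp
    finally show "(\<Sum>e\<in>Basis. P e \<bullet> e) = real m" .
  qed
  moreover have "P (x - w) \<noteq> x - w" if "x \<notin> \<Lambda>" for x
  proof
    assume "P (x - w) = x - w"
    moreover have "P (x - w) \<in> span B" unfolding P_def by (intro span_sum span_scale span_base)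
    ultimately have "x - w \<in> S" using B(6) by simp
    then show False using that by (auto simp: S_def)
  qed
  ultimately show ?thesis using that by blast
qed

text \<open>Compare \<open>u\<close> with the rescaled barrier \<open>L * v ((x - w) / R) + e\<close> and let \<open>e\<close> tend to zero. The barrier is at
least \<open>1\<close> on the unit sphere and at most \<open>(A + 1) * norm z powr \<beta>\<close> in the ball.\<close>

lemma growth_finite_exponent:
  fixes \<Lambda> \<Omega> :: "(real ^ 'n) set" and p :: real
  assumes m: "m \<le> CARD('n) - 1" and aff: "affine \<Lambda>" "aff_dim \<Lambda> = int m" and w: "w \<in> \<Lambda>"
    and p: "real CARD('n) - real m < p" "1 < p" and \<Omega>: "open \<Omega>" "\<Lambda> \<inter> \<Omega> = {}"
    and sub: "p_subharmonic (ereal p) \<Omega> u"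
    and bd: "\<And>y. y \<in> frontier \<Omega> \<Longrightarrow> Limsup (at y within \<Omega>) (\<lambda>x. ereal (u x)) \<le> 0"
  shows "\<exists>C\<ge>0. \<forall>R>0. \<forall>L>0. (\<forall>y\<in>\<Omega> \<inter> sphere w R. u y \<le> L) \<longrightarrow>
    (\<forall>x\<in>\<Omega> \<inter> ball w R. u x \<le> L * C * (norm (x - w) / R) powr ((p - real CARD('n) + real m) / (p - 1)))"
proof -
  obtain P where P: "orthogonal_projection P m" "\<And>x. x \<notin> \<Lambda> \<Longrightarrow> P (x - w) \<noteq> x - w"
    using orthogonal_projection_exists[OF aff w] by blast
  interpret orthogonal_projection P m by (rule P(1))
  define k where "k = real CARD('n) - real m"
  define b where "b = (p - k) / (p - 1) / 2"
  have n1: "CARD('n) \<ge> 1" by (simp add: Suc_leI)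
  have k1: "k \<ge> 1"
  proof -
    have "m + 1 \<le> CARD('n)" using m n1 by linarith
    then have "real (m + 1) \<le> real CARD('n)" by (rule of_nat_mono)
    then show ?thesis by (simp add: k_def)
  qed
  have k12: "k = 1 \<or> k \<ge> 2"
  proof -
    have "k = real (CARD('n) - m)" using m n1 by (simp add: k_def)
    then show ?thesis using k1 by (cases "CARD('n) - m = 1") auto
  qed
  have kp: "k < p" using p by (simp add: k_def)
  have b: "0 < b" "b \<le> 1/2" using kp p k1 by (auto simp: b_def field_simps)
  have rel: "2 * (p - 1) * (b - 1) + p - 2 + k = 0" using p by (simp add: b_def field_simps)
  (* For k > 1 any c with b < c <= 1 - b would do. For k = 1 both b and 1 - b equal 1/2, but then the
     coefficient k + 2 b - 2 vanishes and c may be larger. *)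
  define c where "c = (if k = 1 then 1 else 1 - b)"
  have c: "b < c" "c \<le> 1"
  proof -
    have "b < 1/2" if "k \<ge> 2" using that p by (auto simp: b_def field_simps)
    then show "b < c" "c \<le> 1" using k12 b by (auto simp: c_def)
  qed
  have b1: "b = 1/2" if "k = 1" using that p by (simp add: b_def)
  obtain A K where AK: "K > 0" "A \<ge> K + 1"
    "\<And>s. 0 < s \<Longrightarrow> s \<le> 1 \<Longrightarrow> 0 < A * b * s powr (b - 1) - K * c * s powr (c - 1)"
    "\<And>s t \<phi> \<psi>. 0 < s \<Longrightarrow> s \<le> 1 \<Longrightarrow> 0 \<le> t \<Longrightarrow> t \<le> 1 \<Longrightarrow>
       \<phi> = A * b * s powr (b - 1) - K * c * s powr (c - 1) \<Longrightarrow>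
       \<psi> = A * b * (b - 1) * s powr (b - 1) - K * c * (c - 1) * s powr (c - 1) \<Longrightarrow>
       \<phi>\<^sup>2 * s * (2 * (p - 1) * \<psi> + (p - 2 + k) * \<phi> + real m) + t * (k * \<phi> + 2 * \<psi> + real m + p - 2) < 0"
  proof (rule barrier_constants[of p b c k "real m"])
    show "k + 2 * b - 2 \<le> 0 \<or> b + c \<le> 1" using b1 by (auto simp: c_def)
    show "0 \<le> k + 2 * c - 2" using k12 b c by (auto simp: c_def)
  qed (use p b c k1 rel that in auto)
  define v where "v z = A * s z powr b - K * s z powr c + t z" for z
  define V where "V z = 2 *\<^sub>R ((A * b * s z powr (b - 1) - K * c * s z powr (c - 1)) *\<^sub>R q z + P z)" for z
  have sup: "strict_supersolution p {z. 0 < s z \<and> norm z < 1} v V"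
    unfolding v_def V_def
    by (rule strict_supersolution_barrier) (use AK(3,4) in \<open>simp_all add: k_def\<close>)
  have mono: "r powr c \<le> r powr b" "r \<le> r powr b" if "0 < r" "r \<le> 1" for r :: real
    using that b c powr_mono'[of b c r] powr_mono'[of b 1 r] by auto
  have vbound: "A * s z powr b - K * s z powr c \<ge> s z" if "0 < s z" "s z \<le> 1" for z
  proof -
    have "K * s z powr c + s z \<le> K * s z powr b + s z powr b"
      using mono[OF that] AK(1) by (intro add_mono mult_left_mono) auto
    also have "\<dots> = (K + 1) * s z powr b" by (simp add: algebra_simps)
    also have "\<dots> \<le> A * s z powr b" using AK(2) by (intro mult_right_mono) auto
    finally show ?thesis by simp
  qed
  have st: "s z \<le> 1" if "norm z \<le> 1" for z
  proof -
    have "(norm z)\<^sup>2 \<le> 1" using that by (simp add: power_le_one)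
    moreover have "0 \<le> t z" by simp
    ultimately show ?thesis using norm_split[of z] by linarith
  qed
  have vlow: "(norm z)\<^sup>2 \<le> v z" if "0 < s z" "norm z \<le> 1" for z
    using vbound[OF that(1) st[OF that(2)]] by (simp only: v_def norm_split)
  have vup: "v z \<le> (A + 1) * norm z powr (2 * b)" if "0 < s z" "norm z \<le> 1" for z
  proof -
    have z: "norm z > 0" using that linear_0[OF bounded_linear.linear[OF lin]] by auto
    have n2: "norm z powr (2 * b) = ((norm z)\<^sup>2) powr b" using z by (simp add: powr_powr flip: powr_numeral)
    have "s z powr b \<le> ((norm z)\<^sup>2) powr b"
      using norm_split[of z] inner_ge_zero[of "P z"] that b by (intro powr_mono2) auto
    then have 1: "A * s z powr b \<le> A * norm z powr (2 * b)" using AK(1,2) n2 by (intro mult_left_mono) auto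
    have "t z \<le> (norm z)\<^sup>2" using norm_split[of z] inner_ge_zero[of "q z"] by linarith
    also have "\<dots> \<le> ((norm z)\<^sup>2) powr b" using that z by (intro mono) (auto simp: power_le_one)
    finally have 2: "t z \<le> norm z powr (2 * b)" using n2 by simp
    have 3: "0 \<le> K * s z powr c" using AK(1) by simp
    have "v z \<le> A * norm z powr (2 * b) + norm z powr (2 * b)" unfolding v_def using 1 2 3 by linarith
    then show ?thesis by (simp add: algebra_simps)
  qed
  have vcont: "isCont v z" if "0 < s z" for z
  proof -
    have "continuous_on {z. 0 < s z} v" unfolding v_def by (intro continuous_intros) auto
    moreover have "open {z. 0 < s z}" by (intro open_Collect_less continuous_intros)
    ultimately show ?thesis using that by (auto simp: continuous_on_eq_continuous_at)
  qed
  have spos: "0 < s ((1 / R) *\<^sub>R (x - w))" if "x \<in> \<Omega>" "R > 0" for x R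
  proof -
    have "P (x - w) \<noteq> x - w" using P(2) \<Omega>(2) that by auto
    moreover have "q ((1 / R) *\<^sub>R (x - w)) = (1 / R) *\<^sub>R q (x - w)"
      by (simp only: linear_cmul[OF bounded_linear.linear[OF lin]] scaleR_diff_right[of _ "x - w" "P (x - w)"])
    ultimately have "q ((1 / R) *\<^sub>R (x - w)) \<noteq> 0" using that by simp
    then show ?thesis using inner_gt_zero_iff by blast
  qed
  have main: "u x \<le> L * (A + 1) * (norm (x - w) / R) powr (2 * b)"
    if R: "R > 0" and L: "L > 0" and sph: "\<forall>y\<in>\<Omega> \<inter> sphere w R. u y \<le> L" and x: "x \<in> \<Omega> \<inter> ball w R" for R L x
  proof -
    let ?g = "\<lambda>x. (1 / R) *\<^sub>R (x - w)"
    have ng: "norm (?g x) = norm (x - w) / R" for x using R by simp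
    have "u x \<le> L * v (?g x)"
    proof (rule field_le_epsilon)
      fix e :: real assume e: "e > 0"
      show "u x \<le> L * v (?g x) + e"
      proof (rule p_subharmonic_comparison[where e=e and v="\<lambda>x. L * v (?g x) + e" and V="\<lambda>x. (L / R) *\<^sub>R V (?g x)" and w=w and R=R and \<Omega>=\<Omega> and u=u and p=p])
        show "strict_supersolution p (\<Omega> \<inter> ball w R) (\<lambda>x. L * v (?g x) + e) (\<lambda>x. (L / R) *\<^sub>R V (?g x))"
        proof (rule strict_supersolution_rescale[OF sup L R])
          fix x assume x: "x \<in> \<Omega> \<inter> ball w R"
          then have "norm (?g x) < 1" using R unfolding ng by (simp add: dist_norm norm_minus_commute)
          then show "?g x \<in> {z. 0 < s z \<and> norm z < 1}" using spos[of x R] x R by blast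
        qed
        show "isCont (\<lambda>x. L * v (?g x) + e) y" if "y \<in> \<Omega> \<inter> cball w R" for y
        proof -
          have "isCont v (?g y)" using vcont spos[of y R] that R by blast
          then have "isCont (\<lambda>x. v (?g x)) y" by (intro isCont_o2[of y ?g v]) (auto intro!: continuous_intros)
          then show ?thesis by (intro continuous_intros)
        qed
        show "e \<le> L * v (?g y) + e" if "y \<in> \<Omega> \<inter> ball w R" for y
        proof -
          have "norm (?g y) \<le> 1" using that R unfolding ng by (simp add: dist_norm norm_minus_commute)
          then have "0 \<le> v (?g y)" using vlow[OF spos[of y R]] that R by (meson IntE order_trans zero_le_power2)
          then show ?thesis using L by simp
        qed
        show "u y < L * v (?g y) + e" if "y \<in> \<Omega> \<inter> sphere w R" for y
        proof -
          have "norm (?g y) = 1" using that R unfolding ng by (simp add: dist_norm norm_minus_commute)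
          then have "1 \<le> v (?g y)" using vlow[OF spos[of y R]] that R by auto
          then have "L * 1 \<le> L * v (?g y)" using L by (intro mult_left_mono) auto
          then show ?thesis using sph that e by force
        qed
      qed (use p \<Omega> sub bd e x in auto)
    qed
    also have "\<dots> \<le> L * ((A + 1) * norm (?g x) powr (2 * b))"
    proof -
      have "norm (?g x) \<le> 1" using x R unfolding ng by (simp add: dist_norm norm_minus_commute)
      then show ?thesis using vup[OF spos[of x R]] x R L by (intro mult_left_mono) auto
    qed
    finally show ?thesis unfolding ng by (simp add: mult.assoc)
  qed
  have "2 * (y / 2) = y" for y :: real by simp
  then have "2 * b = (p - k) / (p - 1)" unfolding b_def .
  also have "p - k = p - real CARD('n) + real m" by (simp add: k_def)
  finally have "2 * b = (p - real CARD('n) + real m) / (p - 1)" .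
  then show ?thesis using main AK by (intro exI[of _ "A + 1"]) auto
qed

text \<open>The infinity-Laplacian of \<open>f (norm (x - w))\<close> is \<open>f'\<^sup>2 f''\<close>, which is negative for a power below \<open>1\<close>; since
\<open>e\<close> is the exponent of the squared norm, this means \<open>e < 1/2\<close>.\<close>

lemma radial_power:
  fixes w :: "real^'n" and d :: real
  assumes e: "0 < e" "e < 1/2" and c: "c > 0" and x: "x \<noteq> w"
  defines "\<psi> \<equiv> \<lambda>x. c * ((x - w) \<bullet> (x - w)) powr e + d"
  shows "\<psi> differentiable (at x)"
    and "partial_deriv i \<psi> differentiable (at x)"
    and "w \<notin> S \<Longrightarrow> continuous_on S (partial_deriv j (partial_deriv i \<psi>))"
    and "infinity_laplacian \<psi> x < 0"
proof -
  define r where "r x = (x - w) \<bullet> (x - w)" for x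
  have rpos: "r x > 0" if "x \<noteq> w" for x using that by (simp add: r_def)
  have r': "(r has_derivative (\<lambda>h. 2 * ((x - w) \<bullet> h))) (at x)" for x
    unfolding r_def[abs_def] by (auto intro!: derivative_eq_intros simp: inner_commute)
  define \<kappa> where "\<kappa> x = 2 * c * e * r x powr (e - 1)" for x
  define \<mu> where "\<mu> x = 4 * c * e * (e - 1) * r x powr (e - 2)" for x
  have pw: "((\<lambda>x. r x powr a) has_derivative (\<lambda>h. a * r x powr (a - 1) * (2 * ((x - w) \<bullet> h)))) (at x)" if "x \<noteq> w" for x a
    using has_derivative_compose[OF r' has_real_derivative_powr[OF rpos[OF that], of a, unfolded has_field_derivative_def]] .
  have D1: "(\<psi> has_derivative (\<lambda>h. (\<kappa> x *\<^sub>R (x - w)) \<bullet> h)) (at x)" if "x \<noteq> w" for x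
  proof -
    have "(\<psi> has_derivative (\<lambda>h. c * (e * r x powr (e - 1) * (2 * ((x - w) \<bullet> h))) + 0)) (at x)"
      unfolding \<psi>_def r_def[symmetric] by (intro has_derivative_add has_derivative_mult_right pw[OF that] has_derivative_const)
    then show ?thesis by (simp add: \<kappa>_def algebra_simps)
  qed
  have P1: "partial_deriv i \<psi> x = \<kappa> x * (x - w) $ i" if "x \<noteq> w" for x i
    using has_derivative_imp_partial(1)[OF D1[OF that]] by simp
  have D2: "(partial_deriv i \<psi> has_derivative (\<lambda>h. ((\<mu> x * (x - w) $ i) *\<^sub>R (x - w) + \<kappa> x *\<^sub>R axis i 1) \<bullet> h)) (at x)"
    if "x \<noteq> w" for x i
  proof -
    have "((\<lambda>x. (x - w) $ i) has_derivative (\<lambda>h. h $ i)) (at x)"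
    proof -
      have "((\<lambda>x. (x - w) \<bullet> axis i 1) has_derivative (\<lambda>h. h \<bullet> axis i 1)) (at x)"
        by (auto intro!: derivative_eq_intros)
      then show ?thesis by (simp add: inner_axis)
    qed
    moreover have "(\<kappa> has_derivative (\<lambda>h. 2 * c * e * ((e - 1) * r x powr (e - 1 - 1) * (2 * ((x - w) \<bullet> h))))) (at x)"
      unfolding \<kappa>_def[abs_def] by (intro has_derivative_mult_right pw[OF that])
    ultimately have "((\<lambda>x. \<kappa> x * (x - w) $ i) has_derivative
      (\<lambda>h. \<kappa> x * h $ i + 2 * c * e * ((e - 1) * r x powr (e - 1 - 1) * (2 * ((x - w) \<bullet> h))) * (x - w) $ i)) (at x)"
      by (intro has_derivative_mult)
    then have "((\<lambda>x. \<kappa> x * (x - w) $ i) has_derivative (\<lambda>h. ((\<mu> x * (x - w) $ i) *\<^sub>R (x - w) + \<kappa> x *\<^sub>R axis i 1) \<bullet> h)) (at x)"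
      by (simp add: \<mu>_def inner_add_left inner_axis' algebra_simps)
    then show ?thesis
      by (rule has_derivative_transform_within_open[of _ _ _ _ "- {w}"]) (use that P1 in auto)
  qed
  have P2: "partial_deriv j (partial_deriv i \<psi>) x = \<mu> x * (x - w) $ i * (x - w) $ j + \<kappa> x * (if i = j then 1 else 0)" if "x \<noteq> w" for x i j
    using has_derivative_imp_partial(1)[OF D2[OF that, of i], of j] by (simp add: axis_def)
  show "\<psi> differentiable (at x)" "partial_deriv i \<psi> differentiable (at x)"
    using D1[OF x] D2[OF x] by (auto simp: differentiable_def)
  show "continuous_on S (partial_deriv j (partial_deriv i \<psi>))" if "w \<notin> S"
  proof -
    have "continuous_on S (\<lambda>x. \<mu> x * (x - w) $ i * (x - w) $ j + \<kappa> x * (if i = j then 1 else 0))"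
      unfolding \<mu>_def \<kappa>_def r_def by (intro continuous_intros) (use that in auto)
    then show ?thesis by (rule continuous_on_eq) (use P2 that in metis)
  qed
  have "infinity_laplacian \<psi> x = (\<Sum>i\<in>UNIV. \<Sum>j\<in>UNIV. (\<kappa> x)\<^sup>2 * \<mu> x * ((x - w) $ i * (x - w) $ i) * ((x - w) $ j * (x - w) $ j)
     + (\<kappa> x)^3 * (if i = j then (x - w) $ i * (x - w) $ j else 0))"
    unfolding infinity_laplacian_def P1[OF x] P2[OF x]
    by (intro sum.cong refl) (simp add: power2_eq_square power3_eq_cube algebra_simps)
  also have "\<dots> = (\<Sum>i\<in>UNIV. (\<kappa> x)\<^sup>2 * \<mu> x * ((x - w) $ i * (x - w) $ i) * r x + (\<kappa> x)^3 * ((x - w) $ i * (x - w) $ i))"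
  proof (intro sum.cong refl)
    fix i :: 'n
    have "r x = (\<Sum>j\<in>UNIV. (x - w) $ j * (x - w) $ j)" by (simp add: r_def inner_vec_def)
    then show "(\<Sum>j\<in>UNIV. (\<kappa> x)\<^sup>2 * \<mu> x * ((x - w) $ i * (x - w) $ i) * ((x - w) $ j * (x - w) $ j)
     + (\<kappa> x)^3 * (if i = j then (x - w) $ i * (x - w) $ j else 0)) = (\<kappa> x)\<^sup>2 * \<mu> x * ((x - w) $ i * (x - w) $ i) * r x + (\<kappa> x)^3 * ((x - w) $ i * (x - w) $ i)"
      by (simp only: sum.distrib sum_distrib_left[symmetric]) simp
  qed
  also have "\<dots> = (\<kappa> x)\<^sup>2 * \<mu> x * r x * r x + (\<kappa> x)^3 * r x"
  proof -
    have r: "r x = (\<Sum>i\<in>UNIV. (x - w) $ i * (x - w) $ i)" by (simp add: r_def inner_vec_def)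
    show ?thesis unfolding sum.distrib sum_distrib_left[symmetric] sum_distrib_right[symmetric] r[symmetric] ..
  qed
  finally have L: "infinity_laplacian \<psi> x = (\<kappa> x)\<^sup>2 * (\<mu> x * r x) * r x + (\<kappa> x)^3 * r x" by (simp only: mult.assoc)
  have \<mu>r: "\<mu> x * r x = 2 * (e - 1) * \<kappa> x"
  proof -
    have "r x powr (e - 2) * r x = r x powr (e - 1)" using rpos[OF x] powr_add[of "r x" "e - 2" 1] by simp
    then show ?thesis by (simp add: \<mu>_def \<kappa>_def mult.assoc)
  qed
  have "infinity_laplacian \<psi> x = (\<kappa> x)^3 * r x * (2 * e - 1)"
    unfolding L \<mu>r by (simp add: power2_eq_square power3_eq_cube algebra_simps)
  moreover have "\<kappa> x > 0" using c e rpos[OF x] by (simp add: \<kappa>_def)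
  ultimately show "infinity_laplacian \<psi> x < 0" using e rpos[OF x] by (simp add: mult_pos_neg)
qed

text \<open>If the bound failed, \<open>u - \<psi>\<close> would attain a maximum inside \<open>\<Omega>\<close>, where \<open>\<psi>\<close> is an admissible test function
with negative infinity-Laplacian.\<close>

lemma infinity_subharmonic_bound:
  fixes \<Omega> :: "(real ^ 'n) set"
  assumes \<Omega>: "open \<Omega>" "w \<notin> \<Omega>" and sub: "p_subharmonic \<infinity> \<Omega> u"
    and bd: "\<And>y. y \<in> frontier \<Omega> \<Longrightarrow> Limsup (at y within \<Omega>) (\<lambda>x. ereal (u x)) \<le> 0"
    and R: "R > 0" and L: "L > 0" and sph: "\<And>y. y \<in> \<Omega> \<inter> sphere w R \<Longrightarrow> u y \<le> L"
    and x: "x \<in> \<Omega> \<inter> ball w R" and a: "0 < a" "a < 1/2"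
  shows "u x \<le> L * (norm (x - w) / R) powr (2 * a)"
proof (rule field_le_epsilon)
  fix e :: real assume e: "e > 0"
  have u: "usc_on \<Omega> u" "viscosity_subsolution \<Omega> u" using sub by (auto simp: p_subharmonic_def)
  define c where "c = L / R powr (2 * a)"
  have c: "c > 0" using L R by (simp add: c_def)
  define \<psi> where "\<psi> x = c * ((x - w) \<bullet> (x - w)) powr a + e" for x
  have \<psi>eq: "\<psi> x = L * (norm (x - w) / R) powr (2 * a) + e" for x
  proof -
    have "((x - w) \<bullet> (x - w)) powr a = norm (x - w) powr (2 * a)"
    proof (cases "x = w")
      case False
      then have "(norm (x - w))\<^sup>2 powr a = norm (x - w) powr (2 * a)"
        by (simp add: powr_powr flip: powr_numeral)
      then show ?thesis by (simp add: power2_norm_eq_inner)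
    qed simp
    then show ?thesis using R by (simp add: \<psi>_def c_def powr_divide)
  qed
  have xw: "x \<noteq> w" if "x \<in> \<Omega>" for x using that \<Omega>(2) by auto
  note rp = radial_power[OF a c xw, where d=e, folded \<psi>_def[abs_def]]
  have cont: "isCont \<psi> y" if "y \<in> \<Omega>" for y
    using rp(1)[OF that] by (rule differentiable_imp_continuous_within)
  have ck: "Ck_on 2 \<psi> \<Omega>"
    unfolding numeral_2_eq_2 Ck_on.simps using rp(1,2) rp(3)[OF _ \<Omega>(2)] x by blast
  have "u x \<le> \<psi> x"
  proof (rule ccontr)
    assume n: "\<not> u x \<le> \<psi> x"
    let ?D = "{x \<in> \<Omega> \<inter> ball w R. \<psi> x \<le> u x}"
    have K: "compact (closure ?D)" "closure ?D \<subseteq> \<Omega> \<inter> ball w R"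
    proof -
      have 1: "\<And>y. y \<in> \<Omega> \<inter> cball w R \<Longrightarrow> isCont \<psi> y" using cont by blast
      have 2: "\<And>x. x \<in> \<Omega> \<inter> ball w R \<Longrightarrow> e \<le> \<psi> x" using c by (simp add: \<psi>_def)
      have 3: "u y < \<psi> y" if "y \<in> \<Omega> \<inter> sphere w R" for y
      proof -
        have "norm (y - w) / R = 1" using that R by (simp add: dist_norm norm_minus_commute)
        then have "\<psi> y = L + e" unfolding \<psi>eq by (simp only: powr_one_eq_one mult_1_right)
        then show ?thesis using sph[OF that] e by simp
      qed
      note sc = superlevel_compact[OF \<Omega>(1) u(1), of w R \<psi> e]
      show "compact (closure ?D)" by (rule sc(1)) (fact bd 1 e 2 3)+
      show "closure ?D \<subseteq> \<Omega> \<inter> ball w R" by (rule sc(2)) (fact bd 1 e 2 3)+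
    qed
    have xD: "x \<in> ?D" using x n by auto
    have xc: "x \<in> closure ?D" by (rule subsetD[OF closure_subset xD])
    have K'1: "closure ?D \<subseteq> \<Omega>" by (rule order_trans[OF K(2) Int_lower1])
    have K'2: "closure ?D \<noteq> {}" by (rule notI) (use xc in \<open>simp only: empty_iff\<close>)
    have "\<exists>x0\<in>closure ?D. \<forall>y\<in>closure ?D. u y - \<psi> y \<le> u x0 - \<psi> x0"
      by (rule usc_attains_sup[OF \<Omega>(1) u(1) K(1) K'1 K'2]) (rule cont, rule subsetD[OF K'1])
    then obtain x0 where x0: "x0 \<in> closure ?D" "\<And>y. y \<in> closure ?D \<Longrightarrow> u y - \<psi> y \<le> u x0 - \<psi> x0"
      by blast
    have max: "u y - \<psi> y \<le> u x0 - \<psi> x0" if "y \<in> \<Omega> \<inter> ball w R" for y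
    proof (cases "y \<in> ?D")
      case True
      then show ?thesis by (intro x0(2) subsetD[OF closure_subset])
    next
      case False
      then have "u y - \<psi> y < 0" using that by auto
      also have "0 \<le> u x - \<psi> x" using n by simp
      also have "\<dots> \<le> u x0 - \<psi> x0" using x0(2)[OF xc] .
      finally show ?thesis by simp
    qed
    have x0U: "x0 \<in> \<Omega> \<inter> ball w R" using x0(1) K(2) by blast
    have "open (\<Omega> \<inter> ball w R)" using \<Omega> by auto
    then obtain r where "r > 0" "ball x0 r \<subseteq> \<Omega> \<inter> ball w R" using x0U open_contains_ball by blast
    then have "\<exists>r>0. \<forall>x\<in>ball x0 r \<inter> \<Omega>. u x - \<psi> x \<le> u x0 - \<psi> x0" using max by blast
    then have "0 \<le> infinity_laplacian \<psi> x0"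
      using u(2) ck x0U unfolding viscosity_subsolution_def by blast
    then show False using rp(4)[of x0] x0U by auto
  qed
  then show "u x \<le> L * (norm (x - w) / R) powr (2 * a) + e" by (simp add: \<psi>eq)
qed

lemma growth_infinite_exponent:
  fixes \<Omega> :: "(real ^ 'n) set"
  assumes \<Omega>: "open \<Omega>" "w \<notin> \<Omega>" and sub: "p_subharmonic \<infinity> \<Omega> u"
    and bd: "\<And>y. y \<in> frontier \<Omega> \<Longrightarrow> Limsup (at y within \<Omega>) (\<lambda>x. ereal (u x)) \<le> 0"
    and R: "R > 0" and L: "L > 0" and sph: "\<And>y. y \<in> \<Omega> \<inter> sphere w R \<Longrightarrow> u y \<le> L"
    and x: "x \<in> \<Omega> \<inter> ball w R"
  shows "u x \<le> L * (norm (x - w) / R) powr 1"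
proof -
  have pos: "norm (x - w) / R \<noteq> 0" using x \<Omega>(2) R by auto
  have "((\<lambda>a. L * (norm (x - w) / R) powr (2 * a)) \<longlongrightarrow> L * (norm (x - w) / R) powr (2 * (1/2))) (at_left (1/2))"
    by (intro tendsto_intros) (use pos in auto)
  moreover have "\<forall>\<^sub>F a in at_left (1/2::real). u x \<le> L * (norm (x - w) / R) powr (2 * a)"
  proof -
    have "\<forall>\<^sub>F a in at_left (1/2::real). a \<in> {0<..<1/2}" by (rule eventually_at_leftI[of 0]) auto
    then show ?thesis
      by eventually_elim (use infinity_subharmonic_bound[OF \<Omega> sub bd R L sph x] in auto)
  qed
  ultimately have "u x \<le> L * (norm (x - w) / R) powr (2 * (1/2))"
    by (intro tendsto_lowerbound) auto
  then show ?thesis by simp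
qed

theorem corollary3:
  fixes \<Lambda> \<Omega> :: "(real ^ 'n) set"
    and w :: "real ^ 'n"
    and u :: "real ^ 'n \<Rightarrow> real"
    and m :: nat
    and p :: ereal
  assumes "m \<le> CARD('n) - 1"
    and "affine \<Lambda>" and "aff_dim \<Lambda> = int m"
    and "w \<in> \<Lambda>"
    and "ereal (real CARD('n) - real m) < p" and "1 < p"
    and "open \<Omega>" and "connected \<Omega>" and "\<not> bounded \<Omega>"
    and "\<Lambda> \<inter> \<Omega> = {}"
    and "p_subharmonic p \<Omega> u"
    and "\<And>y. y \<in> frontier \<Omega> \<Longrightarrow> Limsup (at y within \<Omega>) (\<lambda>x. ereal (u x)) \<le> 0"
  shows "(\<forall>x\<in>\<Omega>. u x \<le> 0) \<or>
    0 < Liminf at_top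
      (\<lambda>R::real. sphere_sup \<Omega> u w R / ereal (R powr growth_exponent CARD('n) m p))"
proof (rule disjCI)
  let ?\<beta> = "growth_exponent CARD('n) m p"
  let ?M = "\<lambda>R::real. sphere_sup \<Omega> u w R / ereal (R powr ?\<beta>)"
  assume n: "\<not> 0 < Liminf at_top ?M"
  have w: "w \<notin> \<Omega>" using assms by auto
  have "\<exists>C\<ge>0. \<forall>R>0. \<forall>L>0. (\<forall>y\<in>\<Omega> \<inter> sphere w R. u y \<le> L) \<longrightarrow>
    (\<forall>x\<in>\<Omega> \<inter> ball w R. u x \<le> L * C * (norm (x - w) / R) powr ?\<beta>)"
  proof (cases p)
    case (real r)
    have r: "real CARD('n) - real m < r" "1 < r" using assms real by auto
    show ?thesis
      using growth_finite_exponent[OF assms(1-4) r assms(7,10) assms(11)[unfolded real] assms(12)] real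
      by (simp add: growth_exponent_def)
  next
    case PInf
    have s: "p_subharmonic \<infinity> \<Omega> u" using assms(11) PInf by simp
    show ?thesis
      using growth_infinite_exponent[OF assms(7) w s assms(12)] PInf
      by (intro exI[of _ 1]) (simp add: growth_exponent_def)
  qed (use assms in auto)
  then obtain C where C: "C \<ge> 0" and C2: "\<forall>R>0. \<forall>L>0. (\<forall>y\<in>\<Omega> \<inter> sphere w R. u y \<le> L) \<longrightarrow>
    (\<forall>x\<in>\<Omega> \<inter> ball w R. u x \<le> L * C * (norm (x - w) / R) powr ?\<beta>)"
    by (elim exE conjE)
  show "\<forall>x\<in>\<Omega>. u x \<le> 0"
  proof (rule ballI, rule field_le_epsilon)
    fix x and e :: real assume x: "x \<in> \<Omega>" and e: "0 < e"
    define c where "c = C * norm (x - w) powr ?\<beta>"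
    have c: "c \<ge> 0" using C by (simp add: c_def)
    define \<eta> where "\<eta> = e / (c + 1)"
    have \<eta>: "\<eta> > 0" "\<eta> * c \<le> e" using c e by (auto simp: \<eta>_def field_simps)
    have "\<not> (\<forall>\<^sub>F R in at_top. ereal \<eta> \<le> ?M R)"
    proof
      assume "\<forall>\<^sub>F R in at_top. ereal \<eta> \<le> ?M R"
      then have "ereal \<eta> \<le> Liminf at_top ?M" by (rule Liminf_bounded)
      then show False using n \<eta>(1) by (metis ereal_less(2) less_le_trans)
    qed
    then have "\<exists>R > norm (x - w). ?M R < ereal \<eta>"
      unfolding eventually_at_top_dense by (metis not_le)
    then obtain R where R: "norm (x - w) < R" "?M R < ereal \<eta>" by blast
    have R0: "R > 0" using R(1) norm_ge_zero[of "x - w"] by linarith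
    have Rp: "R powr ?\<beta> > 0" using R0 by simp
    have "sphere_sup \<Omega> u w R < ereal (R powr ?\<beta>) * ereal \<eta>"
      using R(2) Rp by (subst (asm) ereal_divide_less_pos) auto
    then have ss: "sphere_sup \<Omega> u w R < ereal (\<eta> * R powr ?\<beta>)" by (simp add: mult.commute)
    have "u y \<le> \<eta> * R powr ?\<beta>" if "y \<in> \<Omega> \<inter> sphere w R" for y
    proof -
      have "y \<in> frontier (ball w R) \<inter> \<Omega>" using that R0 by (simp add: frontier_ball)
      then have "ereal (u y) \<le> sphere_sup \<Omega> u w R" unfolding sphere_sup_def by (rule SUP_upper)
      then have "ereal (u y) < ereal (\<eta> * R powr ?\<beta>)" using ss by (rule le_less_trans)
      then show ?thesis by simp
    qed
    then have "u x \<le> \<eta> * R powr ?\<beta> * C * (norm (x - w) / R) powr ?\<beta>"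
      using R0 \<eta>(1) Rp x R(1)
      by (intro C2[rule_format]) (auto simp: dist_norm norm_minus_commute intro: mult_pos_pos)
    also have "\<dots> = \<eta> * c" using R0 by (simp add: c_def powr_divide)
    finally show "u x \<le> 0 + e" using \<eta>(2) by simp
  qed
qed

end
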